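(* Assume the Riemann hypothesis and that $A:=2\sum_{k\ge1}|c(i\gamma_k)|$ is finite. Then $\Delta(s)\to0$ uniformly as $|s|\to\infty$ on $S=\{s\in\mathbb{C}:|\operatorname{Re}(s)|\ge\tfrac12\}$.
   Context: $\zeta$ is the Riemann zeta-function; $a(s)=\pi^{-s/2}s\,\Gamma(s/2)(s-1)$; $\xi(s)=\tfrac12a(s)\zeta(s)$ (entire); $n(s)=\sin(\pi s/4)\cdot2\xi(\tfrac12+s)$ (entire); $f(s)=1/n(s)$. $c(z)=1/n'(z)$ whenever $n'(z)\ne0$ (this holds at every $z=4w$, $w\in\mathbb{Z}$). $\gamma_1<\gamma_2<\cdots$ enumerate the distinct imaginary parts of the zeros of $\zeta$ with positive imaginary part. Finiteness of $A$ includes the requirement $n'(i\gamma_k)\ne0$ for all $k\ge1$. $Z^\circ=4\mathbb{Z}\cup Z_i$, with $Z_i$ the set of nonreal zeros of $\zeta(\tfrac12+s)$. $p(s)=p_r(s)+p_i(s)$ with $p_r(s)=\frac{c(0)}{s}+\sum_{w\ge1}c(4w)\big(\frac1{s-4w}+\frac1{s+4w}\big)$ and $p_i(s)=\sum_{k\ge1}c(i\gamma_k)\big(\frac1{s-i\gamma_k}+\frac1{s+i\gamma_k}\big)$. Under the hypotheses, $f-p$ extends analytically from $\mathbb{C}\setminus Z^\circ$ to an entire function, denoted $\Delta$. "$g(s)\to0$ uniformly as $|s|\to\infty$ on $D$" means: for every $\varepsilon>0$ there is $R$ with $|g(s)|<\varepsilon$ for all $s\in D$ with $|s|\ge R$.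 *)

theory Defs
  imports "HOL-Complex_Analysis.Complex_Analysis"
begin

text \<open>
  The Riemann zeta function is the analytic continuation of its Dirichlet series to the
  punctured plane; the identity theorem makes the continuation unique there. The value
  at the pole \<open>1\<close> is left unspecified, and nothing below depends on it.
\<close>

definition zeta :: "complex \<Rightarrow> complex" where
  "zeta = (SOME g. g holomorphic_on - {1} \<and>
             (\<forall>s. Re s > 1 \<longrightarrow> (\<lambda>m. of_nat (Suc m) powr (- s)) sums g s))"

definition riemann_hypothesis :: bool where
  "riemann_hypothesis \<longleftrightarrow>
     (\<forall>s. zeta s = 0 \<and> 0 < Re s \<and> Re s < 1 \<longrightarrow> Re s = 1 / 2)"

definition a_fun :: "complex \<Rightarrow> complex" where
  "a_fun s = of_real pi powr (- s / 2) * s * Gamma (s / 2) * (s - 1)"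

text \<open>
  The product \<open>a_fun s * zeta s / 2\<close> is undefined at \<open>1\<close> and at the poles \<open>0, -2, -4, \<dots>\<close> of
  \<open>Gamma (s / 2)\<close> (where \<^const>\<open>Gamma\<close> takes the value \<open>0\<close> by convention). These singularities are
  removable, and \<open>xi\<close> is the resulting entire function.
\<close>

definition xi :: "complex \<Rightarrow> complex" where
  "xi = remove_sings (\<lambda>s. 1 / 2 * a_fun s * zeta s)"

definition n_fun :: "complex \<Rightarrow> complex" where
  "n_fun s = sin (of_real pi * s / 4) * (2 * xi (1 / 2 + s))"

definition f_fun :: "complex \<Rightarrow> complex" where
  "f_fun s = 1 / n_fun s"

definition c_fun :: "complex \<Rightarrow> complex" where
  "c_fun z = 1 / deriv n_fun z"

definition Z_i :: "complex set" where
  "Z_i = {s. s \<notin> \<real> \<and> zeta (1 / 2 + s) = 0}"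

definition Z_circ :: "complex set" where
  "Z_circ = {s. \<exists>w::int. s = 4 * of_int w} \<union> Z_i"

definition p_r :: "complex \<Rightarrow> complex" where
  "p_r s = c_fun 0 / s +
     (\<Sum>m. c_fun (4 * of_nat (Suc m)) *
            (1 / (s - 4 * of_nat (Suc m)) + 1 / (s + 4 * of_nat (Suc m))))"

text \<open>
  Sequences of ordinates are indexed from \<open>0\<close>, so \<open>\<gamma> k\<close> is the ordinate written
  $\gamma_{k+1}$ in the usual numbering.
\<close>

definition p_i :: "(nat \<Rightarrow> real) \<Rightarrow> complex \<Rightarrow> complex" where
  "p_i \<gamma> s = (\<Sum>k. c_fun (\<i> * of_real (\<gamma> k)) *
                  (1 / (s - \<i> * of_real (\<gamma> k)) + 1 / (s + \<i> * of_real (\<gamma> k))))"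

definition p_fun :: "(nat \<Rightarrow> real) \<Rightarrow> complex \<Rightarrow> complex" where
  "p_fun \<gamma> s = p_r s + p_i \<gamma> s"

end

theory Submission
  imports Defs
begin

text \<open>
  The functional equation is obtained on real \<open>s = -\<alpha>\<close> with \<open>0 < \<alpha> < 1\<close> by computing
  the Mellin transform of \<open>1/(e\<^sup>x - 1) - 1/x + 1/2\<close> twice by Tonelli: from the partial
  fractions of the hyperbolic cotangent one gets the Dirichlet series at \<open>1 + \<alpha>\<close>, and from the
  trapezoidal errors of the functions \<open>u \<mapsto> e\<^bsup>-xu\<^esup>\<close> on the unit intervals one gets the
  Euler--Maclaurin continuation of zeta at \<open>-\<alpha>\<close>. The identity theorem does the rest, and the
  reflected function also provides the continuation of zeta to the whole plane.

  Since \<open>\<Delta>\<close> is entire, the maximum principle on unit discs about the points \<open>4w\<close> reduces the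
  decay to points at distance at least \<open>1\<close> from those. There both pole series tend to \<open>0\<close> by
  dominated convergence, because their coefficients are absolutely summable and the imaginary poles
  stay at distance \<open>1/2\<close>. For \<open>f\<close>, the exponential growth of the sine cancels the exponential
  decay of Gamma in the imaginary direction, as \<open>\<bar>\<Gamma>(x + iy)\<bar>/\<Gamma>(x)\<close> increases with \<open>x\<close> and is
  explicit at \<open>x = 1/2\<close>. What remains is a factor of order \<open>\<bar>s\<bar>\<^sup>2\<close> times \<open>zeta (1/2 + s)\<close> to
  the right of the line \<open>Re = 1\<close>, where the inequality \<open>3 + 4 cos \<theta> + cos 2\<theta> \<ge> 0\<close> yields a
  lower bound of order \<open>\<bar>s\<bar>\<^bsup>-4/3\<^esup>\<close>.
\<close>

section \<open>Partial fractions of the cotangent\<close>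

text \<open>\<open>zeta\<close> is defined by choice, so its definition says nothing until some
  continuation has been built; hence the long construction. The Riemann hypothesis enters through
  the zeros: it identifies those of \<open>n_fun\<close> with the points 4w and +-i
  \<open>\<gamma> k\<close>, where f and p must have equal principal parts. One gap remains there:
  the hypothesis is compatible with zeta(1/2) = 0, and such a zero would lie outside
  \<open>Z_i\<close> and meet the zero of the sine at 0, so zeta(1/2) is shown nonzero separately.
  The half-planes |Re s| >= 1/2 are those where 1/2 + s or 1/2 - s has real part at least 1, the
  range of the 3-4-1 method. Origin of the exponents: if zeta is O(|t|^\<theta>) on Re >= 3/4, then
  balancing in the 3-4-1 method gives a lower bound of order |t|^(-4\<theta>). Interpolating the
  Euler--Maclaurin terms permits any \<theta> > 1/4, and the factor |s|^2 outweighs the loss when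
  \<theta> < 1/2. The choice \<theta> = 1/3 leaves growth |s|^(2/3) for
  \<open>n_fun\<close>.\<close>

lemma Digamma_reflection:
  fixes z :: complex
  assumes "z \<notin> \<int>"
  shows "Digamma (1 - z) - Digamma z = of_real pi * cos (of_real pi * z) / sin (of_real pi * z)"
proof -
  have nz: "z \<notin> \<int>\<^sub>\<le>\<^sub>0" using assms nonpos_Ints_Int by blast
  have nz': "1 - z \<notin> \<int>\<^sub>\<le>\<^sub>0"
  proof
    assume "1 - z \<in> \<int>\<^sub>\<le>\<^sub>0"
    hence "1 - (1 - z) \<in> \<int>" by (intro Ints_diff) (auto simp: nonpos_Ints_Int)
    with assms show False by simp
  qed
  have sn: "sin (of_real pi * w) \<noteq> 0" if "w \<notin> \<int>" for w :: complex
  proof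
    assume "sin (of_real pi * w) = 0"
    then obtain n :: int where "of_real pi * w = of_real (of_int n * pi)"
      by (auto simp: sin_eq_0)
    hence "w = of_int n" by simp
    thus False using that by auto
  qed
  have "((\<lambda>w. Gamma w * Gamma (1 - w)) has_field_derivative
          (Gamma z * Gamma (1 - z)) * (Digamma z - Digamma (1 - z))) (at z)"
    using nz nz' by (auto intro!: derivative_eq_intros simp: algebra_simps)
  moreover have "(\<lambda>w. Gamma w * Gamma (1 - w)) = (\<lambda>w::complex. of_real pi / sin (of_real pi * w))"
    by (simp add: Gamma_reflection_complex)
  moreover have "((\<lambda>w. of_real pi / sin (of_real pi * w)) has_field_derivative
          (- ((of_real pi)^2 * cos (of_real pi * z) / sin (of_real pi * z)^2))) (at z)"
    using sn[OF assms] by (auto intro!: derivative_eq_intros simp: power2_eq_square)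
  ultimately have eq: "(of_real pi / sin (of_real pi * z)) * (Digamma z - Digamma (1 - z)) =
       - ((of_real pi)^2 * cos (of_real pi * z) / sin (of_real pi * z)^2)"
    by (metis DERIV_unique)
  have "b - a = P * c / S" if "P / S * (a - b) = - (P^2 * c / S^2)" "S \<noteq> 0" "P \<noteq> 0" for a b c P S :: complex
  proof -
    have "b - a = - (S / P) * (P / S * (a - b))" using that(2,3) by simp
    also have "\<dots> = P * c / S" unfolding that(1) using that(2,3) by (simp add: power2_eq_square)
    finally show ?thesis .
  qed
  from this[OF eq sn[OF assms]] show ?thesis by simp
qed

lemma cot_partial_fractions:
  fixes z :: complex
  assumes "z \<notin> \<int>"
  shows "(\<lambda>k. 2 * z / (z^2 - of_nat (Suc k)^2)) sums
           (of_real pi * cos (of_real pi * z) / sin (of_real pi * z) - 1 / z)"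
proof -
  have z0: "z \<noteq> 0" "1 - z \<noteq> 0" using assms by auto
  have nz: "of_nat n + z \<noteq> 0" "z - of_nat n \<noteq> 0" for n
  proof -
    have "z = - of_nat n \<Longrightarrow> z \<in> \<int>" by simp
    thus "of_nat n + z \<noteq> 0" using assms by (metis add_eq_0_iff)
    show "z - of_nat n \<noteq> 0" using assms by auto
  qed
  have "(\<lambda>m. (\<Sum>n<m. inverse (z + of_nat n)) - (\<Sum>n<m. inverse (1 - z + of_nat n))) \<longlonglongrightarrow>
      Digamma (1 - z) - Digamma z"
    using tendsto_diff[OF Digamma_LIMSEQ[OF z0(2)] Digamma_LIMSEQ[OF z0(1)]] by simp
  hence "(\<lambda>m. (\<Sum>n<Suc m. inverse (z + of_nat n)) - (\<Sum>n<Suc m. inverse (1 - z + of_nat n))) \<longlonglongrightarrow>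
      Digamma (1 - z) - Digamma z" by (rule LIMSEQ_Suc)
  moreover have "(\<lambda>m. inverse (1 - z + of_nat m)) \<longlonglongrightarrow> 0"
    by (intro tendsto_inverse_0[THEN filterlim_compose] tendsto_add_filterlim_at_infinity[OF tendsto_const])
       (rule tendsto_of_nat)
  \<comment> \<open>The two Digamma limits cancel their logarithms. The term 1/(1 - z + m), which
    tends to 0, removes the last summand of the second sum, so that 1/(z + k + 1) is paired with
    1/(z - k - 1) and only 1/z is left over.\<close>
  ultimately have "(\<lambda>m. (\<Sum>n<Suc m. inverse (z + of_nat n)) - (\<Sum>n<Suc m. inverse (1 - z + of_nat n))
      + inverse (1 - z + of_nat m) - 1 / z) \<longlonglongrightarrow> Digamma (1 - z) - Digamma z + 0 - 1 / z"
    by (intro tendsto_add tendsto_diff[where b = "1/z"] tendsto_const)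
  moreover have "(\<Sum>n<Suc m. inverse (z + of_nat n)) - (\<Sum>n<Suc m. inverse (1 - z + of_nat n))
      + inverse (1 - z + of_nat m) - 1 / z = (\<Sum>k<m. 2 * z / (z^2 - of_nat (Suc k)^2))" for m
  proof (induction m)
    case 0
    show ?case by (simp add: field_simps)
  next
    case (Suc m)
    have *: "2 * z / (z^2 - of_nat (Suc m)^2) = inverse (z + of_nat (Suc m)) - inverse (1 - z + of_nat m)"
    proof -
      have a: "z + of_nat (Suc m) \<noteq> 0" "z - of_nat (Suc m) \<noteq> 0" 
        using nz[of "Suc m"] by (simp_all add: add.commute)
      define b where "b = z - of_nat (Suc m)"
      define c where "c = z + of_nat (Suc m)"
      have e: "1 - z + of_nat m = - b" "z^2 - of_nat (Suc m)^2 = c * b" "2 * z = c + b"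
        by (simp_all add: b_def c_def algebra_simps power2_eq_square)
      have "c \<noteq> 0" "b \<noteq> 0" using a by (simp_all only: b_def c_def not_False_eq_True)
      hence "(c + b) / (c * b) = inverse c - inverse (- b)" by (simp add: field_simps)
      thus ?thesis unfolding e c_def[symmetric] .
    qed
    show ?case unfolding sum.lessThan_Suc[of _ "m"] Suc.IH[symmetric] * by simp
  qed
  ultimately show ?thesis using Digamma_reflection[OF assms] by (simp add: sums_def)
qed

text \<open>Half the hyperbolic cotangent of x/2 equals 1/(exp x - 1) + 1/2, so this is the
  cotangent expansion at the imaginary point i x / (2 pi), multiplied by i / (2 pi).\<close>

lemma coth_partial_fractions:
  fixes x :: real
  assumes "x > 0"
  shows "(\<lambda>k. 2 * x / (x^2 + (2 * pi * real (Suc k))^2)) sums (1 / (exp x - 1) - 1 / x + 1 / 2)"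
proof -
  define z where "z = \<i> * of_real (x / (2 * pi))"
  have z: "z \<notin> \<int>" using assms by (auto simp: z_def elim!: Ints_cases simp: complex_eq_iff)
  have piz: "of_real pi * z = \<i> * of_real (x/2)" by (simp add: z_def)
  have z2: "z^2 = - of_real ((x / (2*pi))^2)" by (simp add: z_def power_mult_distrib power_divide)
  define E where "E = exp (x / 2)"
  have E: "E > 1" "E * E = exp x" using assms by (simp_all add: E_def flip: exp_add)
  have Em: "exp (- (x/2)) = 1 / E" by (simp add: E_def exp_minus field_simps)
  have E': "exp (of_real (x/2)) = (of_real E :: complex)" unfolding E_def by (rule exp_of_real)
  have Em': "exp (- of_real (x/2)) = (1 / of_real E :: complex)"
    using arg_cong[OF Em, of complex_of_real] by (simp flip: exp_of_real)
  have c: "cos (of_real pi * z) = (of_real ((E + 1 / E) / 2) :: complex)"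
    unfolding piz cos_exp_eq using E' Em' by (simp)
  have s: "sin (of_real pi * z) = \<i> * (of_real ((E - 1 / E) / 2) :: complex)"
    unfolding piz sin_exp_eq using E' Em' by (simp add: field_simps)
  define S where "S = (E - 1 / E) / 2" define C where "C = (E + 1 / E) / 2"
  have S: "S > 0" 
  proof -
    have "1 / E < 1" using E by simp
    hence "0 < E - 1 / E" using E(1) by linarith
    thus ?thesis by (simp only: S_def half_gt_zero_iff)
  qed
  have "(\<lambda>k. (\<i> / of_real (2 * pi)) * (2 * z / (z^2 - of_nat (Suc k)^2))) sums
           ((\<i> / of_real (2*pi)) * (of_real pi * cos (of_real pi * z) / sin (of_real pi * z) - 1 / z))"
    by (intro sums_mult cot_partial_fractions z)
  also have "(\<lambda>k. (\<i> / of_real (2 * pi)) * (2 * z / (z^2 - of_nat (Suc k)^2))) = 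
      (\<lambda>k. of_real (2 * x / (x^2 + (2 * pi * real (Suc k))^2)))"
  proof
    fix k
    define y where "y = x / (2*pi)"
    define m where "m = real (Suc k)"
    have "y > 0" using assms by (simp add: y_def)
    hence p: "y^2 + m^2 > 0" by (simp add: add_pos_nonneg)
    have "(\<i> / of_real (2 * pi)) * (2 * z / (z^2 - of_nat (Suc k)^2)) =
       (\<i> / of_real (2 * pi)) * (2 * (\<i> * of_real y) / (- (of_real (y^2 + m^2))))"
      unfolding z2 by (simp add: z_def y_def m_def)
    also have "\<dots> = of_real (y / pi / (y^2 + m^2))"
    proof -
      have "\<i> / of_real (2 * pi) * (2 * (\<i> * Y) / - W) = Y / of_real pi / W" for Y W :: complex
        by (cases "W = 0") (simp_all add: field_simps)
      thus ?thesis unfolding of_real_divide by blast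
    qed
    also have "y / pi / (y^2 + m^2) = 2 * x / (x^2 + (2 * pi * m)^2)"
    proof -
      have x: "x = 2 * pi * y" by (simp add: y_def)
      have "x^2 + (2 * pi * m)^2 = 4 * pi^2 * (y^2 + m^2)" unfolding x by (simp add: algebra_simps power2_eq_square)
      hence "2 * x / (x^2 + (2 * pi * m)^2) = 2 * (2 * pi * y) / (4 * pi^2 * (y^2 + m^2))" unfolding x by simp
      also have "\<dots> = y / pi / (y^2 + m^2)"
      proof -
        have "2 * (2 * pi * y) / (4 * pi^2 * W) = y / pi / W" if "W > 0" for W
          using that by (simp add: field_simps power2_eq_square)
        from this[OF p] show ?thesis .
      qed
      finally show ?thesis ..
    qed
    finally show "(\<i> / of_real (2 * pi)) * (2 * z / (z^2 - of_nat (Suc k)^2)) = 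
      of_real (2 * x / (x^2 + (2 * pi * real (Suc k))^2))" by (simp add: m_def)
  qed
  also have "(\<i> / of_real (2*pi)) * (of_real pi * cos (of_real pi * z) / sin (of_real pi * z) - 1 / z) = 
      complex_of_real (C / S / 2 - 1 / x)"
    unfolding c s S_def[symmetric] C_def[symmetric] using S assms
    by (simp add: z_def field_simps)
  also have "C / S / 2 - 1 / x = 1 / (exp x - 1) - 1 / x + 1 / 2"
  proof -
    have q: "C / S = (E * E + 1) / (E * E - 1)" 
    proof -
      have "E + 1 / E = (E * E + 1) / E" "E - 1 / E = (E * E - 1) / E" "E \<noteq> 0"
        using E(1) by (simp_all add: field_simps)
      thus ?thesis unfolding S_def C_def by simp
    qed
    have "(e + 1) / (e - 1) / 2 = 1 / (e - 1) + 1 / 2" if "e > 1" for e :: real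
      using that by (simp add: field_simps)
    from this[of "exp x"] have r: "(exp x + 1) / (exp x - 1) / 2 = 1 / (exp x - 1) + 1 / 2" using assms by simp
    show ?thesis unfolding q E(2) r by simp
  qed
  finally show ?thesis by (simp only: sums_of_real_iff)
qed

section \<open>Mellin transforms\<close>

text \<open>The substitution t = v u^p in Euler's integral. The parameter \<open>p\<close> covers
  the plain exponential (\<open>p = 1\<close>) and the Gaussian (\<open>p = 2\<close>); with
  nonnegative integrals the later interchanges require measurability only.\<close>

lemma Gamma_nn_integral_powr:
  fixes a v p :: real
  assumes "a > 0" "v > 0" "p > 0"
  shows "(\<integral>\<^sup>+u. ennreal (indicator {0<..} u * (u powr (p * a - 1) * exp (- v * u powr p))) \<partial>lborel)
           = ennreal (Gamma a / (p * v powr a))"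
proof -
  define f where "f = (\<lambda>t::real. t powr (a - 1) / exp t)"
  define g where "g = (\<lambda>u::real. v * u powr p)"
  have "(f has_integral Gamma a) {0..}"
    unfolding f_def using assms by (intro Gamma_integral_real)
  hence F: "(f has_integral Gamma a) {0<..}"
    by (subst has_integral_spike_set_eq[where T = "{0..}"]) (auto intro: negligible_subset[of "{0}"])
  have F': "f absolutely_integrable_on {0<..}"
    by (rule nonnegative_absolutely_integrable_1) (use F in \<open>auto simp: f_def integrable_on_def\<close>)
  have "inj_on g {0<..}"
  proof (rule inj_onI)
    fix x y :: real assume "x \<in> {0<..}" "y \<in> {0<..}" "g x = g y"
    hence "(x powr p) powr (1/p) = (y powr p) powr (1/p)" "x > 0" "y > 0" using assms by (auto simp: g_def)
    thus "x = y" using assms by (simp add: powr_powr)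
  qed
  moreover have img: "g ` {0<..} = {0<..}"
  proof (intro equalityI subsetI)
    fix y :: real assume y: "y \<in> {0<..}"
    hence "y = g ((y / v) powr (1 / p))" using assms by (simp add: g_def powr_powr)
    thus "y \<in> g ` {0<..}" using y assms by auto
  qed (use assms in \<open>auto simp: g_def\<close>)
  moreover have "(g has_field_derivative v * (p * u powr (p - 1))) (at u within {0<..})" if "u \<in> {0<..}" for u
    unfolding g_def using that by (auto intro!: derivative_eq_intros)
  ultimately have "(\<lambda>u. \<bar>v * (p * u powr (p - 1))\<bar> * f (g u)) absolutely_integrable_on {0<..} \<and>
       integral {0<..} (\<lambda>u. \<bar>v * (p * u powr (p - 1))\<bar> * f (g u)) = Gamma a"
    using F F' by (subst has_absolute_integral_change_of_variables_1') auto
  hence "((\<lambda>u. \<bar>v * (p * u powr (p - 1))\<bar> * f (g u)) has_integral Gamma a) {0<..}"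
    by (auto simp: has_integral_iff absolutely_integrable_on_def)
  hence "((\<lambda>u. (p * v powr a) * (u powr (p * a - 1) * exp (- v * u powr p))) has_integral Gamma a) {0<..}"
  proof (rule has_integral_eq[rotated])
    fix u :: real assume "u \<in> {0<..}"
    hence u: "u > 0" by simp
    have "\<bar>v * (p * u powr (p - 1))\<bar> * f (g u) =
       p * (v * v powr (a - 1)) * (u powr (p - 1) * (u powr p) powr (a - 1)) * exp (- v * u powr p)"
      using u assms by (simp add: f_def g_def powr_mult exp_minus field_simps)
    also have "v * v powr (a - 1) = v powr a" using assms by (simp add: powr_mult_base)
    also have "u powr (p - 1) * (u powr p) powr (a - 1) = u powr (p * a - 1)"
      by (simp add: powr_powr flip: powr_add) (simp add: algebra_simps)
    finally show "\<bar>v * (p * u powr (p - 1))\<bar> * f (g u) =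
        (p * v powr a) * (u powr (p * a - 1) * exp (- v * u powr p))" by simp
  qed
  from has_integral_mult_right[OF this, of "1 / (p * v powr a)"]
  have "((\<lambda>u. u powr (p * a - 1) * exp (- v * u powr p)) has_integral Gamma a / (p * v powr a)) {0<..}"
    using assms by simp
  from nn_integral_has_integral_lebesgue[OF _ this] show ?thesis by simp
qed

text \<open>Writing 2/(u^2 + c^2) as the integral of 2 exp(-(u^2 + c^2) v) over v > 0 and
  integrating first in u leaves two Gamma integrals. Their product is not contracted by the
  reflection formula, because the duplication formula is later applied to one of the
  factors.\<close>

lemma nn_integral_powr_over_quadratic:
  fixes \<alpha> c :: real
  assumes "0 < \<alpha>" "\<alpha> < 1" "c > 0"
  shows "(\<integral>\<^sup>+u. ennreal (indicator {0<..} u * (u powr (-\<alpha>) * (2 / (u^2 + c^2)))) \<partial>lborel)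
           = ennreal (Gamma ((1-\<alpha>)/2) * Gamma ((1+\<alpha>)/2) * c powr (-1-\<alpha>))"
proof -
  let ?I = "indicator {0<..} :: real \<Rightarrow> real"
  have "(\<integral>\<^sup>+u. ennreal (?I u * (u powr (-\<alpha>) * (2 / (u^2 + c^2)))) \<partial>lborel) =
     (\<integral>\<^sup>+u. (\<integral>\<^sup>+v. ennreal (?I u * ?I v * (2 * u powr (-\<alpha>) * exp (- (u^2 + c^2) * v))) \<partial>lborel) \<partial>lborel)"
  proof (rule nn_integral_cong)
    fix u :: real
    show "ennreal (?I u * (u powr (-\<alpha>) * (2 / (u^2 + c^2)))) =
          (\<integral>\<^sup>+v. ennreal (?I u * ?I v * (2 * u powr (-\<alpha>) * exp (- (u^2 + c^2) * v))) \<partial>lborel)"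
    proof (cases "u > 0")
      case True
      have p: "u^2 + c^2 > 0" using assms by (simp add: add_nonneg_pos)
      have "(\<integral>\<^sup>+v. ennreal (?I u * ?I v * (2 * u powr (-\<alpha>) * exp (- (u^2 + c^2) * v))) \<partial>lborel) =
            (\<integral>\<^sup>+v. ennreal (2 * u powr (-\<alpha>)) * ennreal (?I v * (v powr (1 * 1 - 1) * exp (- (u^2 + c^2) * v powr 1))) \<partial>lborel)"
        using True by (intro nn_integral_cong) (auto simp: indicator_def ennreal_mult' [symmetric])
      also have "\<dots> = ennreal (2 * u powr (-\<alpha>)) * ennreal (Gamma 1 / (1 * (u^2 + c^2) powr 1))"
        by (subst nn_integral_cmult) (use p in \<open>simp_all only: Gamma_nn_integral_powr zero_less_one, simp_all\<close>)
      also have "\<dots> = ennreal (?I u * (u powr (-\<alpha>) * (2 / (u^2 + c^2))))"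
        using p True by (simp add: ennreal_mult' [symmetric] field_simps)
      finally show ?thesis ..
    qed auto
  qed
  also have "\<dots> = (\<integral>\<^sup>+v. (\<integral>\<^sup>+u. ennreal (?I u * ?I v * (2 * u powr (-\<alpha>) * exp (- (u^2 + c^2) * v))) \<partial>lborel) \<partial>lborel)"
    by (intro lborel_pair.Fubini') auto
  also have "\<dots> = (\<integral>\<^sup>+v. ennreal (Gamma ((1-\<alpha>)/2)) * ennreal (?I v * (v powr (1 * ((1+\<alpha>)/2) - 1) * exp (- (c^2) * v powr 1))) \<partial>lborel)"
  proof (rule nn_integral_cong)
    fix v :: real
    show "(\<integral>\<^sup>+u. ennreal (?I u * ?I v * (2 * u powr (-\<alpha>) * exp (- (u^2 + c^2) * v))) \<partial>lborel) = 
      ennreal (Gamma ((1-\<alpha>)/2)) * ennreal (?I v * (v powr (1 * ((1+\<alpha>)/2) - 1) * exp (- (c^2) * v powr 1)))"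
    proof (cases "v > 0")
      case True
      have "(\<integral>\<^sup>+u. ennreal (?I u * ?I v * (2 * u powr (-\<alpha>) * exp (- (u^2 + c^2) * v))) \<partial>lborel) =
        (\<integral>\<^sup>+u. ennreal (2 * exp (- (c^2) * v)) * ennreal (?I u * (u powr (2 * ((1-\<alpha>)/2) - 1) * exp (- v * u powr 2))) \<partial>lborel)"
        using True by (intro nn_integral_cong)
           (auto simp: indicator_def ennreal_mult' [symmetric] exp_diff exp_minus field_simps)
      also have "\<dots> = ennreal (2 * exp (- (c^2) * v)) * ennreal (Gamma ((1-\<alpha>)/2) / (2 * v powr ((1-\<alpha>)/2)))"
        using assms True by (subst nn_integral_cmult, simp, subst Gamma_nn_integral_powr) auto
      also have "\<dots> = ennreal (Gamma ((1-\<alpha>)/2) * (exp (- (c^2) * v) * v powr (- ((1-\<alpha>)/2))))"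
        using assms by (simp add: ennreal_mult' [symmetric] powr_minus field_simps)
      also have "- ((1-\<alpha>)/2) = 1 * ((1+\<alpha>)/2) - 1" by (simp add: field_simps)
      finally show ?thesis using True assms
        by (simp add: ennreal_mult' [symmetric] mult_ac)
    qed auto
  qed
  also have "\<dots> = ennreal (Gamma ((1-\<alpha>)/2)) * ennreal (Gamma ((1+\<alpha>)/2) / (1 * (c^2) powr ((1+\<alpha>)/2)))"
    using assms by (subst nn_integral_cmult, simp, subst Gamma_nn_integral_powr) auto
  also have "\<dots> = ennreal (Gamma ((1-\<alpha>)/2) * Gamma ((1+\<alpha>)/2) * c powr (-1-\<alpha>))"
  proof -
    have "(c^2) powr ((1+\<alpha>)/2) = c powr (1 + \<alpha>)"
    proof -
      have "(c^2) powr ((1+\<alpha>)/2) = (c powr 2) powr ((1+\<alpha>)/2)" using assms by simp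
      also have "\<dots> = c powr (2 * ((1+\<alpha>)/2))" by (rule powr_powr)
      also have "2 * ((1+\<alpha>)/2) = 1 + \<alpha>" by simp
      finally show ?thesis .
    qed
    moreover have "c powr (-1-\<alpha>) = 1 / c powr (1+\<alpha>)"
      using assms by (subst powr_minus_divide [symmetric]) simp
    ultimately show ?thesis using assms by (simp add: ennreal_mult' [symmetric])
  qed
  finally show ?thesis .
qed

text \<open>(u - n)(n + 1 - u)/2 is the Peano kernel of the trapezoidal rule on [n, n + 1]:
  integrated against g'' it returns (g(n) + g(n + 1))/2 minus the integral of g. Here g(u) =
  exp(-xu), and the division by x^2 reflects g'' = x^2 g.\<close>

lemma trapezoid_exp_integral:
  fixes x :: real
  assumes "x > 0"
  shows "((\<lambda>u. (u - real n) * (real n + 1 - u) / 2 * exp (- x * u)) has_integral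
          (exp (-x) ^ Suc n * ((1 + exp x) / 2 - (exp x - 1) / x) / x^2)) {real n..real n + 1}"
proof -
  define P where "P = (\<lambda>u. - exp (-x*u) * ((u - real n) * (real n + 1 - u) / 2 / x
      + (2 * real n + 1 - 2 * u) / 2 / x^2 - 1 / x^3))"
  have "((\<lambda>u. (u - real n) * (real n + 1 - u) / 2 * exp (- x * u)) has_integral 
           (P (real n + 1) - P (real n))) {real n..real n + 1}"
    using assms unfolding P_def
    by (intro fundamental_theorem_of_calculus)
       (auto intro!: derivative_eq_intros simp flip: has_real_derivative_iff_has_vector_derivative
        simp: field_simps power2_eq_square power3_eq_cube)
  also have "P (real n + 1) - P (real n) = 
      exp (-x) ^ Suc n * ((1 + exp x) / 2 - (exp x - 1) / x) / x^2"
  proof -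
    have e: "exp (- x * (real n + 1)) = exp (-x) ^ Suc n" "exp (- x * real n) = exp (-x) ^ Suc n * exp x"
      by (simp_all flip: exp_of_nat_mult exp_add add: algebra_simps)
    show ?thesis unfolding P_def e using assms
      by (simp add: field_simps power2_eq_square power3_eq_cube)
  qed
  finally show ?thesis .
qed

text \<open>The same kernel for g(u) = u^\<alpha>, where g'' = -\<alpha> (1 - \<alpha>) u^(\<alpha>
  - 2). Concavity turns the sign, so the numerator of \<open>T n\<close> is the integral minus the
  trapezoidal value.\<close>

lemma trapezoid_powr_integral:
  fixes \<alpha> :: real
  assumes "0 < \<alpha>" "\<alpha> < 1"
  defines "T \<equiv> \<lambda>n. ((((real n + 1) powr (1+\<alpha>) - real n powr (1+\<alpha>)) / (1+\<alpha>) -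
           (real n powr \<alpha> + (real n + 1) powr \<alpha>) / 2) / (\<alpha> * (1 - \<alpha>)))"
  shows "((\<lambda>u. (u - real n) * (real n + 1 - u) / 2 * u powr (\<alpha> - 2)) has_integral T n) {real n..real n + 1}"
proof -
  define P where "P = (\<lambda>u. (- (u powr (1+\<alpha>) / (1+\<alpha>)) + (2 * real n + 1) * (u powr \<alpha> / \<alpha>)
      + real n * (real n + 1) * (u powr (\<alpha> - 1) / (1 - \<alpha>))) / 2)"
  have "((\<lambda>u. (u - real n) * (real n + 1 - u) / 2 * u powr (\<alpha> - 2)) has_integral 
           (P (real n + 1) - P (real n))) {real n..real n + 1}"
  \<comment> \<open>For n = 0 the integrand is singular at 0 and \<open>P\<close> is merely
    continuous there, so derivatives are asked for in the interior only. The factor n (n + 1) kills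
    the unbounded term u^(\<alpha> - 1) in that case.\<close>
  proof (rule fundamental_theorem_of_calculus_interior)
    have pw: "continuous_on {real n..real n + 1} (\<lambda>u. u powr \<beta>)" if "\<beta> > 0" for \<beta>
      using that by (intro continuous_on_powr' continuous_on_id continuous_on_const) auto
    have co: "continuous_on {real n..real n + 1} (\<lambda>u. real n * (real n + 1) * (u powr (\<alpha> - 1) / (1 - \<alpha>)))"
    proof (cases "n = 0")
      case False
      thus ?thesis using assms(1,2) by (intro continuous_intros) auto
    qed simp
    show "continuous_on {real n..real n + 1} P"
      unfolding P_def using assms(1,2)
      by (intro continuous_on_divide continuous_on_add continuous_on_minus
            continuous_on_mult[OF continuous_on_const] pw co continuous_on_const) auto
    show "(P has_vector_derivative (x - real n) * (real n + 1 - x) / 2 * x powr (\<alpha> - 2)) (at x)"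
      if "x \<in> {real n<..<real n + 1}" for x
    proof -
      have x: "x > 0" using that of_nat_0_le_iff[of n, where 'a=real] by (auto simp del: of_nat_0_le_iff)
      define y where "y = x powr (\<alpha> - 2)"
      have p: "x powr \<alpha> = x * x * y" "x powr (\<alpha> - 1) = x * y" 
        using x by (simp_all add: y_def powr_diff power2_eq_square)
      have "(P has_real_derivative (- (x powr \<alpha>) + (2 * real n + 1) * x powr (\<alpha> - 1)
           + real n * (real n + 1) * ((\<alpha> - 1) * x powr (\<alpha> - 2) / (1 - \<alpha>))) / 2) (at x)"
        unfolding P_def using assms x by (auto intro!: derivative_eq_intros)
      also have "(\<alpha> - 1) * x powr (\<alpha> - 2) / (1 - \<alpha>) = - y" using assms by (simp add: y_def field_simps)
      finally show ?thesis unfolding p y_def[symmetric]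
        by (simp add: field_simps flip: has_real_derivative_iff_has_vector_derivative)
    qed
  qed auto
  also have "P (real n + 1) - P (real n) = T n"
  proof -
    define a where "a = real n powr \<alpha>"
    define b where "b = (real n + 1) powr \<alpha>"
    have e: "real n powr (1+\<alpha>) = real n * a" "(real n + 1) powr (1+\<alpha>) = (real n + 1) * b"
      by (simp_all add: a_def b_def powr_add)
    have e2: "real n * (real n + 1) * (real n powr (\<alpha> - 1) / (1 - \<alpha>)) = (real n + 1) * a / (1 - \<alpha>)"
      by (cases "n = 0") (simp_all add: a_def powr_diff)
    have e3: "real n * (real n + 1) * ((real n + 1) powr (\<alpha> - 1) / (1 - \<alpha>)) = real n * b / (1 - \<alpha>)"
      by (simp add: b_def powr_diff)
    show ?thesis unfolding P_def T_def e e2 e3 a_def[symmetric] b_def[symmetric]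
      using assms(1,2) by (simp add: divide_simps) (simp add: algebra_simps)
  qed
  finally show ?thesis .
qed

lemma sums_real_if_suminf_ennreal:
  assumes "(\<Sum>n. ennreal (f n)) = ennreal r" "\<And>n. f n \<ge> 0" "r \<ge> 0"
  shows "f sums r"
proof -
  have "(\<lambda>n. ennreal (f n)) sums (\<Sum>n. ennreal (f n))" by (intro summable_sums) auto
  hence "(\<lambda>n. ennreal (\<Sum>k<n. f k)) \<longlonglongrightarrow> ennreal r"
    unfolding sums_def assms(1) using assms(2) by (simp add: sum_ennreal)
  hence "(\<lambda>n. \<Sum>k<n. f k) \<longlonglongrightarrow> r"
    by (rule tendsto_ennrealD) (use assms in \<open>auto intro!: always_eventually sum_nonneg\<close>)
  thus ?thesis by (simp add: sums_def)
qed

text \<open>Integrating x^(1 - \<alpha>) exp(-xu) over x gives Gamma(2 - \<alpha>) u^(\<alpha> - 2),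
  so Tonelli turns the trapezoidal error of the exponentials into that of the power u^\<alpha>, on
  each unit interval separately.\<close>

lemma trapezoid_Mellin:
  fixes \<alpha> :: real
  assumes "0 < \<alpha>" "\<alpha> < 1"
  defines "T \<equiv> \<lambda>n. ((((real n + 1) powr (1+\<alpha>) - real n powr (1+\<alpha>)) / (1+\<alpha>) -
           (real n powr \<alpha> + (real n + 1) powr \<alpha>) / 2) / (\<alpha> * (1 - \<alpha>)))"
  shows "(\<integral>\<^sup>+x. ennreal (indicator {0<..} x * (x powr (1 - \<alpha>) *
            (exp (-x) ^ Suc n * ((1 + exp x) / 2 - (exp x - 1) / x) / x^2))) \<partial>lborel)
         = ennreal (Gamma (2 - \<alpha>) * T n)"
    and "T n \<ge> 0"
proof -
  let ?I = "indicator {0<..} :: real \<Rightarrow> real"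
  define J where "J = {real n..real n + 1}"
  define q where "q = (\<lambda>u. (u - real n) * (real n + 1 - u) / 2)"
  have q: "q u \<ge> 0" if "u \<in> J" for u using that by (auto simp: q_def J_def)
  have [measurable]: "q \<in> borel_measurable borel" "J \<in> sets borel" by (auto simp: q_def J_def)
  have F: "((\<lambda>u. q u * u powr (\<alpha> - 2)) has_integral T n) J"
    unfolding q_def J_def T_def by (rule trapezoid_powr_integral) fact+
  thus "T n \<ge> 0" by (rule has_integral_nonneg) (use q in auto)
  have "(\<integral>\<^sup>+x. ennreal (?I x * (x powr (1 - \<alpha>) *
            (exp (-x) ^ Suc n * ((1 + exp x) / 2 - (exp x - 1) / x) / x^2))) \<partial>lborel) =
     (\<integral>\<^sup>+x. (\<integral>\<^sup>+u. ennreal (?I x * (indicator J u * (x powr (1 - \<alpha>) * (q u * exp (- x * u))))) \<partial>lborel) \<partial>lborel)"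
  proof (rule nn_integral_cong)
    fix x :: real
    define E where "E = exp (-x) ^ Suc n * ((1 + exp x) / 2 - (exp x - 1) / x) / x^2"
    show "ennreal (?I x * (x powr (1 - \<alpha>) * (exp (-x) ^ Suc n * ((1 + exp x) / 2 - (exp x - 1) / x) / x^2))) =
          (\<integral>\<^sup>+u. ennreal (?I x * (indicator J u * (x powr (1 - \<alpha>) * (q u * exp (- x * u))))) \<partial>lborel)"
    proof (cases "x > 0")
      case True
      have I: "((\<lambda>u. q u * exp (- x * u)) has_integral E) J"
        unfolding q_def J_def E_def by (rule trapezoid_exp_integral[OF True])
      have "E \<ge> 0" using I by (rule has_integral_nonneg) (use q in auto)
      have "(\<integral>\<^sup>+u. ennreal (?I x * (indicator J u * (x powr (1 - \<alpha>) * (q u * exp (- x * u))))) \<partial>lborel) =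
         (\<integral>\<^sup>+u. ennreal (x powr (1 - \<alpha>)) * ennreal (indicator J u * (q u * exp (- x * u))) \<partial>lborel)"
        using True by (intro nn_integral_cong) (auto simp: indicator_def ennreal_mult' [symmetric])
      also have "\<dots> = ennreal (x powr (1 - \<alpha>)) * ennreal E"
        by (subst nn_integral_cmult, measurable, subst nn_integral_has_integral_lebesgue[OF _ I]) (use q in auto)
      also have "\<dots> = ennreal (?I x * (x powr (1 - \<alpha>) * E))" using True by (simp add: ennreal_mult')
      finally show ?thesis unfolding E_def by (rule sym)
    qed auto
  qed
  also have "\<dots> = (\<integral>\<^sup>+u. (\<integral>\<^sup>+x. ennreal (?I x * (indicator J u * (x powr (1 - \<alpha>) * (q u * exp (- x * u))))) \<partial>lborel) \<partial>lborel)"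
    by (intro lborel_pair.Fubini') auto
  also have "\<dots> = (\<integral>\<^sup>+u. ennreal (Gamma (2 - \<alpha>)) * ennreal (indicator J u * (q u * u powr (\<alpha> - 2))) \<partial>lborel)"
  proof (rule nn_integral_cong)
    fix u :: real
    show "(\<integral>\<^sup>+x. ennreal (?I x * (indicator J u * (x powr (1 - \<alpha>) * (q u * exp (- x * u))))) \<partial>lborel) =
      ennreal (Gamma (2 - \<alpha>)) * ennreal (indicator J u * (q u * u powr (\<alpha> - 2)))"
    proof (cases "u \<in> J \<and> u \<noteq> 0")
      case True
      hence u: "u > 0" "u \<in> J" by (auto simp: J_def)
      have "(\<integral>\<^sup>+x. ennreal (?I x * (indicator J u * (x powr (1 - \<alpha>) * (q u * exp (- x * u))))) \<partial>lborel) =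
        (\<integral>\<^sup>+x. ennreal (q u) * ennreal (?I x * (x powr (1 * (2 - \<alpha>) - 1) * exp (- u * x powr 1))) \<partial>lborel)"
        using u q[of u] by (intro nn_integral_cong) (auto simp: indicator_def ennreal_mult' [symmetric] mult_ac)
      also have "\<dots> = ennreal (q u) * ennreal (Gamma (2 - \<alpha>) / (1 * u powr (2 - \<alpha>)))"
        using assms u by (subst nn_integral_cmult, simp, subst Gamma_nn_integral_powr) auto
      also have "Gamma (2 - \<alpha>) / (1 * u powr (2 - \<alpha>)) = Gamma (2 - \<alpha>) * u powr (\<alpha> - 2)"
        using powr_minus_divide[of u "2 - \<alpha>"] by simp
      finally show ?thesis using u q[of u] assms
        by (simp add: ennreal_mult' [symmetric] mult_ac)
    next
      case False
      have "q 0 = 0" if "0 \<in> J" using that by (simp add: q_def J_def)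
      thus ?thesis using False by (cases "u \<in> J") auto
    qed
  qed
  also have "\<dots> = ennreal (Gamma (2 - \<alpha>)) * ennreal (T n)"
    by (subst nn_integral_cmult, measurable, subst nn_integral_has_integral_lebesgue[OF _ F]) (use q in auto)
  finally show "(\<integral>\<^sup>+x. ennreal (?I x * (x powr (1 - \<alpha>) *
            (exp (-x) ^ Suc n * ((1 + exp x) / 2 - (exp x - 1) / x) / x^2))) \<partial>lborel)
         = ennreal (Gamma (2 - \<alpha>) * T n)" using assms(2) by (simp add: ennreal_mult')
qed

lemma trapezoid_sums_zeta_dual:
  fixes \<alpha> :: real
  assumes "0 < \<alpha>" "\<alpha> < 1"
  defines "T \<equiv> \<lambda>n. ((((real n + 1) powr (1+\<alpha>) - real n powr (1+\<alpha>)) / (1+\<alpha>) -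
           (real n powr \<alpha> + (real n + 1) powr \<alpha>) / 2) / (\<alpha> * (1 - \<alpha>)))"
  shows "(\<lambda>n. Gamma (2 - \<alpha>) * T n) sums (Gamma ((1-\<alpha>)/2) * Gamma ((1+\<alpha>)/2) * (2 * pi) powr (-1-\<alpha>)
            * (\<Sum>n. real (Suc n) powr (-1-\<alpha>)))"
proof -
  let ?I = "indicator {0<..} :: real \<Rightarrow> real"
  define D where "D = Gamma ((1-\<alpha>)/2) * Gamma ((1+\<alpha>)/2)"
  \<comment> \<open>\<open>K x\<close> is also the total trapezoidal error of u -> exp(-xu) on the
    half-line from 0: the trapezoidal sum is 1/2 + 1/(exp x - 1) and the integral is 1/x. This is
    the source of the second evaluation.\<close>
  define K where "K = (\<lambda>x::real. 1 / (exp x - 1) - 1 / x + 1 / 2)"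
  define c where "c = (\<lambda>k. 2 * pi * real (Suc k))"
  define h where "h = (\<lambda>n x. exp (-x) ^ Suc n * ((1 + exp x) / 2 - (exp x - 1) / x) / x^2 :: real)"
  have c: "c k > 0" for k by (simp add: c_def)
  have ggt: "D > 0" unfolding D_def using assms by (intro mult_pos_pos Gamma_real_pos) auto
  have T: "T n \<ge> 0" for n unfolding T_def by (rule trapezoid_Mellin(2)) fact+
  have "(\<integral>\<^sup>+x. ennreal (?I x * (K x * x powr (- \<alpha> - 1))) \<partial>lborel) =
     (\<integral>\<^sup>+x. (\<Sum>k. ennreal (?I x * (x powr (-\<alpha>) * (2 / (x^2 + c k^2))))) \<partial>lborel)"
  proof (rule nn_integral_cong)
    fix x :: real
    show "ennreal (?I x * (K x * x powr (- \<alpha> - 1))) = (\<Sum>k. ennreal (?I x * (x powr (-\<alpha>) * (2 / (x^2 + c k^2)))))"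
    proof (cases "x > 0")
      case True
      have "(\<lambda>k. (2 * x / (x^2 + c k^2)) * x powr (- \<alpha> - 1)) sums (K x * x powr (- \<alpha> - 1))"
        unfolding K_def c_def by (intro sums_mult2 coth_partial_fractions True)
      also have "(\<lambda>k. (2 * x / (x^2 + c k^2)) * x powr (- \<alpha> - 1)) = (\<lambda>k. x powr (-\<alpha>) * (2 / (x^2 + c k^2)))"
        using True by (simp add: powr_diff fun_eq_iff mult_ac)
      finally have S: "(\<lambda>k. x powr (-\<alpha>) * (2 / (x^2 + c k^2))) sums (K x * x powr (- \<alpha> - 1))" .
      have "(\<Sum>k. ennreal (x powr (-\<alpha>) * (2 / (x^2 + c k^2)))) = ennreal (K x * x powr (- \<alpha> - 1))"
        using S by (intro suminf_ennreal_eq) auto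
      thus ?thesis using True by simp
    qed auto
  qed
  also have "\<dots> = (\<Sum>k. \<integral>\<^sup>+x. ennreal (?I x * (x powr (-\<alpha>) * (2 / (x^2 + c k^2)))) \<partial>lborel)"
    by (rule nn_integral_suminf) auto
  also have "\<dots> = (\<Sum>k. ennreal (D * c k powr (-1-\<alpha>)))"
    unfolding D_def by (intro suminf_cong nn_integral_powr_over_quadratic assms c)
  also have "\<dots> = ennreal (D * (2 * pi) powr (-1-\<alpha>) * (\<Sum>n. real (Suc n) powr (-1-\<alpha>)))"
  proof (rule suminf_ennreal_eq)
    have "summable (\<lambda>n. real n powr (-1-\<alpha>))" using assms by (subst summable_real_powr_iff) auto
    hence "summable (\<lambda>n. real (Suc n) powr (-1-\<alpha>))" by (subst summable_Suc_iff)
    hence "(\<lambda>n. D * (2 * pi) powr (-1-\<alpha>) * real (Suc n) powr (-1-\<alpha>)) sums 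
       (D * (2 * pi) powr (-1-\<alpha>) * (\<Sum>n. real (Suc n) powr (-1-\<alpha>)))"
      by (intro sums_mult summable_sums)
    thus "(\<lambda>k. D * c k powr (-1-\<alpha>)) sums (D * (2 * pi) powr (-1-\<alpha>) * (\<Sum>n. real (Suc n) powr (-1-\<alpha>)))"
      by (simp add: c_def powr_mult mult_ac del: of_nat_Suc)
  qed (use ggt in auto)
  finally have way1: "(\<integral>\<^sup>+x. ennreal (?I x * (K x * x powr (- \<alpha> - 1))) \<partial>lborel) = \<dots>" .
  have "(\<integral>\<^sup>+x. ennreal (?I x * (K x * x powr (- \<alpha> - 1))) \<partial>lborel) =
     (\<integral>\<^sup>+x. (\<Sum>n. ennreal (?I x * (x powr (1 - \<alpha>) * h n x))) \<partial>lborel)"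
  proof (rule nn_integral_cong)
    fix x :: real
    show "ennreal (?I x * (K x * x powr (- \<alpha> - 1))) = (\<Sum>n. ennreal (?I x * (x powr (1 - \<alpha>) * h n x)))"
    proof (cases "x > 0")
      case True
      have hn: "h n x \<ge> 0" for n 
        unfolding h_def by (rule has_integral_nonneg[OF trapezoid_exp_integral[OF True]]) auto
      have E: "exp x > 1" "exp (-x) = 1 / exp x" using True by (simp_all add: exp_minus field_simps)
      have "(\<lambda>n. exp (-x) ^ n) sums (1 / (1 - exp (-x)))" using True by (intro geometric_sums) auto
      hence "(\<lambda>n. exp (-x) ^ n * (x powr (1-\<alpha>) * (exp (-x) * ((1 + exp x) / 2 - (exp x - 1) / x) / x^2))) sums
         (1 / (1 - exp (-x)) * (x powr (1-\<alpha>) * (exp (-x) * ((1 + exp x) / 2 - (exp x - 1) / x) / x^2)))"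
        by (rule sums_mult2)
      also have "1 / (1 - exp (-x)) * (x powr (1-\<alpha>) * (exp (-x) * ((1 + exp x) / 2 - (exp x - 1) / x) / x^2)) =
         x powr (1 - \<alpha>) * (1 / (exp x - 1) * ((1 + exp x) / 2 - (exp x - 1) / x) / x^2)"
      proof -
        have "1 / (1 - 1 / e) * (p * (1 / e * b / y)) = p * (1 / (e - 1) * b / y)" if "e > 1" for e p b y :: real
        proof -
          have "1 / (1 - 1 / e) * (1 / e) = 1 / (e - 1)" using that by (simp add: field_simps)
          hence "1 / (1 - 1 / e) * (1 / e) * (p * b / y) = 1 / (e - 1) * (p * b / y)" by simp
          thus ?thesis by (simp add: mult_ac)
        qed
        from this[OF E(1)] show ?thesis unfolding E(2) .
      qed
      also have "1 / (exp x - 1) * ((1 + exp x) / 2 - (exp x - 1) / x) / x^2 = K x / x^2"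
        using E True unfolding K_def by (simp add: divide_simps) (simp add: algebra_simps)?
      also have "x powr (1 - \<alpha>) * (K x / x^2) = K x * (x powr (1 - \<alpha>) / x powr 2)"
        using True by (simp )
      also have "x powr (1 - \<alpha>) / x powr 2 = x powr (- \<alpha> - 1)"
      proof -
        have "1 - \<alpha> - 2 = - \<alpha> - 1" by simp
        thus ?thesis by (metis powr_diff)
      qed
      finally have S: "(\<lambda>n. x powr (1 - \<alpha>) * h n x) sums (K x * x powr (- \<alpha> - 1))"
        by (simp add: h_def mult_ac)
      have "(\<Sum>n. ennreal (x powr (1 - \<alpha>) * h n x)) = ennreal (K x * x powr (- \<alpha> - 1))"
        using S hn by (intro suminf_ennreal_eq) auto
      thus ?thesis using True by simp
    qed auto
  qed
  also have "\<dots> = (\<Sum>n. \<integral>\<^sup>+x. ennreal (?I x * (x powr (1 - \<alpha>) * h n x)) \<partial>lborel)"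
    unfolding h_def by (rule nn_integral_suminf) auto
  also have "\<dots> = (\<Sum>n. ennreal (Gamma (2 - \<alpha>) * T n))"
    unfolding h_def T_def by (intro suminf_cong trapezoid_Mellin(1) assms)
  finally have "(\<Sum>n. ennreal (Gamma (2 - \<alpha>) * T n)) = 
      ennreal (D * (2 * pi) powr (-1-\<alpha>) * (\<Sum>n. real (Suc n) powr (-1-\<alpha>)))" using way1 by simp
  hence "(\<lambda>n. Gamma (2 - \<alpha>) * T n) sums (D * (2 * pi) powr (-1-\<alpha>) * (\<Sum>n. real (Suc n) powr (-1-\<alpha>)))"
  proof (rule sums_real_if_suminf_ennreal)
    have "summable (\<lambda>n. real n powr (-1-\<alpha>))" using assms by (subst summable_real_powr_iff) auto
    hence "summable (\<lambda>n. real (Suc n) powr (-1-\<alpha>))" by (subst summable_Suc_iff)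
    thus "0 \<le> D * (2 * pi) powr (-1-\<alpha>) * (\<Sum>n. real (Suc n) powr (-1-\<alpha>))"
      using ggt by (intro mult_nonneg_nonneg suminf_nonneg) auto
    show "0 \<le> Gamma (2 - \<alpha>) * T n" for n
      using assms T[of n] by (intro mult_nonneg_nonneg less_imp_le[OF Gamma_real_pos]) auto
  qed
  thus ?thesis by (simp add: D_def)
qed

section \<open>Continuation of zeta beyond the imaginary axis\<close>

lemma holomorphic_on_suminf:
  fixes f :: "nat \<Rightarrow> complex \<Rightarrow> complex"
  assumes "open S" "\<And>n. f n holomorphic_on S"
  assumes "\<And>x. x \<in> S \<Longrightarrow> \<exists>d>0. \<exists>M. cball x d \<subseteq> S \<and> summable M \<and> (\<forall>y\<in>cball x d. \<forall>n. norm (f n y) \<le> M n)"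
  shows "(\<lambda>s. \<Sum>n. f n s) holomorphic_on S"
proof (rule holomorphic_uniform_sequence[OF assms(1), of "\<lambda>N s. \<Sum>n<N. f n s"])
  show "(\<lambda>s. \<Sum>n<N. f n s) holomorphic_on S" for N
    using assms(2) by (intro holomorphic_on_sum)
  fix x assume "x \<in> S"
  from assms(3)[OF this] obtain d M where d: "d > 0" "cball x d \<subseteq> S" "summable M"
    "\<And>y n. y \<in> cball x d \<Longrightarrow> norm (f n y) \<le> M n" by blast
  have "uniform_limit (cball x d) (\<lambda>N s. \<Sum>n<N. f n s) (\<lambda>s. \<Sum>n. f n s) sequentially"
    using d by (intro Weierstrass_m_test)
  thus "\<exists>d>0. cball x d \<subseteq> S \<and> uniform_limit (cball x d) (\<lambda>N s. \<Sum>n<N. f n s) (\<lambda>s. \<Sum>n. f n s) sequentially"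
    using d by blast
qed

text \<open>
  \<open>s - 1\<close> times the trapezoidal error of \<open>x\<^bsup>-s\<^esup>\<close> on \<open>[n + 1, n + 2]\<close>; the factor \<open>s - 1\<close> keeps
  everything holomorphic at \<open>1\<close>.
\<close>

definition euler_maclaurin_term :: "nat \<Rightarrow> complex \<Rightarrow> complex" where
  "euler_maclaurin_term n s = (s - 1) * ((of_nat (Suc n) powr (-s) + of_nat (Suc (Suc n)) powr (-s)) / 2)
      - (of_nat (Suc n) powr (1 - s) - of_nat (Suc (Suc n)) powr (1 - s))"

lemma holomorphic_euler_maclaurin_term: "euler_maclaurin_term n holomorphic_on S"
proof -
  have "of_nat (Suc m) \<noteq> (0::complex)" for m by (simp del: of_nat_Suc)
  thus ?thesis unfolding euler_maclaurin_term_def by (intro holomorphic_intros) auto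
qed

text \<open>The term is the value at c + 1, for c = n + 1, of a function \<open>\<psi>\<close> with
  value 0 at c and derivative (s - 1) \<open>h\<close>, so bounds for \<open>h\<close> on the
  segment suffice. Bounding \<open>h\<close> through its own derivative gains the power of n that
  carries convergence to Re s > -1; bounding it directly is one degree lower in s, which matters for
  the growth in the imaginary direction.\<close>

lemma norm_euler_maclaurin_term_le:
  assumes "Re s > -1"
  shows "norm (euler_maclaurin_term n s) \<le> norm s * norm (s - 1) * norm (s + 1) * real (Suc n) powr (- Re s - 2)"
    and "norm (euler_maclaurin_term n s) \<le> norm s * norm (s - 1) * real (Suc n) powr (- Re s - 1)"
proof -
  define m where "m = real (Suc n)"
  define c where "c = complex_of_real m"
  define S where "S = complex_of_real ` {m..m+1}"
  have m: "m \<ge> 1" by (simp add: m_def)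
  have S: "convex S" unfolding S_def by (intro convex_linear_image) (auto intro!: bounded_linear.linear bounded_linear_of_real)
  have "complex_of_real (m + 1) = c + 1" by (simp add: c_def)
  hence Sm: "c \<in> S" "c + 1 \<in> S" unfolding S_def c_def
    by (metis imageI atLeastAtMost_iff le_add_same_cancel1 order_refl zero_le_one)+
  have z: "z \<noteq> 0" "z \<notin> \<real>\<^sub>\<le>\<^sub>0" "norm (z - c) \<le> 1" if "z \<in> S" for z
  proof -
    from that obtain x where x: "z = of_real x" "m \<le> x" "x \<le> m + 1" unfolding S_def by auto
    show "z \<noteq> 0" "z \<notin> \<real>\<^sub>\<le>\<^sub>0" using x m by (auto simp: complex_nonpos_Reals_iff)
    have "norm (z - c) = \<bar>x - m\<bar>" unfolding x c_def by (metis norm_of_real of_real_diff)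
    thus "norm (z - c) \<le> 1" using x by simp
  qed
  have nz: "norm (z powr w) \<le> m powr (Re w)" if "z \<in> S" "Re w \<le> 0" for z w
  proof -
    from that obtain x where x: "z = of_real x" "m \<le> x" by (auto simp: S_def)
    have "norm (z powr w) = x powr Re w" using x m by (simp add: norm_powr_real_powr)
    also have "\<dots> \<le> m powr Re w" using x m that by (intro powr_mono2') auto
    finally show ?thesis .
  qed
  define A where "A = (\<lambda>z. c powr (-s) - z powr (-s))"
  have A: "norm (A z) \<le> norm s * m powr (- Re s - 1)" if zS: "z \<in> S" for z
  proof -
    have "norm (A z - A c) \<le> (norm s * m powr (- Re s - 1)) * norm (z - c)"
    proof (rule field_differentiable_bound[OF S _ _ zS Sm(1)])
      fix w assume w: "w \<in> S"
      show "(A has_field_derivative s * w powr (-s - 1)) (at w within S)"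
        unfolding A_def using z[OF w] by (auto intro!: derivative_eq_intros)
      show "norm (s * w powr (-s - 1)) \<le> norm s * m powr (- Re s - 1)"
        using nz[OF w, of "-s-1"] assms by (auto simp: norm_mult intro!: mult_left_mono)
    qed
    also have "\<dots> \<le> (norm s * m powr (- Re s - 1)) * 1" using z[OF zS] by (intro mult_left_mono) auto
    finally show ?thesis by (simp add: A_def)
  qed
  define h where "h = (\<lambda>z. A z / 2 - s / 2 * z powr (-s - 1) * (z - c))"
  have h1: "norm (h z) \<le> norm s * m powr (- Re s - 1)" if zS: "z \<in> S" for z
  proof -
    have "norm (h z) \<le> norm (A z / 2) + norm (s / 2 * z powr (-s - 1) * (z - c))"
      unfolding h_def by (rule norm_triangle_ineq4)
    also have "\<dots> \<le> norm s * m powr (- Re s - 1) / 2 + norm s / 2 * m powr (- Re s - 1) * 1"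
      unfolding norm_mult norm_divide using A[OF zS] nz[OF zS, of "-s-1"] assms z(3)[OF zS]
      by (intro add_mono mult_mono) auto
    finally show ?thesis by simp
  qed
  have h2: "norm (h z) \<le> norm s * norm (s + 1) * m powr (- Re s - 2)" if zS: "z \<in> S" for z
  proof -
    have "norm (h z - h c) \<le> (norm s * norm (s + 1) * m powr (- Re s - 2)) * norm (z - c)"
    proof (rule field_differentiable_bound[OF S _ _ zS Sm(1)])
      fix w assume w: "w \<in> S"
      have "(h has_field_derivative s * w powr (-s - 1) / 2
            - (s / 2 * ((-s-1) * w powr (-s - 1 - 1)) * (w - c) + s / 2 * w powr (-s-1))) (at w within S)"
        unfolding h_def A_def using z[OF w] by (auto intro!: derivative_eq_intros simp: field_simps)
      also have "s * w powr (-s - 1) / 2 - (s / 2 * ((-s-1) * w powr (-s - 1 - 1)) * (w - c) + s / 2 * w powr (-s-1))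
             = s * (s + 1) / 2 * w powr (-s - 2) * (w - c)"
      proof -
        have "s * V / 2 - (s / 2 * ((-s-1) * W) * (w - c) + s / 2 * V) = s * (s + 1) / 2 * W * (w - c)" for V W
          by (simp add: field_simps)
        moreover have "-s - 1 - 1 = -s - 2" by simp
        ultimately show ?thesis by metis
      qed
      finally show "(h has_field_derivative s * (s + 1) / 2 * w powr (-s - 2) * (w - c)) (at w within S)" .
      have "norm (s * (s + 1) / 2 * w powr (-s - 2) * (w - c)) \<le>
              norm s * norm (s + 1) / 2 * m powr (- Re s - 2) * 1"
        unfolding norm_mult norm_divide using nz[OF w, of "-s-2"] assms z(3)[OF w]
        by (intro mult_mono) auto
      also have "\<dots> \<le> norm s * norm (s + 1) * m powr (- Re s - 2)" by simp
      finally show "norm (s * (s + 1) / 2 * w powr (-s - 2) * (w - c)) \<le> norm s * norm (s + 1) * m powr (- Re s - 2)" .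
    qed
    also have "\<dots> \<le> (norm s * norm (s + 1) * m powr (- Re s - 2)) * 1" using z[OF zS] by (intro mult_left_mono) auto
    finally show ?thesis by (simp add: h_def A_def)
  qed
  define \<psi> where "\<psi> = (\<lambda>z. (s - 1) * ((c powr (-s) + z powr (-s)) / 2) * (z - c) - (c powr (1-s) - z powr (1-s)))"
  have \<psi>: "norm (\<psi> (c + 1)) \<le> norm (s - 1) * B" if B: "\<And>z. z \<in> S \<Longrightarrow> norm (h z) \<le> B" for B
  proof -
    have "norm (\<psi> (c + 1) - \<psi> c) \<le> (norm (s - 1) * B) * norm (c + 1 - c)"
    proof (rule field_differentiable_bound[OF S _ _ Sm(2) Sm(1)])
      fix w assume w: "w \<in> S"
      have "(\<psi> has_field_derivative (s - 1) * (- (s * w powr (-s - 1)) / 2) * (w - c)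
               + (s - 1) * ((c powr (-s) + w powr (-s)) / 2) + (1 - s) * w powr (1 - s - 1)) (at w within S)"
        unfolding \<psi>_def using z[OF w] by (auto intro!: derivative_eq_intros)
      also have "(s - 1) * (- (s * w powr (-s - 1)) / 2) * (w - c)
               + (s - 1) * ((c powr (-s) + w powr (-s)) / 2) + (1 - s) * w powr (1 - s - 1) = (s - 1) * h w"
        unfolding h_def A_def by (simp add: field_simps)
      finally show "(\<psi> has_field_derivative (s - 1) * h w) (at w within S)" .
      show "norm ((s - 1) * h w) \<le> norm (s - 1) * B"
        using B[OF w] by (auto simp: norm_mult intro!: mult_left_mono)
    qed
    thus ?thesis by (simp add: \<psi>_def)
  qed
  have "\<psi> (c + 1) = euler_maclaurin_term n s"
    by (simp add: \<psi>_def euler_maclaurin_term_def c_def m_def add_ac)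
  with \<psi>[OF h1] \<psi>[OF h2] show
    "norm (euler_maclaurin_term n s) \<le> norm s * norm (s - 1) * norm (s + 1) * real (Suc n) powr (- Re s - 2)"
    "norm (euler_maclaurin_term n s) \<le> norm s * norm (s - 1) * real (Suc n) powr (- Re s - 1)"
    by (simp_all add: m_def mult_ac)
qed

text \<open>This is (s - 1) zeta(s), continued to Re s > -1. Since (s + 1)/2 = (s - 1)(1/2 + 1/(s -
  1)), the first summand carries half of the leading Dirichlet term and the integral of x^(-s) over
  [1, \<infinity>).\<close>

definition zeta_reg :: "complex \<Rightarrow> complex" where
  "zeta_reg s = (s + 1) / 2 + (\<Sum>n. euler_maclaurin_term n s)"

lemma summable_Suc_powr: "a < -1 \<Longrightarrow> summable (\<lambda>n. real (Suc n) powr a)"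
  using summable_real_powr_iff[of a] by (subst summable_Suc_iff) auto

lemma summable_euler_maclaurin_term:
  assumes "Re s > -1"
  shows "summable (\<lambda>n. euler_maclaurin_term n s)"
  by (rule summable_comparison_test[OF _ summable_mult[OF summable_Suc_powr[of "- Re s - 2"]]])
     (use norm_euler_maclaurin_term_le(1)[OF assms] assms in auto)

lemma holomorphic_zeta_reg: "zeta_reg holomorphic_on {s. Re s > -1}"
proof -
  have "(\<lambda>s. \<Sum>n. euler_maclaurin_term n s) holomorphic_on {s. Re s > -1}"
  proof (rule holomorphic_on_suminf)
    fix x assume x: "x \<in> {s. Re s > -1}"
    define d where "d = (Re x + 1) / 2"
    define M where "M = (\<lambda>n. (norm x + d) * (norm x + d + 1) * (norm x + d + 1) * real (Suc n) powr (- (d - 1) - 2))"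
    have d: "d > 0" using x by (simp add: d_def)
    have R: "Re y \<ge> d - 1" "norm y \<le> norm x + d" if "y \<in> cball x d" for y
    proof -
      have "Re x - Re y \<le> norm (x - y)" using complex_Re_le_cmod[of "x - y"] by simp
      thus "Re y \<ge> d - 1" using that by (simp add: dist_norm d_def field_simps)
      have "norm y \<le> norm x + norm (y - x)" using norm_triangle_ineq[of x "y - x"] by simp
      thus "norm y \<le> norm x + d" using that by (simp add: dist_norm norm_minus_commute)
    qed
    have "norm (euler_maclaurin_term n y) \<le> M n" if y: "y \<in> cball x d" for y n
    proof -
      have "norm (euler_maclaurin_term n y) \<le> norm y * norm (y - 1) * norm (y + 1) * real (Suc n) powr (- Re y - 2)"
        using R[OF y] d by (intro norm_euler_maclaurin_term_le) auto
      also have "\<dots> \<le> M n" unfolding M_def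
        using R[OF y] d norm_triangle_ineq4[of y 1] norm_triangle_ineq[of y 1]
        by (intro mult_mono powr_mono) auto
      finally show ?thesis .
    qed
    moreover have "summable M" unfolding M_def using d by (intro summable_mult summable_Suc_powr) auto
    moreover have "cball x d \<subseteq> {s. Re s > -1}" using R d by force
    ultimately show "\<exists>d>0. \<exists>M. cball x d \<subseteq> {s. Re s > -1} \<and> summable M \<and>
        (\<forall>y\<in>cball x d. \<forall>n. norm (euler_maclaurin_term n y) \<le> M n)" using d by blast
  qed (auto simp: open_halfspace_Re_gt holomorphic_euler_maclaurin_term)
  thus ?thesis unfolding zeta_reg_def by (intro holomorphic_intros) auto
qed

lemma sum_euler_maclaurin_term:
  "(s + 1) / 2 + (\<Sum>n<N. euler_maclaurin_term n s) = (s - 1) * ((\<Sum>n<N. of_nat (Suc n) powr (-s)) + of_nat (Suc N) powr (-s) / 2)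
     + of_nat (Suc N) powr (1 - s)"
proof (induction N)
  case (Suc N)
  have "(s + 1) / 2 + (\<Sum>n<Suc N. euler_maclaurin_term n s) =
     (s + 1) / 2 + (\<Sum>n<N. euler_maclaurin_term n s) + euler_maclaurin_term N s" by simp
  also have "\<dots> = (s - 1) * ((\<Sum>n<Suc N. of_nat (Suc n) powr (-s)) + of_nat (Suc (Suc N)) powr (-s) / 2)
     + of_nat (Suc (Suc N)) powr (1 - s)"
    unfolding Suc.IH unfolding euler_maclaurin_term_def sum.lessThan_Suc by (simp only: algebra_simps add_divide_distrib) simp
  finally show ?case .
qed (simp add: field_simps)

lemma Suc_powr_tendsto_0:
  assumes "Re s < 0"
  shows "(\<lambda>n. of_nat (Suc n) powr s) \<longlonglongrightarrow> (0::complex)"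
proof (rule tendsto_norm_zero_cancel)
  have "norm (of_nat (Suc n) powr s) = real (Suc n) powr Re s" for n
    using norm_powr_real_powr[of "of_nat (Suc n)" s] by simp
  moreover have "(\<lambda>n. real (Suc n) powr Re s) \<longlonglongrightarrow> 0"
    by (rule LIMSEQ_Suc, rule tendsto_neg_powr[OF assms filterlim_real_sequentially])
  ultimately show "(\<lambda>n. norm (of_nat (Suc n) powr s :: complex)) \<longlonglongrightarrow> 0" by (simp only:)
qed

lemma Dirichlet_series_sums_zeta_reg:
  assumes "Re s > 1"
  shows "(\<lambda>n. of_nat (Suc n) powr (-s)) sums (zeta_reg s / (s - 1))"
proof -
  have s: "s \<noteq> 1" using assms by auto
  have "(\<lambda>N. ((s + 1) / 2 + (\<Sum>n<N. euler_maclaurin_term n s) - of_nat (Suc N) powr (1 - s)) / (s - 1)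
           - of_nat (Suc N) powr (-s) / 2) \<longlonglongrightarrow> ((s + 1) / 2 + (\<Sum>n. euler_maclaurin_term n s) - 0) / (s - 1) - 0 / 2"
    using assms s by (intro tendsto_intros Suc_powr_tendsto_0 summable_LIMSEQ summable_euler_maclaurin_term) auto
  moreover have "((s + 1) / 2 + (\<Sum>n<N. euler_maclaurin_term n s) - of_nat (Suc N) powr (1 - s)) / (s - 1)
           - of_nat (Suc N) powr (-s) / 2 = (\<Sum>n<N. of_nat (Suc n) powr (-s))" for N
    unfolding sum_euler_maclaurin_term using s by (simp del: of_nat_Suc add: field_simps)
  ultimately show ?thesis by (simp add: sums_def zeta_reg_def del: of_nat_Suc)
qed

section \<open>Functional equation\<close>

lemma zeta_reg_negative_real:
  fixes \<alpha> :: real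
  assumes "0 < \<alpha>" "\<alpha> < 1"
  shows "Gamma (2 - of_real \<alpha>) * zeta_reg (- of_real \<alpha>) * of_real \<alpha> =
     of_real ((1 + \<alpha>) * \<alpha> * (1 - \<alpha>)) * Gamma ((1 - of_real \<alpha>) / 2) * Gamma ((1 + of_real \<alpha>) / 2) *
     of_real (2 * pi) powr (-1 - of_real \<alpha>) * zeta_reg (1 + of_real \<alpha>)"
proof -
  define T where "T = (\<lambda>n. ((((real n + 1) powr (1+\<alpha>) - real n powr (1+\<alpha>)) / (1+\<alpha>) -
           (real n powr \<alpha> + (real n + 1) powr \<alpha>) / 2) / (\<alpha> * (1 - \<alpha>))))"
  \<comment> \<open>\<open>q\<close> clears the denominators of \<open>T n\<close>, so that
    \<open>q * T n\<close> is a trapezoidal error in the normalisation of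
    \<open>euler_maclaurin_term\<close> at s = -\<alpha>.\<close>
  define q where "q = (1 + \<alpha>) * \<alpha> * (1 - \<alpha>)"
  define s where "s = - complex_of_real \<alpha>"
  have q: "q > 0" using assms by (simp add: q_def)
  have S: "(\<lambda>n. Gamma (2 - \<alpha>) * T n) sums (Gamma ((1-\<alpha>)/2) * Gamma ((1+\<alpha>)/2) * (2 * pi) powr (-1-\<alpha>)
            * (\<Sum>n. real (Suc n) powr (-1-\<alpha>)))"
    unfolding T_def by (rule trapezoid_sums_zeta_dual) fact+
  have qT: "q * T n = (1 + \<alpha>) * ((((real n + 1) powr (1+\<alpha>) - real n powr (1+\<alpha>)) / (1+\<alpha>) -
           (real n powr \<alpha> + (real n + 1) powr \<alpha>) / 2))" for n
  proof -
    have "q * (X / (\<alpha> * (1 - \<alpha>))) = (1 + \<alpha>) * X" for X using assms by (simp add: q_def)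
    thus ?thesis unfolding T_def .
  qed
  \<comment> \<open>\<open>T\<close> starts with the interval [0, 1],
    \<open>euler_maclaurin_term\<close> with [1, 2]. At s = -\<alpha> the power x^(-s) is continuous
    at 0, and the extra interval supplies exactly the summand (s + 1)/2 of
    \<open>zeta_reg\<close>.\<close>
  have T0: "of_real (q * T 0) = (s + 1) / 2"
  proof -
    have "(1 + \<alpha>) * (1 / (1 + \<alpha>) - 1 / 2) = (1 - \<alpha>) / 2" using assms by (simp add: right_diff_distrib field_simps)
    hence "q * T 0 = (1 - \<alpha>) / 2" unfolding qT using assms by simp
    hence "complex_of_real (q * T 0) = of_real ((1 - \<alpha>) / 2)" by (rule arg_cong)
    also have "\<dots> = (s + 1) / 2" by (simp add: s_def)
    finally show ?thesis .
  qed
  have TS: "of_real (q * T (Suc n)) = euler_maclaurin_term n s" for n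
  proof -
    define a where "a = real (Suc n)"
    define b where "b = real (Suc (Suc n))"
    have p: "of_nat (Suc n) powr w = complex_of_real (a powr Re w)" 
            "of_nat (Suc (Suc n)) powr w = complex_of_real (b powr Re w)" if "w \<in> \<real>" for w
      using that unfolding a_def b_def by (auto elim!: Reals_cases simp: powr_of_real[symmetric] simp del: of_nat_Suc)
    have r: "- s \<in> \<real>" "1 - s \<in> \<real>" "Re (-s) = \<alpha>" "Re (1 - s) = 1 + \<alpha>" by (auto simp: s_def)
    have "euler_maclaurin_term n s = complex_of_real ((-\<alpha> - 1) * ((a powr \<alpha> + b powr \<alpha>) / 2)
      - (a powr (1 + \<alpha>) - b powr (1 + \<alpha>)))"
      unfolding euler_maclaurin_term_def p[OF r(1)] p[OF r(2)] r(3,4) by (simp add: s_def)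
    also have "(-\<alpha> - 1) * ((a powr \<alpha> + b powr \<alpha>) / 2) - (a powr (1 + \<alpha>) - b powr (1 + \<alpha>)) = q * T (Suc n)"
    proof -
      have ab: "real (Suc n) + 1 = b" "real (Suc n) = a" by (simp_all add: a_def b_def)
      have *: "(1 + \<alpha>) * (X / (1+\<alpha>) - Y) = X - (1 + \<alpha>) * Y" for X Y
        using assms by (simp add: right_diff_distrib)
      have "q * T (Suc n) = (b powr (1 + \<alpha>) - a powr (1 + \<alpha>)) - (1 + \<alpha>) * ((a powr \<alpha> + b powr \<alpha>) / 2)"
        unfolding qT ab(1) unfolding ab(2) by (rule *)
      thus ?thesis by (simp add: field_simps)
    qed
    finally show ?thesis ..
  qed
  have G: "Gamma (2 - \<alpha>) > 0" using assms by (intro Gamma_real_pos) auto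
  define V where "V = Gamma ((1-\<alpha>)/2) * Gamma ((1+\<alpha>)/2) * (2 * pi) powr (-1-\<alpha>)"
  define Z where "Z = (\<Sum>n. real (Suc n) powr (-1-\<alpha>))"
  from sums_mult[OF S, of "q / Gamma (2 - \<alpha>)"]
  have "(\<lambda>n. q * T n) sums (q / Gamma (2 - \<alpha>) * (V * Z))"
    using G by (simp add: V_def Z_def del: of_nat_Suc)
  hence "(\<lambda>n. of_real (q * T n) :: complex) sums of_real (q / Gamma (2 - \<alpha>) * (V * Z))"
    by (rule sums_of_real)
  hence "(\<lambda>n. of_real (q * T (Suc n)) :: complex) sums (of_real (q / Gamma (2 - \<alpha>) * (V * Z)) - of_real (q * T 0))"
    by (subst sums_Suc_iff)  simp
  hence "(\<lambda>n. euler_maclaurin_term n s) sums (of_real (q / Gamma (2 - \<alpha>) * (V * Z)) - (s + 1) / 2)"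
    unfolding TS T0 .
  hence "zeta_reg s = of_real (q / Gamma (2 - \<alpha>) * (V * Z))"
    unfolding zeta_reg_def by (simp add: sums_iff)
  hence A: "zeta_reg s * of_real (Gamma (2 - \<alpha>)) = of_real (q * V) * of_real Z" using G by simp
  have "(\<lambda>n. of_nat (Suc n) powr - (1 + of_real \<alpha>)) sums (zeta_reg (1 + of_real \<alpha>) / (1 + of_real \<alpha> - 1))"
    using assms by (intro Dirichlet_series_sums_zeta_reg) auto
  also have "(\<lambda>n. of_nat (Suc n) powr - (1 + of_real \<alpha>)) = (\<lambda>n. complex_of_real (real (Suc n) powr (-1-\<alpha>)))"
  proof
    fix n
    have "of_nat (Suc n) powr - (1 + of_real \<alpha>) = complex_of_real (real (Suc n)) powr of_real (-1-\<alpha>)"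
      by (simp del: of_nat_Suc)
    also have "\<dots> = complex_of_real (real (Suc n) powr (-1-\<alpha>))" by (rule powr_of_real) auto
    finally show "of_nat (Suc n) powr - (1 + of_real \<alpha>) = complex_of_real (real (Suc n) powr (-1-\<alpha>))" .
  qed
  finally have S2: "(\<lambda>n. complex_of_real (real (Suc n) powr (-1-\<alpha>))) sums (zeta_reg (1 + of_real \<alpha>) / of_real \<alpha>)" by simp
  have "summable (\<lambda>n. real (Suc n) powr (-1-\<alpha>))" using assms by (intro summable_Suc_powr) auto
  hence "(\<lambda>n. complex_of_real (real (Suc n) powr (-1-\<alpha>))) sums of_real Z"
    unfolding Z_def by (intro sums_of_real summable_sums)
  with S2 have B: "of_real Z = zeta_reg (1 + of_real \<alpha>) / of_real \<alpha>" by (rule sums_unique2[symmetric])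
  have "Gamma (2 - complex_of_real \<alpha>) = of_real (Gamma (2 - \<alpha>))"
    by (simp flip: Gamma_complex_of_real)
  moreover have "of_real V = Gamma ((1 - of_real \<alpha>) / 2) * Gamma ((1 + of_real \<alpha>) / 2) *
     complex_of_real (2 * pi) powr (-1 - of_real \<alpha>)"
  proof -
    have "complex_of_real (2 * pi) powr of_real (-1 - \<alpha>) = of_real ((2 * pi) powr (-1-\<alpha>))" by (rule powr_of_real) auto
    thus ?thesis by (simp add: V_def flip: Gamma_complex_of_real)
  qed
  ultimately show ?thesis using A B assms unfolding s_def q_def[symmetric]
    by (simp add: mult_ac)
qed

text \<open>On Re s > -1 this is \<open>a_fun s * zeta s / 2\<close> with s/2 * Gamma(s/2)
  contracted to Gamma(1 + s/2) and (s - 1) zeta(s) replaced by \<open>zeta_reg\<close>, so that the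
  removable singularities at 0 and 1 are already filled.\<close>

definition xi_half :: "complex \<Rightarrow> complex" where
  "xi_half s = of_real pi powr (-s / 2) * Gamma (1 + s / 2) * zeta_reg s"

lemma holomorphic_xi_half: "xi_half holomorphic_on {s. Re s > -1}"
proof -
  have "1 + s / 2 \<notin> \<int>\<^sub>\<le>\<^sub>0" if "Re s > -1" for s
    using that by (auto elim!: nonpos_Ints_cases simp: complex_eq_iff)
  thus ?thesis unfolding xi_half_def
    by (intro holomorphic_intros holomorphic_zeta_reg) auto
qed

text \<open>The duplication formula at (1 - \<alpha>)/2 trades Gamma((1 - \<alpha>)/2) Gamma(1 -
  \<alpha>/2) for Gamma(1 - \<alpha>), which then cancels; the remaining powers of 2 and pi combine
  to pi^(-(1 + \<alpha>)/2).\<close>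

lemma xi_half_reflection_real:
  fixes \<alpha> :: real
  assumes "0 < \<alpha>" "\<alpha> < 1"
  shows "xi_half (- of_real \<alpha>) = xi_half (1 + of_real \<alpha>)"
proof -
  define a where "a = complex_of_real \<alpha>"
  define p where "p = complex_of_real pi"
  have ni: "w \<notin> \<int>\<^sub>\<le>\<^sub>0" if "Re w > 0" for w using that by (auto elim!: nonpos_Ints_cases)
  have a: "a \<noteq> 0" "1 - a \<noteq> 0" using assms by (auto simp: a_def complex_eq_iff)
  have p: "p \<noteq> 0" by (simp add: p_def)
  have e: "(1 - a) / 2 + 1 / 2 = 1 + - a / 2" "2 * ((1 - a) / 2) = 1 - a" "1 - (1 - a) = a" by (simp_all add: field_simps)
  have dup: "Gamma ((1 - a) / 2) * Gamma (1 + - a / 2) = exp (a * of_real (ln 2)) * of_real (sqrt pi) * Gamma (1 - a)"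
    using Gamma_legendre_duplication[of "(1 - a) / 2", unfolded e, OF ni ni] assms by (simp add: a_def)
  have G2: "Gamma (2 - a) = (1 - a) * Gamma (1 - a)"
    using Gamma_plus1[of "1 - a"] ni[of "1 - a"] assms by (simp add: a_def)
  have G3: "Gamma (1 + (1 + a) / 2) = ((1 + a) / 2) * Gamma ((1 + a) / 2)"
    using Gamma_plus1[of "(1 + a) / 2"] ni[of "(1 + a)/2"] assms by (simp add: a_def add.commute)
  have nz: "Gamma (1 - a) \<noteq> 0" using assms by (intro Gamma_nonzero ni) (simp add: a_def)
  have key: "Gamma (2 - a) * zeta_reg (-a) * a = ((1 + a) * a * (1 - a)) * Gamma ((1 - a) / 2) * Gamma ((1 + a) / 2) *
     (2 * p) powr (-1 - a) * zeta_reg (1 + a)"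
    using zeta_reg_negative_real[OF assms] by (simp add: a_def p_def)
  hence "Gamma (1 - a) * zeta_reg (-a) = (1 + a) * Gamma ((1 - a) / 2) * Gamma ((1 + a) / 2) *
     (2 * p) powr (-1 - a) * zeta_reg (1 + a)"
    using a unfolding G2 by (simp add: mult_ac)
  hence "Gamma (1 - a) * xi_half (-a) = p powr (a / 2) * (Gamma ((1 - a) / 2) * Gamma (1 + - a / 2)) * 
     (1 + a) * Gamma ((1 + a) / 2) * (2 * p) powr (-1 - a) * zeta_reg (1 + a)"
    unfolding xi_half_def p_def[symmetric] by (simp add: mult_ac)
  also have "\<dots> = Gamma (1 - a) * (p powr (a / 2) * (exp (a * of_real (ln 2)) * of_real (sqrt pi)) *
     (1 + a) * Gamma ((1 + a) / 2) * (2 * p) powr (-1 - a) * zeta_reg (1 + a))"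
    unfolding dup by (simp add: mult_ac)
  finally have "xi_half (-a) = p powr (a / 2) * (exp (a * of_real (ln 2)) * of_real (sqrt pi)) *
     (1 + a) * Gamma ((1 + a) / 2) * (2 * p) powr (-1 - a) * zeta_reg (1 + a)" using nz by simp
  also have "\<dots> = (p powr (a / 2) * exp (a * of_real (ln 2)) * of_real (sqrt pi) * (2 * p) powr (-1 - a) * 2) *
     (((1 + a) / 2) * Gamma ((1 + a) / 2)) * zeta_reg (1 + a)" by simp
  also have "p powr (a / 2) * exp (a * of_real (ln 2)) * of_real (sqrt pi) * (2 * p) powr (-1 - a) * 2 = p powr (- (1 + a) / 2)"
  proof -
    define L where "L = complex_of_real (ln pi)"
    define M where "M = complex_of_real (ln 2)"
    have Lp: "p powr w = exp (w * L)" for w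
      by (simp add: powr_def p_def L_def Ln_of_real)
    have L2: "(2 * p) powr w = exp (w * (M + L))" for w
      using Ln_of_real[of "2 * pi"] by (simp add: powr_def p_def L_def M_def ln_mult)
    have sq: "of_real (sqrt pi) = exp (L / 2)"
    proof -
      have "sqrt pi = exp (ln pi / 2)" by (simp add: ln_sqrt[symmetric])
      thus ?thesis unfolding L_def by (metis exp_of_real of_real_divide of_real_numeral)
    qed
    have two: "2 = exp M" unfolding M_def by (metis exp_ln exp_of_real of_real_numeral zero_less_numeral)
    have "exp (a/2 * L) * exp (a * M) * exp (L / 2) * exp ((-1 - a) * (M + L)) * exp M = exp (- (1 + a) / 2 * L)"
      unfolding exp_add[symmetric] by (rule arg_cong[of _ _ exp]) (simp add: field_simps)
    thus ?thesis unfolding Lp L2 sq M_def[symmetric] using two by simp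
  qed
  also have "\<dots> * (((1 + a) / 2) * Gamma ((1 + a) / 2)) * zeta_reg (1 + a) = xi_half (1 + a)"
    unfolding xi_half_def G3 p_def ..
  finally show ?thesis by (simp add: a_def)
qed

lemma xi_half_reflection:
  assumes "-1 < Re s" "Re s < 2"
  shows "xi_half (1 - s) = xi_half s"
proof -
  define S where "S = {s. -1 < Re s \<and> Re s < 2}"
  have S: "S = {s. Re s > -1} \<inter> {s. Re s < 2}" by (auto simp: S_def)
  have op: "open S" unfolding S by (intro open_Int open_halfspace_Re_gt open_halfspace_Re_lt)
  have co: "connected S" unfolding S
    by (intro convex_connected convex_Int convex_halfspace_Re_gt convex_halfspace_Re_lt)
  define U where "U = complex_of_real ` {-1<..<0}"
  have h1: "xi_half holomorphic_on S" by (rule holomorphic_on_subset[OF holomorphic_xi_half]) (auto simp: S_def)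
  have "(xi_half \<circ> (\<lambda>s. 1 - s)) holomorphic_on S"
    by (rule holomorphic_on_compose_gen[OF _ holomorphic_xi_half]) (auto simp: S_def intro!: holomorphic_intros)
  hence h2: "(\<lambda>s. xi_half (1 - s) - xi_half s) holomorphic_on S" using h1 by (auto simp: o_def intro!: holomorphic_intros)
  have lim: "(- 1 / 2) islimpt U"
  proof -
    have "(complex_of_real (- 1 / 2)) islimpt (complex_of_real ` {-1<..<0})"
      by (rule islimpt_isCont_image) (auto simp: eventually_at_filter complex_eq_iff islimpt_greaterThanLessThan1 open_imp_islimpt)
    thus ?thesis by (simp add: U_def)
  qed
  have "xi_half (1 - s) - xi_half s = 0"
  proof (rule analytic_continuation[OF h2 op co _ _ lim])
    show "xi_half (1 - z) - xi_half z = 0" if zU: "z \<in> U" for z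
    proof -
      from zU obtain x where "z = - of_real (- x)" "-1 < x" "x < 0" by (auto simp: U_def)
      thus ?thesis using xi_half_reflection_real[of "-x"] by simp
    qed
  qed (use assms in \<open>auto simp: U_def S_def\<close>)
  thus ?thesis by simp
qed

text \<open>The half-planes Re s > -1 and Re s < 2 cover the plane, and on the strip where they
  overlap \<open>xi_half_reflection\<close> makes either branch valid; this is why the case
  distinction defines an entire function.\<close>

definition Xi :: "complex \<Rightarrow> complex" where
  "Xi s = (if Re s > -1 then xi_half s else xi_half (1 - s))"

lemma Xi_right: "Re s > -1 \<Longrightarrow> Xi s = xi_half s"
  by (simp add: Xi_def)

lemma Xi_left: "Re s < 2 \<Longrightarrow> Xi s = xi_half (1 - s)"
  using xi_half_reflection[of s] by (auto simp: Xi_def)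

lemma Xi_reflection: "Xi (1 - s) = Xi s"
  by (cases "Re s > -1") (simp_all add: Xi_right Xi_left)

lemma holomorphic_Xi: "Xi holomorphic_on S"
proof -
  have "Xi holomorphic_on {s. Re s > -1} \<union> {s. Re s < 2}"
  proof (rule holomorphic_on_Un)
    show "Xi holomorphic_on {s. Re s > -1}"
      using holomorphic_xi_half by (rule holomorphic_transform) (simp add: Xi_right)
    have "(xi_half \<circ> (\<lambda>s. 1 - s)) holomorphic_on {s. Re s < 2}"
      by (rule holomorphic_on_compose_gen[OF _ holomorphic_xi_half]) (auto intro!: holomorphic_intros)
    thus "Xi holomorphic_on {s. Re s < 2}"
      by (rule holomorphic_transform) (simp add: Xi_left)
  qed (auto simp: open_halfspace_Re_gt open_halfspace_Re_lt)
  thus ?thesis by (rule holomorphic_on_subset) auto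
qed

text \<open>Solves the definition of xi for zeta. Division by Gamma is expressed by the entire
  function \<open>rGamma\<close>, so no case distinction arises at the trivial zeros.\<close>

definition zeta_ext :: "complex \<Rightarrow> complex" where
  "zeta_ext s = Xi s * of_real pi powr (s / 2) * rGamma (1 + s / 2) / (s - 1)"

lemma zeta_ext_right:
  assumes "Re s > -1"
  shows "zeta_ext s = zeta_reg s / (s - 1)"
proof -
  have "1 + s / 2 \<notin> \<int>\<^sub>\<le>\<^sub>0" 
    using assms by (auto elim!: nonpos_Ints_cases simp: complex_eq_iff)
  hence "Gamma (1 + s / 2) * rGamma (1 + s / 2) = 1" by (simp add: rGamma_inverse_Gamma Gamma_nonzero)
  moreover have "complex_of_real pi powr (- s / 2) * of_real pi powr (s / 2) = 1" by (simp flip: powr_add)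
  ultimately have "xi_half s * of_real pi powr (s / 2) * rGamma (1 + s / 2) = zeta_reg s"
  proof -
    assume a: "Gamma (1 + s / 2) * rGamma (1 + s / 2) = 1" "complex_of_real pi powr (- s / 2) * of_real pi powr (s / 2) = 1"
    have "xi_half s * of_real pi powr (s / 2) * rGamma (1 + s / 2) =
       (of_real pi powr (- s / 2) * of_real pi powr (s / 2)) * (Gamma (1 + s / 2) * rGamma (1 + s / 2)) * zeta_reg s"
      unfolding xi_half_def by (simp only: mult_ac)
    thus ?thesis unfolding a by simp
  qed
  thus ?thesis using assms by (simp add: zeta_ext_def Xi_right)
qed

text \<open>A chosen object has its defining property only if a witness exists;
  \<open>zeta_ext\<close> is that witness. Uniqueness then spreads from Re s > 1 over the connected
  punctured plane.\<close>

lemma zeta_eq_zeta_ext: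
  assumes "s \<noteq> 1"
  shows "zeta s = zeta_ext s"
proof -
  let ?P = "\<lambda>g. g holomorphic_on - {1} \<and>
             (\<forall>s. Re s > 1 \<longrightarrow> (\<lambda>m. of_nat (Suc m) powr (- s)) sums g s)"
  have "?P zeta_ext"
  proof (intro conjI allI impI)
    show "zeta_ext holomorphic_on - {1}"
      unfolding zeta_ext_def by (intro holomorphic_intros holomorphic_Xi) auto
    show "(\<lambda>m. of_nat (Suc m) powr (- s)) sums zeta_ext s" if "Re s > 1" for s
      using Dirichlet_series_sums_zeta_reg[OF that] zeta_ext_right[of s] that by simp
  qed
  from this someI[of ?P, OF this] have Z: "?P zeta_ext" "?P zeta" unfolding zeta_def[symmetric] by blast+
  have "zeta s - zeta_ext s = 0"
  proof (rule analytic_continuation_open[of "{s. Re s > 1}" "- {1}" "\<lambda>s. zeta s - zeta_ext s" "\<lambda>_. 0"])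
    show "{s. 1 < Re s} \<noteq> {}" by (auto intro: exI[of _ 2])
    show "connected (- {1::complex})" by (intro connected_punctured_universe) auto
    show "(\<lambda>s. zeta s - zeta_ext s) holomorphic_on - {1}" using Z by (intro holomorphic_intros) auto
    show "zeta z - zeta_ext z = 0" if "z \<in> {s. 1 < Re s}" for z
      using Z that by (auto intro: sums_unique2)
  qed (use assms in \<open>auto simp: open_halfspace_Re_gt\<close>)
  thus ?thesis by simp
qed

lemma a_fun_zeta_eq_Xi:
  assumes "s \<noteq> 1" "s / 2 \<notin> \<int>\<^sub>\<le>\<^sub>0"
  shows "1 / 2 * a_fun s * zeta s = Xi s"
proof -
  have "s / 2 + 1 \<notin> \<int>\<^sub>\<le>\<^sub>0"
    using assms(2) plus_one_in_nonpos_Ints_imp by blast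
  hence g: "Gamma (1 + s / 2) * rGamma (1 + s / 2) = 1" by (simp add: rGamma_inverse_Gamma Gamma_nonzero add.commute)
  have G: "Gamma (1 + s / 2) = s / 2 * Gamma (s / 2)" 
    using Gamma_plus1[of "s/2"] assms by (simp add: add.commute)
  have p: "complex_of_real pi powr (- s / 2) * of_real pi powr (s / 2) = 1" by (simp flip: powr_add)
  have "1 / 2 * a_fun s * zeta s = 
    (of_real pi powr (- s / 2) * of_real pi powr (s / 2)) * (s / 2 * Gamma (s / 2) * rGamma (1 + s / 2)) * Xi s"
  proof -
    have "1 / 2 * (P * s * G * d) * (X * Q * R / d) = (P * Q) * (s / 2 * G * R) * X" if "d \<noteq> 0" for P G Q R X d :: complex
      using that by simp
    from this[of "s - 1"] show ?thesis
      unfolding zeta_eq_zeta_ext[OF assms(1)] a_fun_def zeta_ext_def using assms(1) by simp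
  qed
  also have "\<dots> = Xi s" using g unfolding p G[symmetric] by simp
  finally show ?thesis .
qed

lemma xi_eq_Xi: "xi s = Xi s"
proof -
  have "eventually (\<lambda>z. 1 / 2 * a_fun z * zeta z = Xi z) (at s)"
  proof -
    have "eventually (\<lambda>z. z \<noteq> 1) (at s)" by (rule eventually_neq_at_within)
    moreover have "eventually (\<lambda>z. z / 2 \<notin> \<int>\<^sub>\<le>\<^sub>0) (at s)"
    proof -
      \<comment> \<open>The points to avoid are the zeros of the entire function rGamma(z/2), which
        are isolated because it does not vanish at z = 2.\<close>
      have "(\<lambda>z::complex. rGamma (z / 2)) holomorphic_on UNIV" by (intro holomorphic_intros) auto
      from non_zero_neighbour_alt[OF this, of s 2]
      have "eventually (\<lambda>z. rGamma (z / 2) \<noteq> 0) (at s)" by (auto elim: eventually_mono)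
      thus ?thesis by (simp add: rGamma_eq_zero_iff)
    qed
    ultimately show ?thesis by eventually_elim (rule a_fun_zeta_eq_Xi)
  qed
  hence "remove_sings (\<lambda>z. 1 / 2 * a_fun z * zeta z) s = remove_sings Xi s"
    by (rule remove_sings_cong) auto
  also have "\<dots> = Xi s"
    using holomorphic_Xi[of UNIV] by (intro remove_sings_at_analytic) (auto simp: analytic_at)
  finally show ?thesis by (simp add: xi_def)
qed

section \<open>Euler product and the 3-4-1 inequality\<close>

text \<open>In the logarithmic series of the three factors, weighted 3, 4 and 1, the n-th terms add
  up to -(r^n / n)(3 + 4u + u^2) with u = z^n on the unit circle, and Re (3 + 4u + u^2) = 2 (1 + Re
  u)^2.\<close>

lemma prod_3_4_1_le_1:
  fixes r :: real and z :: complex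
  assumes r: "0 \<le> r" "r < 1" and z: "norm z = 1"
  shows "norm (1 - of_real r :: complex) ^ 3 * norm (1 - of_real r * z) ^ 4 * norm (1 - of_real r * z^2) \<le> 1"
proof -
  define L where "L = (\<lambda>w::complex. ln (1 - w))"
  \<comment> \<open>The series runs from n = 0, where division by zero makes the term 0.\<close>
  have L: "(\<lambda>n. - (w ^ n / of_nat n)) sums L w" if "norm w < 1" for w
  proof -
    have "(\<lambda>n. - ((- (-w)) ^ n) / of_nat n) sums ln (1 + (-w))" using that by (intro Ln_series') auto
    thus ?thesis by (simp add: L_def)
  qed
  define w1 where "w1 = complex_of_real r"
  define w2 where "w2 = of_real r * z"
  define w3 where "w3 = of_real r * z^2"
  have w: "norm w1 < 1" "norm w2 < 1" "norm w3 < 1"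
    using r z by (simp_all add: w1_def w2_def w3_def norm_mult norm_power)
  have nL: "norm (1 - w) = exp (Re (L w))" if "norm w < 1" for w
  proof -
    have "w \<noteq> 1" using that by auto
    thus ?thesis by (simp add: L_def flip: norm_exp_eq_Re)
  qed
  have S: "(\<lambda>n. Re (3 * - (w1 ^ n / of_nat n) + 4 * - (w2 ^ n / of_nat n) + - (w3 ^ n / of_nat n))) sums
          Re (3 * L w1 + 4 * L w2 + L w3)"
    by (intro sums_Re sums_add sums_mult L w)
  have le: "Re (3 * - (w1 ^ n / of_nat n) + 4 * - (w2 ^ n / of_nat n) + - (w3 ^ n / of_nat n)) \<le> 0" for n
  proof -
    define u where "u = z ^ n"
    have "norm u = 1" by (simp add: u_def norm_power z)
    hence u: "(Re u)^2 + (Im u)^2 = 1" by (simp add: cmod_def)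
    have e: "3 * - (w1 ^ n / of_nat n) + 4 * - (w2 ^ n / of_nat n) + - (w3 ^ n / of_nat n) =
      of_real (- (r ^ n / n)) * (3 + 4 * u + u^2)"
    proof -
      define R where "R = complex_of_real r ^ n"
      have w: "w1 ^ n = R" "w2 ^ n = R * u" "w3 ^ n = R * u^2"
        by (simp_all add: w1_def w2_def w3_def u_def R_def power_mult_distrib mult.commute flip: power_mult)
      have "3 * - (R / d) + 4 * - (R * u / d) + - (R * u^2 / d) = - (R / d) * (3 + 4 * u + u^2)" for d
        by (simp add: algebra_simps add_divide_distrib)
      thus ?thesis unfolding w by (simp add: R_def)
    qed
    have "Re (3 + 4 * u + u^2) = 2 * (1 + Re u)^2"
      using u by (simp add: power2_eq_square algebra_simps)
    moreover have "Re (of_real x * w) = x * Re w" for x w by simp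
    ultimately have "Re (3 * - (w1 ^ n / of_nat n) + 4 * - (w2 ^ n / of_nat n) + - (w3 ^ n / of_nat n)) = 
       - (r ^ n / n) * (2 * (1 + Re u)^2)" unfolding e by metis
    also have "\<dots> \<le> 0" using r by (intro mult_nonpos_nonneg) auto
    finally show ?thesis .
  qed
  have "Re (3 * L w1 + 4 * L w2 + L w3) \<le> 0"
    by (rule sums_le[OF le S sums_zero])
  hence "exp (3 * Re (L w1) + 4 * Re (L w2) + Re (L w3)) \<le> 1" by simp
  also have "exp (3 * Re (L w1) + 4 * Re (L w2) + Re (L w3)) = exp (Re (L w1)) ^ 3 * exp (Re (L w2)) ^ 4 * exp (Re (L w3))"
    by (simp add: exp_add flip: exp_of_nat_mult)
  finally have "norm (1 - w1) ^ 3 * norm (1 - w2) ^ 4 * norm (1 - w3) \<le> 1" using w by (simp add: nL)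
  thus ?thesis by (simp add: w1_def w2_def w3_def)
qed

lemma summable_on_of_nat_powr:
  assumes "Re s > 1"
  shows "(\<lambda>n. norm (of_nat n powr (-s) :: complex)) summable_on A"
proof -
  have "summable (\<lambda>n. real n powr (- Re s))" using assms by (subst summable_real_powr_iff) auto
  moreover have "norm (of_nat n powr (-s) :: complex) = real n powr (- Re s)" for n
    using norm_powr_real_powr[of "of_nat n" "-s"] by simp
  ultimately have "(\<lambda>n. norm (of_nat n powr (-s) :: complex)) summable_on UNIV"
    by (subst summable_on_UNIV_nonneg_real_iff) auto
  thus ?thesis by (rule summable_on_subset_banach) auto
qed

text \<open>Sieving: among the numbers free of the primes treated so far, the multiples of a new
  prime p are p times that same set, and they contribute p^(-s) times its sum. The index 0 adds
  nothing, as \<open>0 powr (-s) = 0\<close>.\<close>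

lemma infsum_coprime_to_primes:
  assumes "Re s > 1" "finite P" "\<And>p. p \<in> P \<Longrightarrow> prime (p::nat)"
  shows "infsum (\<lambda>n. of_nat n powr (-s)) {n. \<forall>p\<in>P. \<not> p dvd n} = 
           (\<Prod>p\<in>P. 1 - of_nat p powr (-s)) * (\<Sum>\<^sub>\<infinity>n. of_nat n powr (-s) :: complex)"
  using assms(2,3)
proof (induction P rule: finite_induct)
  case empty
  show ?case by simp
next
  case (insert p P)
  define f where "f = (\<lambda>n. of_nat n powr (-s) :: complex)"
  define A where "A = {n. \<forall>p\<in>P. \<not> p dvd n}"
  have p: "prime p" using insert by auto
  have sm: "f summable_on B" for B
    unfolding f_def by (rule abs_summable_summable[OF summable_on_of_nat_powr[OF assms(1)]])
  have A: "A = {n. \<forall>p\<in>insert p P. \<not> p dvd n} \<union> (\<lambda>n. p * n) ` A"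
  proof (intro equalityI subsetI)
    fix n assume n: "n \<in> A"
    show "n \<in> {n. \<forall>p\<in>insert p P. \<not> p dvd n} \<union> (\<lambda>n. p * n) ` A"
    proof (cases "p dvd n")
      case True
      then obtain m where m: "n = p * m" by auto
      hence "m \<in> A" using n by (auto simp: A_def)
      thus ?thesis using m by auto
    qed (use n in \<open>auto simp: A_def\<close>)
  next
    fix n assume "n \<in> {n. \<forall>p\<in>insert p P. \<not> p dvd n} \<union> (\<lambda>n. p * n) ` A"
    thus "n \<in> A"
    proof
      assume "n \<in> (\<lambda>n. p * n) ` A"
      then obtain m where m: "m \<in> A" "n = p * m" by auto
      have "\<not> q dvd p * m" if q: "q \<in> P" for q
      proof
        assume "q dvd p * m"
        moreover have "prime q" using q insert by auto
        ultimately have "q dvd p \<or> q dvd m" by (simp add: prime_dvd_mult_iff)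
        moreover have "\<not> q dvd m" using m q by (auto simp: A_def)
        moreover have "\<not> q dvd p" using primes_dvd_imp_eq[OF \<open>prime q\<close> p] q insert.hyps by auto
        ultimately show False by blast
      qed
      thus ?thesis using m by (auto simp: A_def)
    qed (auto simp: A_def)
  qed
  have "infsum f A = infsum f {n. \<forall>p\<in>insert p P. \<not> p dvd n} + infsum f ((\<lambda>n. p * n) ` A)"
    by (subst A, rule infsum_Un_disjoint) (auto intro: sm)
  also have "infsum f ((\<lambda>n. p * n) ` A) = infsum (f \<circ> (\<lambda>n. p * n)) A"
    using p by (intro infsum_reindex) (auto simp: inj_on_def)
  also have "f \<circ> (\<lambda>n. p * n) = (\<lambda>n. of_nat p powr (-s) * f n)"
    by (auto simp: f_def fun_eq_iff powr_times_real)
  also have "infsum (\<lambda>n. of_nat p powr (-s) * f n) A = of_nat p powr (-s) * infsum f A"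
    by (rule infsum_cmult_right) (auto intro: sm)
  finally have "infsum f A - of_nat p powr (-s) * infsum f A = infsum f {n. \<forall>p\<in>insert p P. \<not> p dvd n}"
    by (subst diff_eq_eq)
  hence "infsum f {n. \<forall>p\<in>insert p P. \<not> p dvd n} = (1 - of_nat p powr (-s)) * infsum f A"
    by (simp only: left_diff_distrib mult_1)
  also have "infsum f A = (\<Prod>p\<in>P. 1 - of_nat p powr (-s)) * (\<Sum>\<^sub>\<infinity>n. f n)"
    unfolding f_def A_def using insert by auto
  finally show ?case using insert by (simp add: f_def mult_ac)
qed

text \<open>What survives the sieve by the primes up to N is 1 and numbers greater than N, whose sum
  is bounded by a tail of a convergent series. Stated as finite product times series, the Euler
  product involves no infinite product and no reciprocal.\<close>

lemma Euler_product_tendsto: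
  assumes "Re s > 1"
  shows "(\<lambda>N. (\<Prod>p | prime p \<and> p \<le> N. 1 - of_nat p powr (-s)) * (\<Sum>\<^sub>\<infinity>n. of_nat n powr (-s) :: complex)) \<longlonglongrightarrow> 1"
proof -
  define f where "f = (\<lambda>n. of_nat n powr (-s) :: complex)"
  define A where "A = (\<lambda>N. {n::nat. \<forall>p\<in>{p. prime p \<and> p \<le> N}. \<not> p dvd n})"
  have fin: "finite {p::nat. prime p \<and> p \<le> N}" for N by (rule finite_subset[of _ "{..N}"]) auto
  have sm: "f summable_on B" "(\<lambda>n. norm (f n)) summable_on B" for B
    unfolding f_def using summable_on_of_nat_powr[OF assms, of B] by (auto intro: abs_summable_summable)
  have nf: "norm (f n) = real n powr (- Re s)" for n
    unfolding f_def using norm_powr_real_powr[of "of_nat n" "-s"] by simp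
  have smr: "summable (\<lambda>n. real n powr (- Re s))" using assms by (subst summable_real_powr_iff) auto
  have bound: "norm (infsum f (A N) - 1) \<le> (\<Sum>n. real (n + Suc N) powr (- Re s))" for N
  proof -
    have 1: "1 \<in> A N" by (auto simp: A_def)
    \<comment> \<open>For N < 2 the number 0 survives as well, there being no prime to divide it;
      its term is 0.\<close>
    have sub: "A N - {1} \<subseteq> insert 0 {Suc N..}"
    proof
      fix n assume n: "n \<in> A N - {1}"
      show "n \<in> insert 0 {Suc N..}"
      proof (cases "n = 0")
        case False
        with n have "n \<noteq> 1" by auto
        then obtain p where p: "prime p" "p dvd n" using prime_factor_nat by blast
        hence "p \<le> n" using False by (auto dest: dvd_imp_le)
        moreover have "\<not> p \<le> N" using n p by (auto simp: A_def)
        ultimately show ?thesis by auto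
      qed auto
    qed
    have "infsum f (A N) = infsum f {1} + infsum f (A N - {1})"
      by (subst infsum_Un_disjoint[symmetric]) (use 1 in \<open>auto intro: sm simp: insert_absorb\<close>)
    hence "infsum f (A N) - 1 = infsum f (A N - {1})" by (simp add: f_def)
    hence "norm (infsum f (A N) - 1) \<le> infsum (\<lambda>n. norm (f n)) (A N - {1})"
      using norm_infsum_bound[OF sm(2)] by simp
    also have "\<dots> \<le> infsum (\<lambda>n. norm (f n)) {Suc N..}"
      by (rule infsum_mono_neutral[OF sm(2) sm(2)]) (use sub in \<open>auto simp: f_def\<close>)
    also have "{Suc N..} = range (\<lambda>n. n + Suc N)" by (auto simp: image_iff le_iff_add add.commute)
    also have "infsum (\<lambda>n. norm (f n)) \<dots> = infsum (\<lambda>n. real (n + Suc N) powr (- Re s)) UNIV"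
      by (subst infsum_reindex) (auto simp: nf o_def inj_on_def)
    also have "\<dots> = (\<Sum>n. real (n + Suc N) powr (- Re s))"
    proof (rule infsumI, rule norm_summable_imp_has_sum)
      have "summable (\<lambda>n. real (n + Suc N) powr (- Re s))" by (rule summable_ignore_initial_segment[OF smr])
      thus "summable (\<lambda>n. norm (real (n + Suc N) powr (- Re s)))" 
           "(\<lambda>n. real (n + Suc N) powr (- Re s)) sums (\<Sum>n. real (n + Suc N) powr (- Re s))"
        by (auto simp: summable_sums)
    qed
    finally show ?thesis .
  qed
  have "(\<lambda>N. \<Sum>n. real (n + N) powr (- Re s)) \<longlonglongrightarrow> 0"
    by (rule suminf_exist_split2[OF smr])
  hence lim: "(\<lambda>N. \<Sum>n. real (n + Suc N) powr (- Re s)) \<longlonglongrightarrow> 0" by (rule LIMSEQ_Suc)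
  have "(\<lambda>N. infsum f (A N) - 1) \<longlonglongrightarrow> 0"
    by (rule Lim_null_comparison[OF _ lim]) (use bound in auto)
  hence "(\<lambda>N. infsum f (A N)) \<longlonglongrightarrow> 1" by (simp add: LIM_zero_iff)
  thus ?thesis unfolding f_def A_def
    by (subst (asm) infsum_coprime_to_primes[OF assms fin]) auto
qed

lemma infsum_eq_Dirichlet:
  assumes "Re s > 1" "(\<lambda>n. of_nat (Suc n) powr (-s)) sums z"
  shows "(\<Sum>\<^sub>\<infinity>n. of_nat n powr (-s) :: complex) = z"
proof -
  have "(\<lambda>n. of_nat n powr (-s) :: complex) sums (z + of_nat 0 powr (-s))"
    using assms(2) by (subst sums_Suc_iff [symmetric]) simp
  moreover have "summable (\<lambda>n. norm (of_nat n powr (-s) :: complex))"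
    using summable_on_of_nat_powr[OF assms(1), of UNIV] by (subst (asm) summable_on_UNIV_nonneg_real_iff) auto
  ultimately show ?thesis by (intro infsumI norm_summable_imp_has_sum) auto
qed

text \<open>The finite products satisfy the 3-4-1 bound by 1, prime by prime. Multiplied by the
  corresponding values of the series they tend to 1, so those values alone must have 3-4-1 product
  at least 1.\<close>

lemma Dirichlet_series_3_4_1:
  fixes \<zeta> :: "complex \<Rightarrow> complex"
  assumes D: "\<And>s. Re s > 1 \<Longrightarrow> (\<lambda>n. of_nat (Suc n) powr (-s)) sums \<zeta> s"
  assumes "\<sigma> > 1"
  shows "norm (\<zeta> (of_real \<sigma>)) ^ 3 * norm (\<zeta> (Complex \<sigma> t)) ^ 4 * norm (\<zeta> (Complex \<sigma> (2 * t))) \<ge> 1"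
proof -
  define E where "E = (\<lambda>s N. (\<Prod>p | prime p \<and> p \<le> N. 1 - of_nat p powr (-s)) :: complex)"
  have lim: "(\<lambda>N. E s N * \<zeta> s) \<longlonglongrightarrow> 1" if "Re s > 1" for s
    unfolding E_def using Euler_product_tendsto[OF that] infsum_eq_Dirichlet[OF that D[OF that]] by simp
  let ?F = "\<lambda>N. norm (E (of_real \<sigma>) N * \<zeta> (of_real \<sigma>)) ^ 3 * norm (E (Complex \<sigma> t) N * \<zeta> (Complex \<sigma> t)) ^ 4 *
              norm (E (Complex \<sigma> (2 * t)) N * \<zeta> (Complex \<sigma> (2 * t)))"
  have "?F \<longlonglongrightarrow> norm (1::complex) ^ 3 * norm (1::complex) ^ 4 * norm (1::complex)"
    using assms(2) by (intro tendsto_intros lim) auto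
  moreover have "?F N \<le> norm (\<zeta> (of_real \<sigma>)) ^ 3 * norm (\<zeta> (Complex \<sigma> t)) ^ 4 * norm (\<zeta> (Complex \<sigma> (2 * t)))" for N
  proof -
    have "norm (E (of_real \<sigma>) N) ^ 3 * norm (E (Complex \<sigma> t) N) ^ 4 * norm (E (Complex \<sigma> (2 * t)) N) =
       (\<Prod>p | prime p \<and> p \<le> N. norm (1 - of_nat p powr (-of_real \<sigma>) :: complex) ^ 3 * 
          norm (1 - of_nat p powr (-Complex \<sigma> t) :: complex) ^ 4 * norm (1 - of_nat p powr (-Complex \<sigma> (2*t)) :: complex))"
      unfolding E_def by (simp only: prod.distrib prod_power_distrib[symmetric] prod_norm)
    also have "\<dots> \<le> 1"
    proof (rule prod_le_1)
      fix p assume "p \<in> {p. prime p \<and> p \<le> N}"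
      hence p: "p > 1" using prime_gt_1_nat by auto
      define r where "r = real p powr (-\<sigma>)"
      define z where "z = (of_nat p powr (- \<i> * of_real t) :: complex)"
      have "of_nat p powr (-of_real \<sigma>) = complex_of_real (real p) powr (of_real (-\<sigma>))" by simp
      also have "\<dots> = of_real r" unfolding r_def by (rule powr_of_real) auto
      finally have e1: "of_nat p powr (-of_real \<sigma>) = complex_of_real r" .
      have e2: "of_nat p powr (-Complex \<sigma> t) = of_real r * z" 
        unfolding z_def e1[symmetric] by (simp add: Complex_eq flip: powr_add)
      have e3: "of_nat p powr (-Complex \<sigma> (2*t)) = of_real r * z^2"
        unfolding z_def e1[symmetric] power2_eq_square by (simp add: Complex_eq algebra_simps flip: powr_add)
      have "norm z = 1" unfolding z_def using p by (subst norm_powr_real_powr) auto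
      moreover have "0 \<le> r" "r < 1" unfolding r_def using p assms(2) by (auto intro: powr_less_one)
      ultimately show "0 \<le> norm (1 - of_nat p powr (-of_real \<sigma>) :: complex) ^ 3 * 
          norm (1 - of_nat p powr (-Complex \<sigma> t) :: complex) ^ 4 * norm (1 - of_nat p powr (-Complex \<sigma> (2*t)) :: complex) \<and>
          norm (1 - of_nat p powr (-of_real \<sigma>) :: complex) ^ 3 * 
          norm (1 - of_nat p powr (-Complex \<sigma> t) :: complex) ^ 4 * norm (1 - of_nat p powr (-Complex \<sigma> (2*t)) :: complex) \<le> 1"
        unfolding e1 e2 e3 using prod_3_4_1_le_1 by simp
    qed
    finally have "norm (E (of_real \<sigma>) N) ^ 3 * norm (E (Complex \<sigma> t) N) ^ 4 * norm (E (Complex \<sigma> (2 * t)) N) \<le> 1" .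
    hence "(norm (E (of_real \<sigma>) N) ^ 3 * norm (E (Complex \<sigma> t) N) ^ 4 * norm (E (Complex \<sigma> (2 * t)) N)) *
      (norm (\<zeta> (of_real \<sigma>)) ^ 3 * norm (\<zeta> (Complex \<sigma> t)) ^ 4 * norm (\<zeta> (Complex \<sigma> (2 * t)))) \<le>
       1 * (norm (\<zeta> (of_real \<sigma>)) ^ 3 * norm (\<zeta> (Complex \<sigma> t)) ^ 4 * norm (\<zeta> (Complex \<sigma> (2 * t))))"
      by (intro mult_right_mono) auto
    thus ?thesis by (simp add: norm_mult power_mult_distrib mult_ac)
  qed
  ultimately show ?thesis
    by (intro LIMSEQ_le_const2[of ?F]) (auto intro: exI[of _ 0])
qed

section \<open>Bounds for zeta\<close>

lemma zeta_right:
  assumes "Re s > -1" "s \<noteq> 1"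
  shows "zeta s = zeta_reg s / (s - 1)"
  using assms zeta_eq_zeta_ext zeta_ext_right by simp

lemma holomorphic_zeta: "zeta holomorphic_on - {1}"
proof -
  have "zeta_ext holomorphic_on - {1}"
    unfolding zeta_ext_def by (intro holomorphic_intros holomorphic_Xi) auto
  thus ?thesis by (rule holomorphic_transform) (auto simp: zeta_eq_zeta_ext)
qed

lemma zeta_sums: "Re s > 1 \<Longrightarrow> (\<lambda>n. of_nat (Suc n) powr (-s)) sums zeta s"
  using Dirichlet_series_sums_zeta_reg[of s] zeta_right[of s] by (cases "s = 1") (simp_all del: of_nat_Suc)

text \<open>Interpolation, up to the factor |s - 1|, between the bounds 2 m^(-Re s) and |s| m^(-Re s
  - 1) with m = n + 1: giving up a factor \<open>W\<close> of order |s|^(1/3) buys m^(-1/3). On Re s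
  >= 3/4 the exponent 3/4 + 1/3 = 13/12 then exceeds 1.\<close>

lemma norm_euler_maclaurin_term_le':
  assumes "Re s \<ge> 3 / 4" "norm s \<le> 3 * W ^ 3" "W \<ge> 1"
  shows "norm (euler_maclaurin_term n s) \<le> norm (s - 1) * (3 * W * real (Suc n) powr (- (13 / 12)))"
proof -
  define m where "m = real (Suc n)"
  define c where "c = complex_of_real m"
  have m: "m \<ge> 1" by (simp add: m_def)
  define S where "S = complex_of_real ` {m..m+1}"
  have S: "convex S" unfolding S_def by (intro convex_linear_image) (auto intro!: bounded_linear.linear bounded_linear_of_real)
  have "complex_of_real (m + 1) = c + 1" by (simp add: c_def)
  hence Sm: "c \<in> S" "c + 1 \<in> S" unfolding S_def c_def
    by (metis imageI atLeastAtMost_iff le_add_same_cancel1 order_refl zero_le_one)+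
  have nz: "z \<notin> \<real>\<^sub>\<le>\<^sub>0 \<and> norm (z powr (-s)) \<le> m powr (- Re s)" if "z \<in> S" for z
  proof -
    from that obtain x where x: "z = of_real x" "m \<le> x" by (auto simp: S_def)
    have "norm (z powr (-s)) = x powr (- Re s)" using x m by (simp add: norm_powr_real_powr)
    also have "\<dots> \<le> m powr (- Re s)" using x m assms by (intro powr_mono2') auto
    finally show ?thesis using x m by (auto simp: complex_nonpos_Reals_iff)
  qed
  have e: "euler_maclaurin_term n s = (s - 1) * ((c powr (-s) + (c + 1) powr (-s)) / 2) + ((c + 1) powr (1 - s) - c powr (1 - s))"
    by (simp add: euler_maclaurin_term_def c_def m_def add_ac)
  have "norm ((c + 1) powr (1 - s) - c powr (1 - s)) \<le> (norm (s - 1) * m powr (- Re s)) * norm (c + 1 - c)"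
  proof (rule field_differentiable_bound[OF S _ _ Sm(2) Sm(1)])
    fix z assume z: "z \<in> S"
    show "((\<lambda>z. z powr (1 - s)) has_field_derivative (1 - s) * z powr (1 - s - 1)) (at z within S)"
      using nz[OF z] by (auto intro!: derivative_eq_intros)
    show "norm ((1 - s) * z powr (1 - s - 1)) \<le> norm (s - 1) * m powr (- Re s)"
      using nz[OF z] by (auto simp: norm_mult norm_minus_commute intro!: mult_left_mono)
  qed
  moreover have "norm ((s - 1) * ((c powr (-s) + (c + 1) powr (-s)) / 2)) \<le> norm (s - 1) * m powr (- Re s)"
  proof -
    have "norm (c powr (-s) + (c + 1) powr (-s)) \<le> m powr (- Re s) + m powr (- Re s)"
      using nz[OF Sm(1)] nz[OF Sm(2)] by (intro norm_triangle_mono) auto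
    thus ?thesis unfolding norm_mult by (intro mult_left_mono) auto
  qed
  ultimately have b1: "norm (euler_maclaurin_term n s) \<le> norm (s - 1) * (2 * m powr (- Re s))"
    unfolding e by (intro order.trans[OF norm_triangle_ineq]) simp
  have b2: "norm (euler_maclaurin_term n s) \<le> norm (s - 1) * (norm s * m powr (- Re s - 1))"
    using norm_euler_maclaurin_term_le(2)[of s n] assms by (simp add: m_def mult_ac)
  have m12: "m powr (- Re s) \<le> m powr (- (3 / 4))" using m assms by (intro powr_mono) auto
  have "min 2 (norm s / m) \<le> 3 * W * m powr (- (1 / 3))"
  proof -
    define y where "y = root 3 m"
    have y: "y > 0" "y ^ 3 = m" using m by (simp_all add: y_def)
    have y': "m powr (1 / 3) = y" using root_powr_inverse[of 3 m] m by (simp add: y_def)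
    \<comment> \<open>Either y <= W, and the constant 2 is small enough, or W/y < 1, and then the
      cube of W/y is at most W/y itself.\<close>
    have "min 2 (norm s / m) \<le> 3 * W / y"
    proof (cases "W \<ge> y")
      case True
      hence "1 \<le> W / y" using y by simp
      thus ?thesis by simp
    next
      case False
      hence "W / y \<le> 1" "0 \<le> W / y" using y assms by auto
      hence "(W / y) ^ 3 \<le> W / y" using power_decreasing[of 1 3 "W / y"] by simp
      moreover have "norm s / m \<le> 3 * (W / y) ^ 3" using assms m y by (simp add: power_divide divide_right_mono)
      ultimately show ?thesis by simp
    qed
    moreover have "m powr (- (1 / 3)) = 1 / y" by (simp only: powr_minus_divide y')
    ultimately show ?thesis by (simp only: times_divide_eq_right mult_1_right)
  qed
  moreover have "norm (euler_maclaurin_term n s) \<le> norm (s - 1) * (m powr (- Re s) * min 2 (norm s / m))"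
  proof -
    have "m powr (- Re s - 1) = m powr (- Re s) / m" using m by (simp add: powr_diff)
    thus ?thesis using b1 b2 by (cases "2 \<le> norm s / m") (simp_all add: mult_ac)
  qed
  moreover have "norm (s - 1) * (m powr (- Re s) * min 2 (norm s / m)) \<le> norm (s - 1) * (m powr (- (3/4)) * (3 * W * m powr (- (1 / 3))))"
    using m12 m calculation(1) by (intro mult_left_mono mult_mono) auto
  ultimately have "norm (euler_maclaurin_term n s) \<le> norm (s - 1) * (m powr (- (3/4)) * (3 * W * m powr (- (1 / 3))))"
    by linarith
  also have "m powr (- (3/4)) * (3 * W * m powr (- (1 / 3))) = 3 * W * m powr (- (13 / 12))"
    by (simp flip: powr_add)
  finally show ?thesis by (simp add: m_def)
qed

text \<open>The summand 1 keeps the quantity at least 1 near the real axis, and the cube root turns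
  the growth exponents 1/3 and 4/3 into the integer powers 1 and 4.\<close>

definition cbrt_height :: "real \<Rightarrow> real" where "cbrt_height t = root 3 (1 + \<bar>t\<bar>)"

lemma cbrt_height: "cbrt_height t ^ 3 = 1 + \<bar>t\<bar>" "cbrt_height t \<ge> 1"
  by (simp_all add: cbrt_height_def)

lemma cbrt_height_le: "1 + \<bar>t'\<bar> \<le> 8 * (1 + \<bar>t\<bar>) \<Longrightarrow> cbrt_height t' \<le> 2 * cbrt_height t"
proof -
  assume *: "1 + \<bar>t'\<bar> \<le> 8 * (1 + \<bar>t\<bar>)"
  have "root 3 8 = (2::real)" by (rule real_root_pos_unique) auto
  moreover have "root 3 (8 * (1 + \<bar>t\<bar>)) = root 3 8 * root 3 (1 + \<bar>t\<bar>)" by (rule real_root_mult)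
  moreover have "root 3 (1 + \<bar>t'\<bar>) \<le> root 3 (8 * (1 + \<bar>t\<bar>))" using * by (intro real_root_le_mono) auto
  ultimately show ?thesis by (simp only: cbrt_height_def)
qed

lemma zeta_upper_bound:
  assumes "\<tau> > 0"
  obtains C where "C > 0" "\<And>s. 3 / 4 \<le> Re s \<Longrightarrow> Re s \<le> 3 \<Longrightarrow> \<bar>Im s\<bar> \<ge> \<tau> \<Longrightarrow> norm (zeta s) \<le> C * cbrt_height (Im s)"
proof -
  define K where "K = (\<Sum>n. real (Suc n) powr (- (13 / 12)))"
  have sm: "summable (\<lambda>n. real (Suc n) powr (- (13 / 12)))" by (rule summable_Suc_powr) auto
  have K: "K \<ge> 0" unfolding K_def by (rule suminf_nonneg[OF sm]) auto
  have "norm (zeta s) \<le> (1 + 2 / \<tau> + 3 * K) * cbrt_height (Im s)"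
    if s: "3 / 4 \<le> Re s" "Re s \<le> 3" "\<bar>Im s\<bar> \<ge> \<tau>" for s
  proof -
    define W where "W = cbrt_height (Im s)"
    have W: "W \<ge> 1" "W ^ 3 = 1 + \<bar>Im s\<bar>" by (simp_all add: W_def cbrt_height)
    have s1: "s \<noteq> 1" using s assms by auto
    have tau: "\<tau> \<le> norm (s - 1)" using s abs_Im_le_cmod[of "s - 1"] by simp
    have ns: "norm s \<le> 3 * W ^ 3" using s cmod_le[of s] W by simp
    have "norm (\<Sum>n. euler_maclaurin_term n s) \<le> (\<Sum>n. norm (s - 1) * (3 * W * real (Suc n) powr (- (13 / 12))))"
      using sm by (intro norm_suminf_le norm_euler_maclaurin_term_le' s ns W summable_mult)
    also have "\<dots> = norm (s - 1) * (3 * W * K)"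
      unfolding K_def by (simp only: suminf_mult[OF summable_mult[OF sm]] suminf_mult[OF sm])
    finally have H: "norm (\<Sum>n. euler_maclaurin_term n s) \<le> norm (s - 1) * (3 * W * K)" .
    have "norm ((s + 1) / 2) \<le> norm (s - 1) / 2 + 1"
    proof -
      have "(s + 1) / 2 = (s - 1) / 2 + 1" by (simp add: field_simps)
      thus ?thesis using norm_triangle_ineq[of "(s - 1) / 2" 1] by (simp only: norm_divide) simp
    qed
    also have "\<dots> \<le> norm (s - 1) * (1 + 2 / \<tau>)"
    proof -
      have "1 \<le> norm (s - 1) / \<tau>" using tau assms by simp
      moreover have "norm (s - 1) * (1 + 2 / \<tau>) = norm (s - 1) + 2 * (norm (s - 1) / \<tau>)" by (simp add: algebra_simps)
      ultimately show ?thesis using norm_ge_zero[of "s - 1"] by linarith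
    qed
    finally have "norm (zeta_reg s) \<le> norm (s - 1) * (1 + 2 / \<tau>) + norm (s - 1) * (3 * W * K)"
      unfolding zeta_reg_def using H by (intro norm_triangle_mono)
    also have "\<dots> \<le> norm (s - 1) * (1 + 2 / \<tau>) * W + norm (s - 1) * (3 * W * K)"
      using W assms mult_left_mono[of 1 W "norm (s - 1) * (1 + 2 / \<tau>)"] by simp
    finally have "norm (zeta_reg s) \<le> ((1 + 2 / \<tau> + 3 * K) * W) * norm (s - 1)" by (simp add: algebra_simps)
    moreover have "norm (s - 1) > 0" using s1 by simp
    ultimately have "norm (zeta_reg s) / norm (s - 1) \<le> (1 + 2 / \<tau> + 3 * K) * W" by (simp add: pos_divide_le_eq)
    thus ?thesis using s s1 by (simp add: zeta_right norm_divide W_def)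
  qed
  moreover have "1 + 2 / \<tau> + 3 * K > 0" using K assms by (intro add_pos_nonneg) auto
  ultimately show ?thesis using that by blast
qed

lemma zeta_diff_bound:
  assumes "\<tau> > 0"
  obtains C where "C > 0"
    "\<And>\<sigma> \<sigma>' t. 1 \<le> \<sigma> \<Longrightarrow> \<sigma> \<le> \<sigma>' \<Longrightarrow> \<sigma>' \<le> 2 \<Longrightarrow> \<bar>t\<bar> \<ge> \<tau> \<Longrightarrow>
       norm (zeta (Complex \<sigma> t) - zeta (Complex \<sigma>' t)) \<le> C * cbrt_height t * (\<sigma>' - \<sigma>)"
proof -
  obtain C where C: "C > 0" "\<And>s. 3 / 4 \<le> Re s \<Longrightarrow> Re s \<le> 3 \<Longrightarrow> \<bar>Im s\<bar> \<ge> \<tau> / 2 \<Longrightarrow> norm (zeta s) \<le> C * cbrt_height (Im s)"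
    using zeta_upper_bound[of "\<tau> / 2"] assms by auto
  \<comment> \<open>The radius 1/4 keeps circles about points with Re >= 1 inside the region Re >=
    3/4 of the upper bound, and \<tau>/2 keeps them away from the pole at 1.\<close>
  define r where "r = min (1 / 4) (\<tau> / 2)"
  have r: "r > 0" "r \<le> 1 / 4" "r \<le> \<tau> / 2" using assms by (auto simp: r_def)
  have deriv: "norm (deriv zeta w) \<le> 2 * C / r * cbrt_height (Im w)"
    if w: "1 \<le> Re w" "Re w \<le> 2" "\<bar>Im w\<bar> \<ge> \<tau>" for w
  proof -
    have near: "\<bar>Re x - Re w\<bar> \<le> r \<and> \<bar>Im x - Im w\<bar> \<le> r" if "norm (w - x) \<le> r" for x
      using abs_Re_le_cmod[of "w - x"] abs_Im_le_cmod[of "w - x"] that by auto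
    have sub: "cball w r \<subseteq> - {1}"
    proof
      fix x assume "x \<in> cball w r"
      hence "\<bar>Im x - Im w\<bar> \<le> r" using near[of x] by (simp add: dist_norm)
      hence "Im x \<noteq> 0" using w r assms by auto
      thus "x \<in> - {1}" by auto
    qed
    have hol: "zeta holomorphic_on cball w r" by (rule holomorphic_on_subset[OF holomorphic_zeta sub])
    have "norm ((deriv ^^ 1) zeta w) \<le> fact 1 * (2 * C * cbrt_height (Im w)) / r ^ 1"
    proof (rule Cauchy_inequality)
      show "zeta holomorphic_on ball w r" by (rule holomorphic_on_subset[OF hol]) auto
      show "continuous_on (cball w r) zeta" by (rule holomorphic_on_imp_continuous_on[OF hol])
      fix x assume "norm (w - x) = r"
      hence x: "\<bar>Re x - Re w\<bar> \<le> r" "\<bar>Im x - Im w\<bar> \<le> r" using near[of x] by auto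
      have "norm (zeta x) \<le> C * cbrt_height (Im x)" using x w r by (intro C(2)) auto
      also have "cbrt_height (Im x) \<le> 2 * cbrt_height (Im w)" using x r by (intro cbrt_height_le) auto
      hence "C * cbrt_height (Im x) \<le> C * (2 * cbrt_height (Im w))" using C by (intro mult_left_mono) auto
      finally show "norm (zeta x) \<le> 2 * C * cbrt_height (Im w)" by simp
    qed (use r in auto)
    thus ?thesis by simp
  qed
  show ?thesis
  proof (rule that[of "2 * C / r"])
    fix \<sigma> \<sigma>' t :: real assume *: "1 \<le> \<sigma>" "\<sigma> \<le> \<sigma>'" "\<sigma>' \<le> 2" "\<bar>t\<bar> \<ge> \<tau>"
    define S where "S = closed_segment (Complex \<sigma> t) (Complex \<sigma>' t)"
    have S: "Im w = t \<and> 1 \<le> Re w \<and> Re w \<le> 2" if "w \<in> S" for w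
    proof -
      have "S = {w. Im w = t \<and> Re w \<in> closed_segment \<sigma> \<sigma>'}"
        unfolding S_def using closed_segment_same_Im[of "Complex \<sigma> t" "Complex \<sigma>' t"] by auto
      thus ?thesis using that * by (auto simp: closed_segment_eq_real_ivl)
    qed
    have "norm (zeta (Complex \<sigma> t) - zeta (Complex \<sigma>' t)) \<le> (2 * C / r * cbrt_height t) * norm (Complex \<sigma> t - Complex \<sigma>' t)"
    proof (rule field_differentiable_bound)
      fix w assume w: "w \<in> S"
      have "w \<in> - {1}" using S[OF w] * assms by auto
      thus "(zeta has_field_derivative deriv zeta w) (at w within S)"
        using holomorphic_derivI[OF holomorphic_zeta] by (auto intro: has_field_derivative_at_within)
      show "norm (deriv zeta w) \<le> 2 * C / r * cbrt_height t" using deriv[of w] S[OF w] * by auto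
    qed (auto simp: S_def)
    also have "Complex \<sigma> t - Complex \<sigma>' t = of_real (\<sigma> - \<sigma>')" by (simp add: complex_eq_iff)
    finally show "norm (zeta (Complex \<sigma> t) - zeta (Complex \<sigma>' t)) \<le> 2 * C / r * cbrt_height t * (\<sigma>' - \<sigma>)"
    proof -
      have "\<bar>\<sigma> - \<sigma>'\<bar> = \<sigma>' - \<sigma>" using * by simp
      moreover assume "norm (zeta (Complex \<sigma> t) - zeta (Complex \<sigma>' t)) \<le> 2 * C / r * cbrt_height t * norm (complex_of_real (\<sigma> - \<sigma>'))"
      ultimately show ?thesis by (simp only: norm_of_real)
    qed
  qed (use C r in auto)
qed

lemma zeta_near_1_bound:
  obtains C where "C > 0" "\<And>\<sigma>. 1 < \<sigma> \<Longrightarrow> \<sigma> \<le> 2 \<Longrightarrow> norm (zeta (of_real \<sigma>)) \<le> C / (\<sigma> - 1)"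
proof -
  have cont: "continuous_on (complex_of_real ` {1..2}) zeta_reg"
    by (rule continuous_on_subset[OF holomorphic_on_imp_continuous_on[OF holomorphic_zeta_reg]]) auto
  have comp: "compact (complex_of_real ` {1..2})"
    by (intro compact_continuous_image continuous_intros) auto
  have "bounded (zeta_reg ` (complex_of_real ` {1..2}))"
    by (rule compact_imp_bounded[OF compact_continuous_image[OF cont comp]])
  then obtain C where C: "C > 0" "\<And>\<sigma>. \<sigma> \<in> {1..2} \<Longrightarrow> norm (zeta_reg (of_real \<sigma>)) \<le> C"
    unfolding bounded_pos by auto
  show ?thesis
  proof (rule that[OF C(1)])
    fix \<sigma> :: real assume *: "1 < \<sigma>" "\<sigma> \<le> 2"
    have "norm (zeta (of_real \<sigma>)) = norm (zeta_reg (of_real \<sigma>)) / norm (complex_of_real (\<sigma> - 1))"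
      using * by (subst zeta_right) (auto simp: norm_divide)
    also have "\<dots> \<le> C / (\<sigma> - 1)" using C(2)[of \<sigma>] * by (simp only: norm_of_real) (auto intro: divide_right_mono)
    finally show "norm (zeta (of_real \<sigma>)) \<le> C / (\<sigma> - 1)" .
  qed
qed

text \<open>In the 3-4-1 inequality the real point costs at most a cubed simple pole and the point
  at height 2t the growth |t|^(1/3). The middle factor keeps its fourth power, so that roots are
  taken only when the two sides are balanced.\<close>

lemma zeta_lower_bound_right:
  assumes "\<tau> > 0"
  obtains c where "c > 0" "\<And>\<sigma> t. 1 < \<sigma> \<Longrightarrow> \<sigma> \<le> 2 \<Longrightarrow> \<bar>t\<bar> \<ge> \<tau> \<Longrightarrow> norm (zeta (Complex \<sigma> t)) ^ 4 \<ge> c * (\<sigma> - 1) ^ 3 / cbrt_height t"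
proof -
  obtain C1 where C1: "C1 > 0" "\<And>\<sigma>. 1 < \<sigma> \<Longrightarrow> \<sigma> \<le> 2 \<Longrightarrow> norm (zeta (of_real \<sigma>)) \<le> C1 / (\<sigma> - 1)"
    using zeta_near_1_bound by auto
  obtain C2 where C2: "C2 > 0" "\<And>s. 3 / 4 \<le> Re s \<Longrightarrow> Re s \<le> 3 \<Longrightarrow> \<bar>Im s\<bar> \<ge> \<tau> \<Longrightarrow> norm (zeta s) \<le> C2 * cbrt_height (Im s)"
    using zeta_upper_bound[OF assms] by auto
  show ?thesis
  proof (rule that[of "1 / (C1 ^ 3 * (2 * C2))"])
    fix \<sigma> t :: real assume *: "1 < \<sigma>" "\<sigma> \<le> 2" "\<bar>t\<bar> \<ge> \<tau>"
    define Z where "Z = norm (zeta (Complex \<sigma> t)) ^ 4"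
    have "norm (zeta (Complex \<sigma> (2 * t))) \<le> C2 * cbrt_height (2 * t)" using C2(2)[of "Complex \<sigma> (2 * t)"] * assms by auto
    also have "cbrt_height (2 * t) \<le> 2 * cbrt_height t" by (intro cbrt_height_le) auto
    hence "C2 * cbrt_height (2 * t) \<le> C2 * (2 * cbrt_height t)" using C2 by (intro mult_left_mono) auto
    finally have b: "norm (zeta (Complex \<sigma> (2 * t))) \<le> 2 * C2 * cbrt_height t" by simp
    have "1 \<le> norm (zeta (of_real \<sigma>)) ^ 3 * Z * norm (zeta (Complex \<sigma> (2 * t)))"
      unfolding Z_def using * by (intro Dirichlet_series_3_4_1 zeta_sums)
    also have "\<dots> \<le> (C1 / (\<sigma> - 1)) ^ 3 * Z * (2 * C2 * cbrt_height t)"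
      using C1 * b by (intro mult_mono power_mono C1(2)) (auto simp: Z_def)
    finally have "1 \<le> (C1 ^ 3 * (2 * C2)) * Z * cbrt_height t / (\<sigma> - 1) ^ 3"
      by (simp add: power_divide mult_ac)
    moreover have "(\<sigma> - 1) ^ 3 > 0" "cbrt_height t > 0" "C1 ^ 3 * (2 * C2) > 0" using * C1 C2 cbrt_height(2)[of t] by auto
    moreover have "1 / A * Y / d \<le> z" if "1 \<le> A * z * d / Y" "Y > 0" "d > 0" "A > 0" for A Y d z :: real
      using that by (simp add: field_simps)
    ultimately show "1 / (C1 ^ 3 * (2 * C2)) * (\<sigma> - 1) ^ 3 / cbrt_height t \<le> norm (zeta (Complex \<sigma> t)) ^ 4"
      unfolding Z_def[symmetric] by blast
  qed (use C1 C2 in auto)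
qed

text \<open>
  The 3-4-1 inequality bounds zeta from below at distance \<open>q\<^sup>4\<close> to the right of the line \<open>Re = 1\<close>;
  moving back to the line costs at most \<open>C q\<^sup>4 U\<^sup>4\<close> with \<open>U\<^bsup>12\<^esup> = 1 + \<bar>t\<bar>\<close>, and \<open>q = \<eta> / U\<^sup>5\<close>
  balances the two.
\<close>

lemma zeta_lower_bound_edge:
  assumes "\<tau> > 0"
  obtains c where "c > 0" "\<And>s. 1 \<le> Re s \<Longrightarrow> Re s \<le> 2 \<Longrightarrow> \<bar>Im s\<bar> \<ge> \<tau> \<Longrightarrow> norm (zeta s) \<ge> c / cbrt_height (Im s) ^ 4"
proof -
  obtain c where c: "c > 0" "\<And>\<sigma> t. 1 < \<sigma> \<Longrightarrow> \<sigma> \<le> 2 \<Longrightarrow> \<bar>t\<bar> \<ge> \<tau> \<Longrightarrow> norm (zeta (Complex \<sigma> t)) ^ 4 \<ge> c * (\<sigma> - 1) ^ 3 / cbrt_height t"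
    using zeta_lower_bound_right[OF assms] by auto
  obtain C where C: "C > 0"
    "\<And>\<sigma> \<sigma>' t. 1 \<le> \<sigma> \<Longrightarrow> \<sigma> \<le> \<sigma>' \<Longrightarrow> \<sigma>' \<le> 2 \<Longrightarrow> \<bar>t\<bar> \<ge> \<tau> \<Longrightarrow>
       norm (zeta (Complex \<sigma> t) - zeta (Complex \<sigma>' t)) \<le> C * cbrt_height t * (\<sigma>' - \<sigma>)"
    using zeta_diff_bound[OF assms] by metis
  define b where "b = root 4 c"
  have b: "b > 0" "b ^ 4 = c" using c by (simp_all add: b_def)
  \<comment> \<open>The bound \<eta> <= b/(2C) makes the loss C \<eta>^4 / U^16 at most half of the
    gain b \<eta>^3 / U^16; the cap at 1 ensures q <= 1.\<close>
  define \<eta> where "\<eta> = min 1 (b / (2 * C))"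
  have \<eta>: "\<eta> > 0" "\<eta> \<le> 1" "C * \<eta> \<le> b / 2" using b C by (auto simp: \<eta>_def min_def field_simps)
  show ?thesis
  proof (rule that[of "b / 2 * \<eta> ^ 3"])
    fix s assume s: "1 \<le> Re s" "Re s \<le> 2" "\<bar>Im s\<bar> \<ge> \<tau>"
    define \<sigma> where "\<sigma> = Re s"
    define t where "t = Im s"
    have s_eq: "s = Complex \<sigma> t" by (simp add: \<sigma>_def t_def)
    \<comment> \<open>A fourth root of \<open>cbrt_height t\<close> is chosen, like \<open>b\<close>
      for \<open>c\<close>, so that the bound at distance q^4 is literally the fourth power of b q^3
      / U.\<close>
    define U where "U = root 4 (cbrt_height t)"
    have U: "U \<ge> 1" "U ^ 4 = cbrt_height t" using cbrt_height(2)[of t] by (simp_all add: U_def)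
    define q where "q = \<eta> / U ^ 5"
    have "\<eta> \<le> U ^ 5" using \<eta>(2) one_le_power[OF U(1), of 5] by (rule order.trans)
    hence q: "q > 0" "q \<le> 1" using \<eta>(1) U(1) by (simp_all add: q_def)
    have Z: "norm (zeta (Complex \<sigma>' t)) \<ge> b * \<eta> ^ 3 / cbrt_height t ^ 4" if "1 + q ^ 4 \<le> \<sigma>'" "\<sigma>' \<le> 2" for \<sigma>'
    proof -
      have "(b * q ^ 3 / U) ^ 4 = c * (q ^ 4) ^ 3 / cbrt_height t"
        by (simp add: power_divide power_mult_distrib b U flip: power_mult)
      also have "\<dots> \<le> c * (\<sigma>' - 1) ^ 3 / cbrt_height t"
        using c cbrt_height(2)[of t] that q by (intro divide_right_mono mult_left_mono power_mono) auto
      also have "\<dots> \<le> norm (zeta (Complex \<sigma>' t)) ^ 4" using that s q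
        by (intro c(2)) (auto simp: t_def intro: less_le_trans[of _ "1 + q ^ 4"])
      finally have "(b * q ^ 3 / U) ^ 4 \<le> norm (zeta (Complex \<sigma>' t)) ^ 4" .
      hence le: "b * q ^ 3 / U \<le> norm (zeta (Complex \<sigma>' t))"
        using power_strict_mono[of "norm (zeta (Complex \<sigma>' t))" "b * q ^ 3 / U" 4]
        by (meson norm_ge_zero not_le zero_less_numeral)
      have "q ^ 3 = \<eta> ^ 3 / U ^ 15" by (simp add: q_def power_divide flip: power_mult)
      moreover have "U ^ 16 = U ^ 15 * U" using power_add[of U 15 1] by simp
      ultimately have "b * \<eta> ^ 3 / U ^ 16 = b * q ^ 3 / U" by simp
      also note le
      finally show ?thesis by (simp flip: U(2) power_mult)
    qed
    have "b / 2 * \<eta> ^ 3 / cbrt_height t ^ 4 \<le> norm (zeta (Complex \<sigma> t))"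
    proof (cases "1 + q ^ 4 \<le> \<sigma>")
      case True
      have "b / 2 * \<eta> ^ 3 / cbrt_height t ^ 4 \<le> b * \<eta> ^ 3 / cbrt_height t ^ 4"
        using b \<eta> cbrt_height(2)[of t] by (intro divide_right_mono mult_right_mono) auto
      also have "\<dots> \<le> norm (zeta (Complex \<sigma> t))" using True s by (intro Z) (auto simp: \<sigma>_def)
      finally show ?thesis .
    next
      case False
      define \<sigma>' where "\<sigma>' = 1 + q ^ 4"
      have q4: "q ^ 4 \<le> 1" using q by (intro power_le_one) auto
      have "norm (zeta (Complex \<sigma> t) - zeta (Complex \<sigma>' t)) \<le> C * cbrt_height t * (\<sigma>' - \<sigma>)"
        using False s q4 by (intro C(2)) (auto simp: \<sigma>'_def \<sigma>_def t_def)
      also have "\<dots> \<le> C * cbrt_height t * q ^ 4"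
        using C cbrt_height(2)[of t] s by (intro mult_left_mono) (auto simp: \<sigma>'_def \<sigma>_def)
      also have "\<dots> = C * \<eta> * \<eta> ^ 3 / cbrt_height t ^ 4"
      proof -
        have q4': "q ^ 4 = \<eta> ^ 4 / U ^ 20" by (simp add: q_def power_divide flip: power_mult)
        have U20: "U ^ 20 = U ^ 4 * U ^ 16" using power_add[of U 4 16] by simp
        have U16: "(U ^ 4) ^ 4 = U ^ 16" by (simp flip: power_mult)
        have \<eta>4: "\<eta> ^ 4 = \<eta> * \<eta> ^ 3" using power_add[of \<eta> 1 3] by simp
        have "C * V * (X / (V * Y)) = C * X / Y" if "V \<noteq> 0" for V X Y :: real
          using that by simp
        from this[of "U ^ 4" "\<eta> * \<eta> ^ 3" "U ^ 16"] U(1)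
        have "C * U ^ 4 * (\<eta> * \<eta> ^ 3 / (U ^ 4 * U ^ 16)) = C * (\<eta> * \<eta> ^ 3) / U ^ 16" by simp
        thus ?thesis unfolding U(2)[symmetric] q4' U20 U16 \<eta>4 by (simp only: mult.assoc)
      qed
      also have "\<dots> \<le> b / 2 * \<eta> ^ 3 / cbrt_height t ^ 4"
        using \<eta> cbrt_height(2)[of t] by (intro divide_right_mono mult_right_mono) auto
      finally have "norm (zeta (Complex \<sigma> t) - zeta (Complex \<sigma>' t)) \<le> b / 2 * \<eta> ^ 3 / cbrt_height t ^ 4" .
      moreover have "b * \<eta> ^ 3 / cbrt_height t ^ 4 \<le> norm (zeta (Complex \<sigma>' t))" using q4 by (intro Z) (auto simp: \<sigma>'_def)
      moreover have "norm (zeta (Complex \<sigma>' t)) \<le> norm (zeta (Complex \<sigma> t)) + norm (zeta (Complex \<sigma> t) - zeta (Complex \<sigma>' t))"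
        by (metis norm_minus_commute norm_triangle_sub)
      moreover have "b / 2 * \<eta> ^ 3 / cbrt_height t ^ 4 = (b * \<eta> ^ 3 / cbrt_height t ^ 4) / 2" by simp
      moreover have "x \<le> z" if "d \<le> x" "X \<le> y" "y \<le> z + d" "x = X / 2" for x y z d X :: real
        using that by linarith
      ultimately show ?thesis by blast
    qed
    thus "b / 2 * \<eta> ^ 3 / cbrt_height (Im s) ^ 4 \<le> norm (zeta s)" by (simp add: s_eq)
  qed (use b \<eta> in auto)
qed

text \<open>From the second term on the Dirichlet series is dominated by the sum of 1/n^2, which
  without its first term is pi^2/6 - 1 < 3/4.\<close>

lemma zeta_lower_bound_far_right:
  assumes "Re s \<ge> 2"
  shows "norm (zeta s) \<ge> 1 / 4"
proof -
  have "(\<lambda>n. of_nat (Suc n) powr (-s)) sums zeta s" using assms by (intro zeta_sums) auto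
  hence S: "(\<lambda>n. of_nat (Suc (Suc n)) powr (-s)) sums (zeta s - 1)"
    by (subst sums_Suc_iff) simp
  have B: "(\<lambda>n. 1 / (real (Suc (Suc n)))\<^sup>2) sums (pi\<^sup>2 / 6 - 1)"
    using inverse_squares_sums by (subst sums_Suc_iff) (simp add: add_ac)
  have "norm (zeta s - 1) = norm (\<Sum>n. of_nat (Suc (Suc n)) powr (-s) :: complex)" using S by (simp add: sums_iff)
  also have "\<dots> \<le> (\<Sum>n. 1 / (real (Suc (Suc n)))\<^sup>2)"
  proof (rule norm_suminf_le)
    fix n
    have "norm (of_nat (Suc (Suc n)) powr (-s) :: complex) = real (Suc (Suc n)) powr (- Re s)"
      using norm_powr_real_powr[of "of_nat (Suc (Suc n))" "-s"] by simp
    also have "\<dots> \<le> real (Suc (Suc n)) powr (- 2)" using assms by (intro powr_mono) auto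
    also have "\<dots> = 1 / (real (Suc (Suc n)))\<^sup>2" by (simp add: powr_minus_divide del: of_nat_Suc)
    finally show "norm (of_nat (Suc (Suc n)) powr (-s) :: complex) \<le> 1 / (real (Suc (Suc n)))\<^sup>2" .
  qed (use B in \<open>simp add: sums_iff\<close>)
  also have "\<dots> = pi\<^sup>2 / 6 - 1" using B by (simp add: sums_iff)
  also have "pi\<^sup>2 \<le> 3.2\<^sup>2" using pi_approx by (intro power_mono) auto
  finally have "norm (zeta s - 1) \<le> 3 / 4" by (simp add: power2_eq_square)
  moreover have "norm (1::complex) \<le> norm (zeta s) + norm (zeta s - 1)"
    by (metis norm_minus_commute norm_triangle_sub)
  ultimately show ?thesis by simp
qed

lemma zeta_nonzero_right:
  assumes "Re s \<ge> 1" "s \<noteq> 1"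
  shows "zeta s \<noteq> 0"
proof (cases "Im s = 0")
  case True
  hence s: "s = of_real (Re s)" "Re s > 1" using assms by (auto simp: complex_eq_iff)
  have "(\<lambda>n. Re (of_nat (Suc n) powr (-s))) sums Re (zeta s)" using s by (intro sums_Re zeta_sums) auto
  also have "(\<lambda>n. Re (of_nat (Suc n) powr (-s))) = (\<lambda>n. real (Suc n) powr (- Re s))"
  proof
    fix n
    have "of_nat (Suc n) powr (-s) = complex_of_real (real (Suc n)) powr (of_real (- Re s))" 
      by (subst s) (simp del: of_nat_Suc)
    also have "\<dots> = of_real (real (Suc n) powr (- Re s))" by (rule powr_of_real) auto
    finally show "Re (of_nat (Suc n) powr (-s)) = real (Suc n) powr (- Re s)" by simp
  qed
  finally have "(\<lambda>n. real (Suc n) powr (- Re s)) sums Re (zeta s)" .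
  moreover have "(\<Sum>n. real (Suc n) powr (- Re s)) > 0" 
    by (rule suminf_pos) (use summable_Suc_powr[of "- Re s"] s in auto)
  ultimately show ?thesis by (auto simp: sums_iff)
next
  case False
  show ?thesis
  proof (cases "Re s \<ge> 2")
    case True
    thus ?thesis using zeta_lower_bound_far_right[of s] by auto
  next
    case 2: False
    \<comment> \<open>With \<tau> = |Im s| the edge bound applies at s itself; its constant depends
      on s, which is enough for nonvanishing.\<close>
    obtain c where c: "c > 0" "\<And>z. 1 \<le> Re z \<Longrightarrow> Re z \<le> 2 \<Longrightarrow> \<bar>Im z\<bar> \<ge> \<bar>Im s\<bar> \<Longrightarrow> norm (zeta z) \<ge> c / cbrt_height (Im z) ^ 4"
      using zeta_lower_bound_edge[of "\<bar>Im s\<bar>"] False by auto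
    have "c / cbrt_height (Im s) ^ 4 > 0" using c cbrt_height(2)[of "Im s"] by simp
    also have "\<dots> \<le> norm (zeta s)" using assms 2 by (intro c(2)) auto
    finally show ?thesis by auto
  qed
qed

text \<open>Excludes the one real zero in the critical strip that the Riemann hypothesis leaves
  open. Here s - 1 = -1/2, and comparing 1/(2 sqrt n) with the increments of sqrt n shows that the
  truncated sums stay at least 1/2, which means zeta(1/2) <= -1.\<close>

lemma zeta_reg_half_nonzero: "zeta_reg (1 / 2) \<noteq> 0"
proof -
  define s where "s = (1 / 2 :: complex)"
  have p: "of_nat (Suc n) powr (-s) = complex_of_real (1 / sqrt (real (Suc n)))"
          "of_nat (Suc n) powr (1 - s) = complex_of_real (sqrt (real (Suc n)))" for n
  proof -
    have "of_nat (Suc n) powr (-s) = complex_of_real (real (Suc n)) powr of_real (- (1 / 2))" 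
      by (simp add: s_def del: of_nat_Suc)
    also have "\<dots> = of_real (real (Suc n) powr (- (1 / 2)))" by (rule powr_of_real) auto
    finally show "of_nat (Suc n) powr (-s) = complex_of_real (1 / sqrt (real (Suc n)))"
      by (simp add: powr_minus powr_half_sqrt inverse_eq_divide del: of_nat_Suc)
    have "of_nat (Suc n) powr (1 - s) = complex_of_real (real (Suc n)) powr of_real (1 / 2)" 
      by (simp add: s_def del: of_nat_Suc)
    also have "\<dots> = of_real (real (Suc n) powr (1 / 2))" by (rule powr_of_real) auto
    finally show "of_nat (Suc n) powr (1 - s) = complex_of_real (sqrt (real (Suc n)))"
      by (simp add: powr_half_sqrt del: of_nat_Suc)
  qed
  define g where "g = (\<lambda>N. sqrt (real (Suc N)) - 1 / 2 * ((\<Sum>n<N. 1 / sqrt (real (Suc n))) + 1 / sqrt (real (Suc N)) / 2))"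
  have "(\<lambda>N. (s + 1) / 2 + (\<Sum>n<N. euler_maclaurin_term n s)) \<longlonglongrightarrow> zeta_reg s"
    unfolding zeta_reg_def by (intro tendsto_intros summable_LIMSEQ summable_euler_maclaurin_term) (simp add: s_def)
  moreover have "(s + 1) / 2 + (\<Sum>n<N. euler_maclaurin_term n s) = of_real (g N)" for N
    unfolding sum_euler_maclaurin_term p g_def by (simp add: s_def del: of_nat_Suc)
  ultimately have lim: "(\<lambda>N. complex_of_real (g N)) \<longlonglongrightarrow> zeta_reg s" by simp
  hence limR: "g \<longlonglongrightarrow> Re (zeta_reg s)" using tendsto_Re by fastforce
  have inc: "sqrt (real (Suc N)) + 1 / (2 * sqrt (real (Suc (Suc N)))) \<le> sqrt (real (Suc (Suc N)))" for N
  proof -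
    define a where "a = sqrt (real (Suc N))"
    define b where "b = sqrt (real (Suc (Suc N)))"
    have ab: "0 < a" "0 < b" "a ^ 2 = real (Suc N)" "b ^ 2 = real (Suc N) + 1" by (simp_all add: a_def b_def)
    have "0 \<le> (b - a) ^ 2" by simp
    hence "2 * b * a + 1 \<le> 2 * (b * b)" using ab(3,4) by (simp add: power2_eq_square algebra_simps)
    hence "a + 1 / (2 * b) \<le> b" using ab(1,2) by (simp add: field_simps)
    thus ?thesis by (simp add: a_def b_def)
  qed
  have "(\<Sum>n<Suc N. 1 / sqrt (real (Suc n))) / 2 \<le> sqrt (real (Suc N)) - 1 / 2" for N
  proof (induction N)
    case (Suc N)
    have "(\<Sum>n<Suc (Suc N). 1 / sqrt (real (Suc n))) / 2 = (\<Sum>n<Suc N. 1 / sqrt (real (Suc n))) / 2 + 1 / (2 * sqrt (real (Suc (Suc N))))"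
      by (simp add: add_divide_distrib)
    thus ?case using Suc inc[of N] by linarith
  qed simp
  hence "g N \<ge> 1 / 2" for N
  proof -
    assume *: "\<And>N. (\<Sum>n<Suc N. 1 / sqrt (real (Suc n))) / 2 \<le> sqrt (real (Suc N)) - 1 / 2"
    have "g N = sqrt (real (Suc N)) - (\<Sum>n<Suc N. 1 / sqrt (real (Suc n))) / 2 + 1 / sqrt (real (Suc N)) / 4"
      by (simp add: g_def field_simps)
    moreover have "1 / sqrt (real (Suc N)) / 4 \<ge> 0" by simp
    ultimately show ?thesis using *[of N] by linarith
  qed
  hence "1 / 2 \<le> Re (zeta_reg s)" by (intro LIMSEQ_le_const[OF limR]) auto
  thus ?thesis by (auto simp: s_def)
qed

section \<open>Lower bounds for Gamma and the sine\<close>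

lemma cos_ii_of_real: "cos (\<i> * of_real v) = of_real (cosh v)"
proof -
  have "exp (\<i> * (\<i> * of_real v)) = complex_of_real (exp (-v))" "exp (- (\<i> * (\<i> * of_real v))) = complex_of_real (exp v)"
    by (simp_all flip: exp_of_real)
  thus ?thesis unfolding cos_exp_eq cosh_field_def by simp
qed

lemma sin_ii_of_real: "sin (\<i> * of_real v) = \<i> * of_real (sinh v)"
proof -
  have "exp (\<i> * (\<i> * of_real v)) = complex_of_real (exp (-v))" "exp (- (\<i> * (\<i> * of_real v))) = complex_of_real (exp v)"
    by (simp_all flip: exp_of_real)
  thus ?thesis unfolding sin_exp_eq sinh_field_def by (simp add: field_simps)
qed

lemma norm_Gamma_half_line: "norm (Gamma (Complex (1/2) y)) ^ 2 = pi / cosh (pi * y)"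
proof -
  define z where "z = Complex (1/2) y"
  have "1 - z = cnj z" by (simp add: z_def complex_eq_iff)
  hence "norm (Gamma z * Gamma (cnj z)) = norm (of_real pi / sin (of_real pi * z))"
    using Gamma_reflection_complex[of z] by simp
  also have "norm (Gamma (cnj z)) = norm (Gamma z)" by (metis cnj_Gamma complex_mod_cnj)
  hence "norm (Gamma z * Gamma (cnj z)) = norm (Gamma z) ^ 2" by (simp add: norm_mult power2_eq_square)
  also have "sin (of_real pi * z) = of_real (cosh (pi * y))"
  proof -
    have "of_real pi * z = of_real pi / 2 + \<i> * of_real (pi * y)" by (simp add: z_def complex_eq_iff)
    hence "sin (of_real pi * z) = cos (\<i> * of_real (pi * y))" by (simp add: sin_add sin_of_real[symmetric] cos_of_real[symmetric] del: of_real_mult)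
    also have "\<dots> = of_real (cosh (pi * y))"
      by (rule cos_ii_of_real)
    finally show ?thesis .
  qed
  finally show ?thesis by (simp add: z_def norm_divide)
qed

text \<open>In the quotient of the two limit formulas for Gamma the factorials and powers of n
  cancel. What remains is the product of (x + k)/|x + k + iy|, and each factor increases with
  x.\<close>

lemma norm_Gamma_ratio_mono:
  assumes "0 < x" "x \<le> x'"
  shows "norm (Gamma (Complex x y)) / Gamma x \<le> norm (Gamma (Complex x' y)) / Gamma x'"
proof -
  define g where "g = (\<lambda>x n. norm (Gamma_series (Complex x y) n) / Gamma_series x n)"
  have g: "g x n = (\<Prod>k=0..n. (x + real k) / norm (Complex (x + real k) y))" if "x > 0" "n > 0" for x n
  proof -
    have "norm (Gamma_series (Complex x y) n) = fact n * exp (x * ln (real n)) / (\<Prod>k=0..n. norm (Complex (x + real k) y))"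
    proof -
      have "norm (exp (Complex x y * of_real (ln (real n)))) = exp (x * ln (real n))"
        by (simp add: norm_exp_eq_Re)
      moreover have "Complex x y + of_nat k = Complex (x + real k) y" for k by (simp add: complex_eq_iff)
      ultimately show ?thesis unfolding Gamma_series_def
        by (simp add: norm_mult norm_divide prod_norm pochhammer_Suc_prod)
    qed
    moreover have "Gamma_series x n = fact n * exp (x * ln (real n)) / (\<Prod>k=0..n. x + real k)"
      unfolding Gamma_series_def by (simp add: pochhammer_Suc_prod)
    moreover have "(\<Prod>k=0..n. x + real k) > 0" using that by (intro prod_pos) auto
    ultimately show ?thesis by (simp add: g_def prod_dividef)
  qed
  have lim: "g x \<longlonglongrightarrow> norm (Gamma (Complex x y)) / Gamma x" if "x > 0" for x
  proof -
    have "Gamma x \<noteq> 0" using Gamma_real_pos[OF that] by simp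
    thus ?thesis unfolding g_def by (intro tendsto_intros)
  qed
  have "g x n \<le> g x' n" if n: "n > 0" for n
  proof -
    have "(\<Prod>k=0..n. (x + real k) / norm (Complex (x + real k) y)) \<le>
          (\<Prod>k=0..n. (x' + real k) / norm (Complex (x' + real k) y))"
    proof (intro prod_mono conjI)
      fix k
      define u where "u = x + real k" 
      define v where "v = x' + real k"
      have uv: "0 < u" "u \<le> v" using assms by (auto simp: u_def v_def)
      have "u^2 \<le> v^2" using uv by (intro power_mono) auto
      hence "u^2 * y^2 \<le> v^2 * y^2" by (intro mult_right_mono) auto
      hence "u^2 * (v^2 + y^2) \<le> v^2 * (u^2 + y^2)" by (simp add: algebra_simps)
      hence "sqrt (u^2 * (v^2 + y^2)) \<le> sqrt (v^2 * (u^2 + y^2))" by (rule real_sqrt_le_mono)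
      hence "u * norm (Complex v y) \<le> v * norm (Complex u y)"
        using uv by (simp add: real_sqrt_mult complex_norm)
      moreover have "norm (Complex u y) > 0" "norm (Complex v y) > 0" using uv by (auto simp: complex_eq_iff)
      ultimately show "u / norm (Complex u y) \<le> v / norm (Complex v y)" by (simp add: field_simps)
      show "0 \<le> u / norm (Complex u y)" using uv by simp
    qed
    thus ?thesis using assms n by (simp add: g)
  qed
  hence "eventually (\<lambda>n. g x n \<le> g x' n) sequentially" by (intro eventually_sequentiallyI[of 1]) auto
  thus ?thesis using assms by (intro tendsto_le[OF _ lim lim]) auto
qed

lemma norm_Gamma_ge:
  assumes "x \<ge> 1 / 2"
  shows "norm (Gamma (Complex x y)) \<ge> Gamma x / sqrt (cosh (pi * y))"
proof -
  have "norm (Gamma (Complex (1/2) y)) = sqrt (pi / cosh (pi * y))"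
    using norm_Gamma_half_line[of y] by (metis abs_of_nonneg norm_ge_zero real_sqrt_abs)
  hence "1 / sqrt (cosh (pi * y)) = norm (Gamma (Complex (1/2) y)) / Gamma (1/2)"
    by (simp add: Gamma_one_half_real real_sqrt_divide)
  also have "\<dots> \<le> norm (Gamma (Complex x y)) / Gamma x"
    by (rule norm_Gamma_ratio_mono) (use assms in auto)
  finally show ?thesis using Gamma_real_pos[of x] assms by (simp add: field_simps)
qed

text \<open>For x > 5 the recurrence multiplies the value at x - 1 by (x - 1)/pi > 1, so the minimum
  over the compact interval [1/2, 5] bounds the whole half-line.\<close>

lemma Gamma_pi_powr_bounded_below:
  obtains c :: real where "c > 0" "\<And>x. x \<ge> 1 / 2 \<Longrightarrow> Gamma x * pi powr (-x) \<ge> c"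
proof -
  define h where "h = (\<lambda>x::real. Gamma x * pi powr (-x))"
  have pos: "h x > 0" if "x > 0" for x using that by (simp add: h_def Gamma_real_pos)
  have "continuous_on {1/2..5} h" unfolding h_def
    by (intro continuous_intros) (auto elim!: nonpos_Ints_cases)
  then obtain x0 where x0: "x0 \<in> {1/2..5}" "\<And>x. x \<in> {1/2..5} \<Longrightarrow> h x0 \<le> h x"
    using continuous_attains_inf[of "{1/2..5}" h] by auto
  have "\<forall>x. 1/2 \<le> x \<and> x \<le> 5 + real n \<longrightarrow> h x0 \<le> h x" for n
  proof (induction n)
    case (Suc n)
    show ?case
    proof (intro allI impI)
      fix x assume x: "1/2 \<le> x \<and> x \<le> 5 + real (Suc n)"
      show "h x0 \<le> h x"
      proof (cases "x \<le> 5")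
        case False
        have hx: "h x = ((x - 1) / pi) * h (x - 1)"
        proof -
          have "x - 1 \<notin> \<int>\<^sub>\<le>\<^sub>0" using False by (auto elim!: nonpos_Ints_cases)
          hence "Gamma x = (x - 1) * Gamma (x - 1)" using Gamma_plus1[of "x - 1"] by simp
          moreover have "pi powr (- x) = pi powr (- (x - 1)) / pi" by (simp add: powr_diff powr_minus field_simps)
          ultimately show ?thesis by (simp add: h_def)
        qed
        have "h x0 \<le> h (x - 1)" using Suc x False by auto
        also have "1 \<le> (x - 1) / pi" using False pi_less_4 by simp
        hence "1 * h (x - 1) \<le> ((x - 1) / pi) * h (x - 1)"
          using False pos[of "x - 1"] by (intro mult_right_mono) auto
        hence "h (x - 1) \<le> h x" unfolding hx by simp
        finally show ?thesis .
      qed (use x x0 in auto)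
    qed
  qed (use x0 in auto)
  moreover have "\<exists>n. x \<le> 5 + real n" for x by (metis add_increasing order.trans real_arch_simple zero_le_numeral order_refl)
  ultimately have "h x0 \<le> h x" if "1/2 \<le> x" for x using that by blast
  moreover have "h x0 > 0" using pos x0 by auto
  ultimately show ?thesis using that[of "h x0"] by (auto simp: h_def)
qed

lemma norm_sin_squared: "norm (sin (Complex u v)) ^ 2 = (sin u)^2 + (sinh v)^2"
proof -
  have "sin (Complex u v) = sin (of_real u) * cos (\<i> * of_real v) + cos (of_real u) * sin (\<i> * of_real v)"
    by (simp add: Complex_eq sin_add)
  also have "cos (\<i> * of_real v) = of_real (cosh v)"
    by (rule cos_ii_of_real)
  also have "sin (\<i> * of_real v) = \<i> * of_real (sinh v)"
    by (rule sin_ii_of_real)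
  finally have "sin (Complex u v) = Complex (sin u * cosh v) (cos u * sinh v)"
    by (simp add: complex_eq_iff sin_of_real cos_of_real)
  hence "norm (sin (Complex u v)) ^ 2 = (sin u * cosh v)^2 + (cos u * sinh v)^2" by (simp add: cmod_def)
  also have "\<dots> = (sin u)^2 + (sinh v)^2"
    by (simp add: power_mult_distrib cosh_square_eq cos_squared_eq algebra_simps)
  finally show ?thesis .
qed

text \<open>Reduce u modulo pi to t with |t| <= pi/2. The distance condition gives |t| + |v| >=
  pi/4, so one of the two is at least pi/8, where |sinh v| or |sin t| is at least 1/4.\<close>

lemma sin_bounded_below_away_from_zeros:
  assumes "\<And>w::int. dist (Complex u v) (of_real (pi * of_int w)) \<ge> pi / 4"
  shows "(sin u)^2 + (sinh v)^2 \<ge> 1 / 16"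
proof -
  obtain w :: int where w: "\<bar>u - pi * of_int w\<bar> \<le> pi / 2"
  proof
    have "\<bar>u / pi - of_int (round (u / pi))\<bar> \<le> 1 / 2" using of_int_round_abs_le[of "u / pi"] by (simp add: abs_minus_commute)
    hence "pi * \<bar>u / pi - of_int (round (u / pi))\<bar> \<le> pi * (1 / 2)" by (intro mult_left_mono) auto
    also have "pi * \<bar>u / pi - of_int (round (u / pi))\<bar> = \<bar>pi * (u / pi - of_int (round (u / pi)))\<bar>" by (simp add: abs_mult)
    also have "pi * (u / pi - of_int (round (u / pi))) = u - pi * of_int (round (u / pi))" by (simp add: right_diff_distrib)
    finally show "\<bar>u - pi * of_int (round (u / pi))\<bar> \<le> pi / 2" by simp
  qed
  define t where "t = u - pi * of_int w"
  have "(sin u)^2 = (sin t)^2"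
  proof -
    have sw: "sin (of_int w * pi) = 0" by (auto simp: sin_zero_iff_int2)
    have "u = t + of_int w * pi" by (simp add: t_def)
    hence "sin u = sin t * cos (of_int w * pi)" by (simp add: sin_add sw)
    moreover have "(cos (of_int w * pi))^2 = 1" using sin_cos_squared_add[of "of_int w * pi"] sw by simp
    ultimately show ?thesis by (simp add: power_mult_distrib)
  qed
  have "pi / 4 \<le> norm (Complex t v)"
    using assms[of w] by (simp add: dist_norm t_def complex_diff Complex_eq algebra_simps)
  also have "\<dots> \<le> \<bar>t\<bar> + \<bar>v\<bar>" using cmod_le[of "Complex t v"] by simp
  finally have tv: "pi / 4 \<le> \<bar>t\<bar> + \<bar>v\<bar>" .
  show ?thesis
  proof (cases "\<bar>v\<bar> \<ge> pi / 8")
    case True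
    have "(1/4)^2 \<le> \<bar>v\<bar>^2" using True pi_gt3 by (intro power_mono) auto
    also have "\<bar>v\<bar>^2 \<le> (sinh \<bar>v\<bar>)^2"
    proof (rule power_mono)
      show "\<bar>v\<bar> \<le> sinh \<bar>v\<bar>"
    proof -
      have "sinh 0 - 0 \<le> sinh \<bar>v\<bar> - \<bar>v\<bar>"
        by (rule DERIV_nonneg_imp_nondecreasing[where f = "\<lambda>x. sinh x - x"])
           (auto intro!: derivative_eq_intros exI simp: cosh_real_ge_1)
      thus ?thesis by simp
    qed
    qed simp
    also have "\<dots> = (sinh v)^2" by (simp add: abs_if)
    finally show ?thesis by (simp add: power2_eq_square add_increasing)
  next
    case False
    hence t: "pi / 8 \<le> \<bar>t\<bar>" "\<bar>t\<bar> \<le> pi / 2" using tv w by (auto simp: t_def)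
    have "sin \<bar>t\<bar> \<ge> sin (pi / 8)" using t by (intro sin_monotone_2pi_le) auto
    moreover have "sin (pi / 8) \<ge> 1 / 4"
    proof -
      have "sin (pi / 4) = 2 * sin (pi / 8) * cos (pi / 8)" using sin_double[of "pi / 8"] by simp
      also have "\<dots> \<le> 2 * sin (pi / 8) * 1" by (intro mult_left_mono) (auto intro!: sin_ge_zero)
      finally have "sqrt 2 / 4 \<le> sin (pi / 8)" by (simp add: sin_45)
      moreover have "1 \<le> sqrt 2" by simp
      ultimately show ?thesis by linarith
    qed
    ultimately have "(1/4)^2 \<le> (sin \<bar>t\<bar>)^2" by (intro power_mono) auto
    also have "(sin \<bar>t\<bar>)^2 = (sin u)^2" unfolding \<open>(sin u)^2 = (sin t)^2\<close> by (simp add: abs_if)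
    finally show ?thesis by (simp add: power2_eq_square add_increasing2)
  qed
qed

section \<open>Zeros and growth of the denominator\<close>

lemma zeta_lower_bound:
  obtains c where "c > 0" "\<And>s. 1 \<le> Re s \<Longrightarrow> \<bar>Im s\<bar> \<ge> 1 \<or> Re s \<ge> 2 \<Longrightarrow> norm (zeta s) \<ge> c / cbrt_height (Im s) ^ 4"
proof -
  obtain c where c: "c > 0" "\<And>s. 1 \<le> Re s \<Longrightarrow> Re s \<le> 2 \<Longrightarrow> \<bar>Im s\<bar> \<ge> 1 \<Longrightarrow> norm (zeta s) \<ge> c / cbrt_height (Im s) ^ 4"
    using zeta_lower_bound_edge[of 1] by auto
  show ?thesis
  proof (rule that[of "min c (1/4)"])
    fix s assume s: "1 \<le> Re s" "\<bar>Im s\<bar> \<ge> 1 \<or> Re s \<ge> 2"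
    have U: "cbrt_height (Im s) ^ 4 \<ge> 1" using cbrt_height(2) by (rule one_le_power)
    show "min c (1/4) / cbrt_height (Im s) ^ 4 \<le> norm (zeta s)"
    proof (cases "Re s \<ge> 2")
      case True
      have "min c (1/4) / cbrt_height (Im s) ^ 4 \<le> (1/4) / 1" using U c(1) by (intro frac_le) auto
      also have "\<dots> \<le> norm (zeta s)" using zeta_lower_bound_far_right[OF True] by simp
      finally show ?thesis .
    next
      case False
      have "min c (1/4) / cbrt_height (Im s) ^ 4 \<le> c / cbrt_height (Im s) ^ 4" using U by (intro divide_right_mono) auto
      also have "\<dots> \<le> norm (zeta s)" using s False by (intro c(2)) auto
      finally show ?thesis .
    qed
  qed (use c in auto)
qed

text \<open>The Gamma bound costs a square root of cosh. It is kept in this form and not replaced by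
  an exponential, because \<open>norm_sin_ge_cosh\<close> provides the very same quantity and the
  two cancel in \<open>n_fun\<close>.\<close>

lemma norm_Xi_ge:
  obtains c where "c > 0" "\<And>w. Re w \<ge> 1 \<Longrightarrow> w \<noteq> 1 \<Longrightarrow>
    norm (Xi w) \<ge> c * norm w * norm (w - 1) * norm (zeta w) / sqrt (cosh (pi * Im w / 2))"
proof -
  obtain c where c: "c > 0" "\<And>x. x \<ge> 1 / 2 \<Longrightarrow> Gamma x * pi powr (-x) \<ge> c"
    using Gamma_pi_powr_bounded_below by auto
  show ?thesis
  proof (rule that[of "c / 2"])
    fix w assume w: "Re w \<ge> 1" "w \<noteq> 1"
    define x where "x = Re w / 2"
    define y where "y = Im w / 2"
    define q where "q = sqrt (cosh (pi * y))"
    have q: "q > 0" by (simp add: q_def)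
    have wz: "w / 2 = Complex x y" by (simp add: x_def y_def complex_eq_iff)
    have ni: "w / 2 \<notin> \<int>\<^sub>\<le>\<^sub>0" using w by (auto elim!: nonpos_Ints_cases simp: complex_eq_iff)
    have X: "Xi w = of_real pi powr (-w/2) * (w / 2 * Gamma (w / 2)) * ((w - 1) * zeta w)"
      using w zeta_right[of w] Gamma_plus1[OF ni] Xi_right[of w] by (simp add: xi_half_def add.commute)
    have "norm (of_real pi powr (-w/2) :: complex) = pi powr (-x)"
      by (subst norm_powr_real_powr) (auto simp: x_def)
    hence N: "norm (Xi w) = pi powr (-x) * (norm w / 2 * norm (Gamma (Complex x y))) * (norm (w - 1) * norm (zeta w))"
      unfolding X norm_mult wz[symmetric] by (simp add: norm_divide)
    have x: "x \<ge> 1 / 2" using w by (simp add: x_def)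
    have "c / q \<le> (Gamma x * pi powr (-x)) / q" using c(2)[OF x] q by (intro divide_right_mono) auto
    also have "\<dots> = pi powr (-x) * (Gamma x / q)" by simp
    also have "\<dots> \<le> pi powr (-x) * norm (Gamma (Complex x y))"
      using norm_Gamma_ge[OF x, of y] by (intro mult_left_mono) (auto simp: q_def)
    finally have "(c / q) * (norm w / 2 * (norm (w - 1) * norm (zeta w))) \<le>
        (pi powr (-x) * norm (Gamma (Complex x y))) * (norm w / 2 * (norm (w - 1) * norm (zeta w)))"
      by (rule mult_right_mono) auto
    also have "\<dots> = norm (Xi w)" unfolding N by simp
    finally show "c / 2 * norm w * norm (w - 1) * norm (zeta w) / sqrt (cosh (pi * Im w / 2)) \<le> norm (Xi w)"
      by (simp add: q_def y_def mult_ac)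
  qed (use c in auto)
qed

lemma n_fun_eq: "n_fun s = sin (of_real pi * s / 4) * (2 * Xi (1 / 2 + s))"
  by (simp add: n_fun_def xi_eq_Xi)

lemma n_fun_minus: "n_fun (-s) = - n_fun s"
proof -
  have "Xi (1 / 2 + - s) = Xi (1 / 2 + s)" using Xi_reflection[of "1 / 2 + s"] by simp
  thus ?thesis by (simp add: n_fun_eq)
qed

lemma holomorphic_n_fun: "n_fun holomorphic_on S"
proof -
  have "(Xi \<circ> (\<lambda>s. 1 / 2 + s)) holomorphic_on S"
    by (rule holomorphic_on_compose_gen[OF _ holomorphic_Xi[of UNIV]]) (auto intro!: holomorphic_intros)
  thus ?thesis unfolding n_fun_eq[abs_def] o_def by (intro holomorphic_intros) auto
qed

lemma n_fun_analytic: "n_fun analytic_on A"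
  using holomorphic_n_fun[of UNIV] by (metis analytic_on_subset analytic_on_open open_UNIV subset_UNIV)

lemma deriv_n_fun_minus: "deriv n_fun (-z) = deriv n_fun z"
proof -
  have D: "(n_fun has_field_derivative deriv n_fun w) (at w)" for w
    by (rule holomorphic_derivI[OF holomorphic_n_fun[of UNIV]]) auto
  have "((\<lambda>s. n_fun (- s)) has_field_derivative deriv n_fun (-z) * (-1)) (at z)"
    by (rule DERIV_chain2[OF D]) (auto intro!: derivative_eq_intros)
  hence "((\<lambda>s. - n_fun s) has_field_derivative - deriv n_fun (-z)) (at z)" by (simp add: n_fun_minus)
  moreover have "((\<lambda>s. - n_fun s) has_field_derivative - deriv n_fun z) (at z)" by (intro DERIV_minus D)
  ultimately show ?thesis using DERIV_unique by fastforce
qed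

lemma c_fun_minus: "c_fun (-z) = c_fun z"
  by (simp add: c_fun_def deriv_n_fun_minus)

lemma norm_sin_ge_cosh:
  assumes "\<And>w::int. dist s (4 * of_int w) \<ge> 1"
  shows "norm (sin (of_real pi * s / 4)) \<ge> sqrt (cosh (pi * Im s / 2)) / 5"
proof -
  define u where "u = pi * Re s / 4"
  define v where "v = pi * Im s / 4"
  have e: "of_real pi * s / 4 = Complex u v" by (simp add: u_def v_def complex_eq_iff)
  have "dist (Complex u v) (of_real (pi * of_int w)) \<ge> pi / 4" for w :: int
  proof -
    have eq: "Complex u v - of_real (pi * of_int w) = of_real (pi / 4) * (s - 4 * of_int w)"
      unfolding e[symmetric] by (simp add: algebra_simps)
    have "dist (Complex u v) (of_real (pi * of_int w)) = (pi / 4) * dist s (4 * of_int w)"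
      unfolding dist_norm eq norm_mult norm_of_real by simp
    thus ?thesis using assms[of w] by simp
  qed
  hence A: "(sin u)^2 + (sinh v)^2 \<ge> 1 / 16" by (rule sin_bounded_below_away_from_zeros)
  have "cosh (pi * Im s / 2) = cosh (2 * v)" by (simp add: v_def)
  also have "\<dots> = 2 * (sinh v)^2 + 1" by (simp add: cosh_double cosh_square_eq)
  \<comment> \<open>Away from the zeros 1 <= 16 ((sin u)^2 + (sinh v)^2). Adding 2 (sinh v)^2 stays
    below the coefficient 25, chosen as the square of 5.\<close>
  also have "\<dots> \<le> 25 * ((sin u)^2 + (sinh v)^2)" 
  proof -
    have "2 * y + 1 \<le> 25 * (x + y)" if "x + y \<ge> 1 / 16" "x \<ge> 0" "y \<ge> 0" for x y :: real
    proof -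
      have "1 \<le> 16 * (x + y)" using that(1) by simp
      moreover have "25 * (x + y) = 16 * (x + y) + 9 * x + 9 * y" by simp
      ultimately show ?thesis using that(2,3) by linarith
    qed
    from this[OF A] show ?thesis by simp
  qed
  finally have "cosh (pi * Im s / 2) \<le> 25 * norm (sin (of_real pi * s / 4))^2" unfolding e norm_sin_squared .
  hence "sqrt (cosh (pi * Im s / 2)) \<le> 5 * norm (sin (of_real pi * s / 4))"
    by (intro real_le_lsqrt) (simp_all add: power_mult_distrib)
  thus ?thesis by simp
qed

text \<open>Two factors of order |s| against the loss |s|^(4/3) from zeta leave |s|^(2/3), the
  square roots of cosh having cancelled. The condition Re s >= 1/2 is Re (1/2 + s) >= 1.\<close>

lemma norm_n_fun_ge:
  obtains c where "c > 0" "\<And>s. Re s \<ge> 1 / 2 \<Longrightarrow> norm s \<ge> 3 \<Longrightarrow> (\<And>w::int. dist s (4 * of_int w) \<ge> 1) \<Longrightarrow>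
     norm (n_fun s) \<ge> c * root 3 (norm s) ^ 2"
proof -
  obtain c1 where c1: "c1 > 0" "\<And>w. Re w \<ge> 1 \<Longrightarrow> w \<noteq> 1 \<Longrightarrow>
    norm (Xi w) \<ge> c1 * norm w * norm (w - 1) * norm (zeta w) / sqrt (cosh (pi * Im w / 2))"
    using norm_Xi_ge by metis
  obtain c2 where c2: "c2 > 0" "\<And>s. 1 \<le> Re s \<Longrightarrow> \<bar>Im s\<bar> \<ge> 1 \<or> Re s \<ge> 2 \<Longrightarrow> norm (zeta s) \<ge> c2 / cbrt_height (Im s) ^ 4"
    using zeta_lower_bound by metis
  show ?thesis
  \<comment> \<open>2/5 stems from the factor 2 of \<open>Xi\<close> and the sine bound, 1/2 from |w
    - 1| >= |s|/2, and 1/16 from the fourth power of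
    \<open>cbrt_height (Im s) \<le> 2 * V\<close>.\<close>
  proof (rule that[of "2 / 5 * c1 * c2 / 2 / 16"])
    fix s assume s: "Re s \<ge> 1 / 2" "norm s \<ge> 3" "\<And>w::int. dist s (4 * of_int w) \<ge> 1"
    define w where "w = 1 / 2 + s"
    define q where "q = sqrt (cosh (pi * Im s / 2))"
    define V where "V = root 3 (norm s)"
    have q: "q > 0" by (simp add: q_def)
    have V: "V \<ge> 1" "V ^ 3 = norm s" using s(2) by (simp_all add: V_def)
    have w: "Re w \<ge> 1" "Im w = Im s" "w \<noteq> 1" "\<bar>Im w\<bar> \<ge> 1 \<or> Re w \<ge> 2"
    proof -
      show "Re w \<ge> 1" "Im w = Im s" using s by (auto simp: w_def)
      \<comment> \<open>If |Im s| < 1, then |s| >= 3 forces Re s > 2; so w stays away from the pole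
        at 1.\<close>
      have "norm s \<le> \<bar>Re s\<bar> + \<bar>Im s\<bar>" by (rule cmod_le)
      thus 1: "\<bar>Im w\<bar> \<ge> 1 \<or> Re w \<ge> 2" using s by (auto simp: w_def)
      thus "w \<noteq> 1" by auto
    qed
    have n1: "norm w \<ge> norm s"
    proof -
      have "(Re s)^2 \<le> (Re w)^2" using s by (intro power_mono) (auto simp: w_def)
      thus ?thesis unfolding cmod_def using w(2) by simp
    qed
    have n2: "norm (w - 1) \<ge> norm s / 2"
    proof -
      have "w - 1 = s - 1 / 2" by (simp add: w_def)
      thus ?thesis using norm_triangle_ineq2[of s "1/2"] s(2) by simp
    qed
    have U: "cbrt_height (Im s) \<le> 2 * V"
    proof -
      have "cbrt_height (Im s) ^ 3 \<le> (2 * V) ^ 3" using abs_Im_le_cmod[of s] s(2)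
        unfolding cbrt_height(1) by (simp add: power_mult_distrib V(2))
      thus ?thesis using V(1) by (metis power_strict_mono not_le cbrt_height(2) order.trans zero_le_one zero_less_numeral mult_nonneg_nonneg zero_le_numeral)
    qed
    have z: "norm (zeta w) \<ge> c2 / (16 * V ^ 4)"
    proof -
      have "cbrt_height (Im s) ^ 4 \<le> (2 * V) ^ 4" using U cbrt_height(2)[of "Im s"] by (intro power_mono) auto
      hence "c2 / (16 * V ^ 4) \<le> c2 / cbrt_height (Im s) ^ 4"
        using c2(1) cbrt_height(2)[of "Im s"] V(1)
        by (intro divide_left_mono mult_pos_pos zero_less_power) (auto simp: power_mult_distrib)
      also have "\<dots> \<le> norm (zeta w)" using c2(2)[of w] w by simp
      finally show ?thesis .
    qed
    have "c1 * V ^ 3 * (V ^ 3 / 2) * (c2 / (16 * V ^ 4)) / q \<le> c1 * norm w * norm (w - 1) * norm (zeta w) / q"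
      using c1(1) c2(1) q V n1 n2 z by (intro divide_right_mono mult_mono) auto
    also have "\<dots> \<le> norm (Xi w)" using c1(2)[of w] w by (simp add: q_def)
    finally have X: "c1 * V ^ 3 * (V ^ 3 / 2) * (c2 / (16 * V ^ 4)) / q \<le> norm (Xi w)" .
    have "norm (sin (of_real pi * s / 4)) \<ge> q / 5" unfolding q_def by (rule norm_sin_ge_cosh) fact
    hence "(q / 5) * (2 * (c1 * V ^ 3 * (V ^ 3 / 2) * (c2 / (16 * V ^ 4)) / q)) \<le> norm (sin (of_real pi * s / 4)) * (2 * norm (Xi w))"
      using X q c1(1) c2(1) V(1) by (intro mult_mono) auto
    also have "\<dots> = norm (n_fun s)" by (simp add: n_fun_eq norm_mult w_def)
    also have "(q / 5) * (2 * (c1 * V ^ 3 * (V ^ 3 / 2) * (c2 / (16 * V ^ 4)) / q)) = 2 / 5 * c1 * c2 / 2 / 16 * V ^ 2"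
      using q V(1) by (simp add: field_simps power2_eq_square power3_eq_cube power4_eq_xxxx)
    finally show "2 / 5 * c1 * c2 / 2 / 16 * root 3 (norm s) ^ 2 \<le> norm (n_fun s)" by (simp add: V_def)
  qed (use c1 c2 in auto)
qed

lemma f_fun_decay:
  assumes "\<epsilon> > 0"
  obtains R where "\<And>s. \<bar>Re s\<bar> \<ge> 1 / 2 \<Longrightarrow> norm s \<ge> R \<Longrightarrow> (\<And>w::int. dist s (4 * of_int w) \<ge> 1) \<Longrightarrow> norm (f_fun s) < \<epsilon>"
proof -
  obtain c where c: "c > 0" "\<And>s. Re s \<ge> 1 / 2 \<Longrightarrow> norm s \<ge> 3 \<Longrightarrow> (\<And>w::int. dist s (4 * of_int w) \<ge> 1) \<Longrightarrow>
     norm (n_fun s) \<ge> c * root 3 (norm s) ^ 2" using norm_n_fun_ge by metis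
  \<comment> \<open>Since V > 1 one has V^2 >= V, and c V = c + 1/\<epsilon> exceeds
    1/\<epsilon>.\<close>
  define V where "V = 1 + 1 / (c * \<epsilon>)"
  have V: "V > 1" using c(1) assms by (simp add: V_def)
  have right: "norm (f_fun s) < \<epsilon>" if s: "Re s \<ge> 1 / 2" "norm s \<ge> 3 + V ^ 3" "\<And>w::int. dist s (4 * of_int w) \<ge> 1" for s
  proof -
    have "V = root 3 (V ^ 3)" using V by (simp add: real_root_power_cancel)
    also have "\<dots> \<le> root 3 (norm s)" using s by (intro real_root_le_mono) auto
    finally have "V * V \<le> root 3 (norm s) ^ 2" using V unfolding power2_eq_square by (intro mult_mono) auto
    moreover have "V * 1 \<le> V * V" using V by (intro mult_left_mono) auto
    ultimately have "c * V \<le> c * root 3 (norm s) ^ 2" using c(1) by (intro mult_left_mono) auto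
    also have "\<dots> \<le> norm (n_fun s)" using s V by (intro c(2)) (auto intro: order.trans[of _ "3 + V ^ 3"])
    finally have n: "c * V \<le> norm (n_fun s)" .
    have "1 / \<epsilon> < c * V" using c(1) assms by (simp add: V_def distrib_left)
    hence "1 / \<epsilon> < norm (n_fun s)" using n by linarith
    moreover from this have "norm (n_fun s) > 0" using assms by (smt (verit) divide_pos_pos)
    ultimately show ?thesis using assms by (simp add: f_fun_def norm_divide field_simps)
  qed
  show ?thesis
  proof (rule that[of "3 + V ^ 3"])
    fix s assume s: "\<bar>Re s\<bar> \<ge> 1 / 2" "norm s \<ge> 3 + V ^ 3" "\<And>w::int. dist s (4 * of_int w) \<ge> 1"
    show "norm (f_fun s) < \<epsilon>"
    proof (cases "Re s \<ge> 1 / 2")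
      case False
      have "dist (-s) (4 * of_int w) \<ge> 1" for w :: int
      proof -
        have "dist (-s) (4 * of_int w) = dist s (4 * of_int (-w))"
          using dist_minus[of s "4 * of_int (-w)"] by simp
        thus ?thesis using s(3)[of "-w"] by simp
      qed
      moreover have "norm (f_fun (-s)) = norm (f_fun s)" by (simp add: f_fun_def n_fun_minus norm_divide)
      ultimately show ?thesis using right[of "-s"] s False by auto
    qed (use right s in auto)
  qed
qed

section \<open>Derivative of \<open>n_fun\<close> and coefficients at the points 4w\<close>

lemma deriv_n_fun_4: "deriv n_fun (4 * of_int w) = of_real (pi / 4 * cos (of_int w * pi)) * (2 * Xi (1 / 2 + 4 * of_int w))"
proof -
  define z where "z = (4 * of_int w :: complex)"
  have D: "(Xi has_field_derivative deriv Xi u) (at u)" for u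
    by (rule holomorphic_derivI[OF holomorphic_Xi[of UNIV]]) auto
  have "((\<lambda>s. Xi (1 / 2 + s)) has_field_derivative deriv Xi (1 / 2 + z) * 1) (at z)"
    by (rule DERIV_chain2[OF D]) (auto intro!: derivative_eq_intros)
  hence "(n_fun has_field_derivative (of_real pi / 4 * cos (of_real pi * z / 4)) * (2 * Xi (1 / 2 + z))
            + sin (of_real pi * z / 4) * (2 * deriv Xi (1 / 2 + z))) (at z)"
    unfolding n_fun_eq[abs_def] by (auto intro!: derivative_eq_intros)
  moreover have e: "of_real pi * z / 4 = complex_of_real (of_int w * pi)" by (simp add: z_def)
  moreover have "sin (of_real pi * z / 4) = 0"
    unfolding e sin_of_real by (simp add: sin_zero_iff_int2)
  moreover have "cos (of_real pi * z / 4) = of_real (cos (of_int w * pi))" unfolding e by (rule cos_of_real)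
  ultimately show ?thesis by (simp add: z_def DERIV_imp_deriv)
qed

lemma norm_deriv_n_fun_4: "norm (deriv n_fun (4 * of_int w)) = pi / 2 * norm (Xi (1 / 2 + 4 * of_int w))"
proof -
  have "sin (of_int w * pi) = 0" by (auto simp: sin_zero_iff_int2)
  hence "(cos (of_int w * pi))^2 = 1" using sin_cos_squared_add[of "of_int w * pi"] by simp
  hence "\<bar>cos (of_int w * pi)\<bar> = 1" by (metis abs_1 abs_square_eq_1 power2_abs)
  thus ?thesis unfolding deriv_n_fun_4 norm_mult norm_of_real by (simp add: abs_mult)
qed

text \<open>On the real axis the cosh in \<open>norm_Xi_ge\<close> is 1, so \<open>Xi\<close> at 1/2
  + 4k is at least a multiple of k^2, and the coefficients are O(1/k^2).\<close>

lemma summable_c_fun_4: "summable (\<lambda>m. norm (c_fun (4 * of_nat (Suc m))))"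
proof -
  obtain c1 where c1: "c1 > 0" "\<And>w. Re w \<ge> 1 \<Longrightarrow> w \<noteq> 1 \<Longrightarrow>
    norm (Xi w) \<ge> c1 * norm w * norm (w - 1) * norm (zeta w) / sqrt (cosh (pi * Im w / 2))"
    using norm_Xi_ge by metis
  have bound: "norm (c_fun (4 * of_nat (Suc m))) \<le> (8 / (pi * c1)) * (1 / (real m + 1)\<^sup>2)" for m
  proof -
    define k where "k = real m + 1"
    have k: "k \<ge> 1" by (simp add: k_def)
    define w where "w = (1 / 2 + 4 * of_int (int (Suc m)) :: complex)"
    have w: "w = of_real (1 / 2 + 4 * k)" by (simp add: w_def k_def)
    have w1: "Re w \<ge> 2" "w \<noteq> 1" "Im w = 0" using k by (auto simp: w complex_eq_iff)
    have nw: "norm w \<ge> k" unfolding w norm_of_real using k by simp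
    have "w - 1 = of_real (4 * k - 1 / 2)" by (simp add: w)
    hence nw1: "norm (w - 1) \<ge> k" using k by (simp only: norm_of_real)
    have "c1 * k * k * (1 / 4) \<le> c1 * norm w * norm (w - 1) * norm (zeta w)"
      using c1(1) k nw nw1 zeta_lower_bound_far_right[OF w1(1)] by (intro mult_mono) auto
    also have "\<dots> \<le> norm (Xi w)" using c1(2)[of w] w1 by simp
    finally have "pi / 2 * (c1 * k * k * (1 / 4)) \<le> norm (deriv n_fun (4 * of_int (int (Suc m))))"
      unfolding norm_deriv_n_fun_4 w_def by (intro mult_left_mono) auto
    moreover have "0 < pi / 2 * (c1 * k * k * (1 / 4))" using c1(1) k by (intro mult_pos_pos) auto
    ultimately have "1 / norm (deriv n_fun (4 * of_int (int (Suc m)))) \<le> 1 / (pi / 2 * (c1 * k * k * (1 / 4)))"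
      by (intro frac_le) auto
    also have "\<dots> = (8 / (pi * c1)) * (1 / k\<^sup>2)" by (simp add: power2_eq_square)
    finally show ?thesis by (simp add: c_fun_def norm_divide k_def)
  qed
  have "summable (\<lambda>m. (8 / (pi * c1)) * (1 / (real m + 1)\<^sup>2))"
    using sums_summable[OF inverse_squares_sums] by (intro summable_mult) (simp add: add.commute)
  thus ?thesis
  proof (rule summable_comparison_test'[where N = 0])
    show "norm (norm (c_fun (4 * of_nat (Suc m)))) \<le> (8 / (pi * c1)) * (1 / (real m + 1)\<^sup>2)" for m
      using bound[of m] by (simp only: real_norm_def abs_norm_cancel)
  qed
qed

section \<open>Zeros of \<open>Xi\<close> and of \<open>n_fun\<close>\<close>

lemma zeta_zero_imp_Xi_zero:
  assumes "zeta s = 0" "Im s \<noteq> 0"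
  shows "Xi s = 0"
proof -
  have s: "s \<noteq> 1" using assms by auto
  have "1 + s / 2 \<notin> \<int>\<^sub>\<le>\<^sub>0" using assms(2) by (auto elim!: nonpos_Ints_cases simp: complex_eq_iff)
  thus ?thesis using assms(1) s zeta_eq_zeta_ext[OF s] by (simp add: zeta_ext_def rGamma_eq_zero_iff)
qed

lemma Xi_nonzero_right:
  assumes "Re s \<ge> 1"
  shows "Xi s \<noteq> 0"
proof -
  have "1 + s / 2 \<notin> \<int>\<^sub>\<le>\<^sub>0" using assms by (auto elim!: nonpos_Ints_cases simp: complex_eq_iff)
  hence G: "Gamma (1 + s / 2) \<noteq> 0" by (simp add: Gamma_eq_zero_iff)
  have "zeta_reg s \<noteq> 0"
  proof (cases "s = 1")
    case True
    \<comment> \<open>At s = 1 only the summand (s + 1)/2 survives, so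
      \<open>zeta_reg 1 = 1\<close>, the residue of zeta.\<close>
    have "euler_maclaurin_term n 1 = 0" for n by (simp add: euler_maclaurin_term_def del: of_nat_Suc)
    thus ?thesis by (simp add: True zeta_reg_def)
  next
    case False
    thus ?thesis using zeta_nonzero_right[of s] zeta_right[of s] assms by auto
  qed
  thus ?thesis using assms G by (simp add: Xi_right xi_half_def)
qed

text \<open>Nonvanishing on Re s >= 1 and the reflection confine the zeros to the open critical
  strip, where the Riemann hypothesis applies; the point 1/2 itself is excluded by
  \<open>zeta_reg_half_nonzero\<close>.\<close>

lemma Xi_zero:
  assumes "riemann_hypothesis" "Xi s = 0"
  shows "zeta s = 0" "Re s = 1 / 2" "Im s \<noteq> 0"
proof -
  have 1: "Re s < 1" using Xi_nonzero_right[of s] assms by force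
  have 2: "Re s > 0" using Xi_nonzero_right[of "1 - s"] assms Xi_reflection[of s] by force
  have "1 + s / 2 \<notin> \<int>\<^sub>\<le>\<^sub>0" using 2 by (auto elim!: nonpos_Ints_cases simp: complex_eq_iff)
  hence "Gamma (1 + s / 2) \<noteq> 0" by (simp add: Gamma_eq_zero_iff)
  hence r: "zeta_reg s = 0" using assms 2 by (simp add: Xi_right xi_half_def)
  moreover have "s \<noteq> 1" using 1 by auto
  ultimately show "zeta s = 0" using 2 by (simp add: zeta_right)
  thus 3: "Re s = 1 / 2" using assms(1) 1 2 by (simp add: riemann_hypothesis_def)
  show "Im s \<noteq> 0"
  proof
    assume "Im s = 0"
    hence "s = 1 / 2" using 3 by (simp add: complex_eq_iff)
    thus False using r zeta_reg_half_nonzero by metis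
  qed
qed

lemma deriv_n_fun_4_nonzero:
  assumes "riemann_hypothesis"
  shows "deriv n_fun (4 * of_int w) \<noteq> 0"
proof -
  have "Xi (1 / 2 + 4 * of_int w) \<noteq> 0" using Xi_zero(3)[OF assms, of "1 / 2 + 4 * of_int w"] by auto
  hence "norm (deriv n_fun (4 * of_int w)) > 0" unfolding norm_deriv_n_fun_4 by simp
  thus ?thesis by auto
qed

text \<open>The trivial zeros of zeta are cancelled in \<open>Xi\<close> by the poles of Gamma and,
  being real, are also absent from \<open>Z_i\<close>; the remaining zeros are nonreal by
  \<open>Xi_zero\<close>.\<close>

lemma n_fun_eq_0_iff:
  assumes "riemann_hypothesis"
  shows "n_fun s = 0 \<longleftrightarrow> s \<in> Z_circ"
proof -
  have "sin (of_real pi * s / 4) = 0 \<longleftrightarrow> (\<exists>w::int. s = 4 * of_int w)"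
  proof -
    have "of_real pi * s / 4 = of_real (of_int w * pi) \<longleftrightarrow> s = 4 * of_int w" for w :: int
      by (auto simp: field_simps)
    thus ?thesis by (simp add: sin_eq_0)
  qed
  moreover have "Xi (1 / 2 + s) = 0 \<longleftrightarrow> s \<in> Z_i"
  proof
    assume "Xi (1 / 2 + s) = 0"
    from Xi_zero[OF assms this] show "s \<in> Z_i" by (auto simp: Z_i_def complex_is_Real_iff)
  next
    assume "s \<in> Z_i"
    thus "Xi (1 / 2 + s) = 0" by (intro zeta_zero_imp_Xi_zero) (auto simp: Z_i_def complex_is_Real_iff)
  qed
  ultimately show ?thesis by (auto simp: n_fun_eq Z_circ_def)
qed

section \<open>Simple poles and pole series\<close>

text \<open>A pole of order at most one with residue \<open>c\<close>; the case \<open>c = 0\<close>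
  is a removable singularity. Comparison on a punctured neighbourhood ignores whatever value
  division by zero gives at \<open>a\<close>.\<close>

definition has_simple_part :: "(complex \<Rightarrow> complex) \<Rightarrow> complex \<Rightarrow> complex \<Rightarrow> bool" where
  "has_simple_part F a c \<longleftrightarrow> (\<exists>h. h analytic_on {a} \<and> (\<forall>\<^sub>F s in at a. F s = h s + c / (s - a)))"

lemma has_simple_part_analytic: "F analytic_on {a} \<Longrightarrow> has_simple_part F a 0"
  unfolding has_simple_part_def by (intro exI[of _ F]) auto

lemma has_simple_part_add:
  assumes "has_simple_part F a c" "has_simple_part G a d"
  shows "has_simple_part (\<lambda>s. F s + G s) a (c + d)"
proof -
  obtain h where h: "h analytic_on {a}" "\<forall>\<^sub>F s in at a. F s = h s + c / (s - a)" using assms by (auto simp: has_simple_part_def)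
  obtain k where k: "k analytic_on {a}" "\<forall>\<^sub>F s in at a. G s = k s + d / (s - a)" using assms by (auto simp: has_simple_part_def)
  have "\<forall>\<^sub>F s in at a. F s + G s = (h s + k s) + (c + d) / (s - a)"
    using h(2) k(2) by eventually_elim (simp add: add_divide_distrib)
  thus ?thesis unfolding has_simple_part_def using h k by (intro exI[of _ "\<lambda>s. h s + k s"]) (auto intro: analytic_intros)
qed

lemma has_simple_part_diff:
  assumes "has_simple_part F a c" "has_simple_part G a d"
  shows "has_simple_part (\<lambda>s. F s - G s) a (c - d)"
proof -
  obtain h where h: "h analytic_on {a}" "\<forall>\<^sub>F s in at a. F s = h s + c / (s - a)" using assms by (auto simp: has_simple_part_def)
  obtain k where k: "k analytic_on {a}" "\<forall>\<^sub>F s in at a. G s = k s + d / (s - a)" using assms by (auto simp: has_simple_part_def)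
  have "\<forall>\<^sub>F s in at a. F s - G s = (h s - k s) + (c - d) / (s - a)"
    using h(2) k(2) by eventually_elim (simp add: diff_divide_distrib)
  thus ?thesis unfolding has_simple_part_def using h k by (intro exI[of _ "\<lambda>s. h s - k s"]) (auto intro: analytic_intros)
qed

lemma has_simple_part_pole: "has_simple_part (\<lambda>s. c / (s - a)) a c"
  unfolding has_simple_part_def by (intro exI[of _ "\<lambda>_. 0"]) auto

lemma remove_sings_analytic_if_simple_part_0:
  assumes "has_simple_part F a 0"
  shows "remove_sings F analytic_on {a}"
proof -
  obtain h where h: "h analytic_on {a}" "\<forall>\<^sub>F s in at a. F s = h s" using assms by (auto simp: has_simple_part_def)
  have "isolated_singularity_at F a \<longleftrightarrow> isolated_singularity_at h a"
    by (rule isolated_singularity_at_cong) (use h in auto)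
  moreover have "isolated_singularity_at h a" using h(1) by (rule isolated_singularity_at_analytic)
  moreover have "h \<midarrow>a\<rightarrow> h a" using h(1) analytic_at_imp_isCont isContD by blast
  hence "F \<midarrow>a\<rightarrow> h a" using h(2) by (subst filterlim_cong[OF refl refl]) auto
  ultimately show ?thesis by (intro remove_sings_analytic_at) auto
qed

lemma has_simple_part_inverse_of_simple_zero:
  assumes "n analytic_on {a}" "n a = 0" "deriv n a \<noteq> 0"
  shows "has_simple_part (\<lambda>s. 1 / n s) a (1 / deriv n a)"
proof -
  obtain r where r: "r > 0" "n holomorphic_on ball a r" using assms(1) by (auto simp: analytic_on_def)
  \<comment> \<open>\<open>m\<close> is \<open>n\<close> divided by its simple zero and
    \<open>g = 1 / m\<close>. After g(a)/(s - a) is split off from 1/n, the difference quotient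
    \<open>h\<close> of \<open>g\<close> is the analytic remainder.\<close>
  define m where "m = (\<lambda>z. if z = a then deriv n a else (n z - n a) / (z - a))"
  have m: "m holomorphic_on ball a r" unfolding m_def by (rule pole_lemma) (use r in auto)
  have "isCont m a" using holomorphic_on_imp_continuous_on[OF m] r by (simp add: continuous_on_eq_continuous_at)
  moreover have "m a \<noteq> 0" using assms by (simp add: m_def)
  ultimately obtain e where e: "e > 0" "\<And>z. dist a z < e \<Longrightarrow> m z \<noteq> 0" using continuous_at_avoid[of a m 0] by metis
  define g where "g = (\<lambda>z. 1 / m z)"
  define t where "t = min r e"
  have t: "t > 0" using r e by (simp add: t_def)
  have g: "g holomorphic_on ball a t" unfolding g_def
    by (intro holomorphic_intros holomorphic_on_subset[OF m]) (use e in \<open>auto simp: t_def\<close>)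
  define h where "h = (\<lambda>z. if z = a then deriv g a else (g z - g a) / (z - a))"
  have h: "h holomorphic_on ball a t" unfolding h_def by (rule pole_lemma) (use g t in auto)
  have "\<forall>\<^sub>F s in at a. 1 / n s = h s + 1 / deriv n a / (s - a)"
  proof (rule eventually_at_ball'[THEN eventually_mono])
    show "t > 0" by fact
    fix z assume z: "z \<in> ball a t \<and> z \<noteq> a \<and> z \<in> UNIV"
    have "n z = m z * (z - a)" using z assms(2) by (simp add: m_def)
    hence "1 / n z = g z / (z - a)" by (simp add: g_def)
    also have "\<dots> = h z + g a / (z - a)" using z by (simp add: h_def diff_divide_distrib)
    finally show "1 / n z = h z + 1 / deriv n a / (z - a)" by (simp add: g_def m_def)
  qed
  moreover have "h analytic_on {a}" using h t by (auto simp: analytic_at intro!: exI[of _ "ball a t"])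
  ultimately show ?thesis unfolding has_simple_part_def by blast
qed

text \<open>Common form of \<open>p_i\<close> and of \<open>p_r\<close> without its term at 0.
  Opposite poles share one coefficient because the derivative of the odd function
  \<open>n_fun\<close> is even.\<close>

definition pole_pairs :: "(nat \<Rightarrow> complex) \<Rightarrow> (nat \<Rightarrow> complex) \<Rightarrow> complex \<Rightarrow> complex" where
  "pole_pairs b z s = (\<Sum>k. b k * (1 / (s - z k) + 1 / (s + z k)))"

lemma norm_pole_pair_le:
  fixes b s w :: complex
  assumes "\<delta> > 0" "b = 0 \<or> norm (s - w) \<ge> \<delta> \<and> norm (s + w) \<ge> \<delta>"
  shows "norm (b * (1 / (s - w) + 1 / (s + w))) \<le> norm b * (2 / \<delta>)"
proof (cases "b = 0")
  case False
  have "norm (1 / (s - w)) \<le> 1 / \<delta>" "norm (1 / (s + w)) \<le> 1 / \<delta>"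
    unfolding norm_divide using assms False by (auto intro!: frac_le)
  hence "norm (1 / (s - w) + 1 / (s + w)) \<le> 1 / \<delta> + 1 / \<delta>" by (rule norm_triangle_mono)
  thus ?thesis unfolding norm_mult by (intro mult_left_mono) auto
qed auto

text \<open>The alternative \<open>b k = 0\<close> admits a series from which one pair has been
  struck out, so the result also applies near the poles of that pair.\<close>

lemma pole_pairs_holomorphic:
  assumes "summable (\<lambda>k. norm (b k))" "open S" "\<delta> > 0"
  assumes "\<And>s k. s \<in> S \<Longrightarrow> b k = 0 \<or> norm (s - z k) \<ge> \<delta> \<and> norm (s + z k) \<ge> \<delta>"
  shows "pole_pairs b z holomorphic_on S"
proof -
  have "(\<lambda>s. \<Sum>k. b k * (1 / (s - z k) + 1 / (s + z k))) holomorphic_on S"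
  proof (rule holomorphic_on_suminf[OF assms(2)])
    show "(\<lambda>s. b k * (1 / (s - z k) + 1 / (s + z k))) holomorphic_on S" for k
    proof (cases "b k = 0")
      case False
      hence "s - z k \<noteq> 0" "s + z k \<noteq> 0" if "s \<in> S" for s using assms(4)[OF that, of k] assms(3) by auto
      thus ?thesis by (intro holomorphic_intros) auto
    qed auto
    fix x assume "x \<in> S"
    then obtain d where d: "d > 0" "cball x d \<subseteq> S" using assms(2) by (auto simp: open_contains_cball)
    have "norm (b k * (1 / (y - z k) + 1 / (y + z k))) \<le> norm (b k) * (2 / \<delta>)" if "y \<in> cball x d" for y k
    proof (rule norm_pole_pair_le[OF assms(3)])
      have "y \<in> S" using that d by blast
      thus "b k = 0 \<or> norm (y - z k) \<ge> \<delta> \<and> norm (y + z k) \<ge> \<delta>" by (rule assms(4))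
    qed
    thus "\<exists>d>0. \<exists>M. cball x d \<subseteq> S \<and> summable M \<and> (\<forall>y\<in>cball x d. \<forall>k. norm (b k * (1 / (y - z k) + 1 / (y + z k))) \<le> M k)"
      using d assms(1) by (intro exI[of _ d] conjI exI[of _ "\<lambda>k. norm (b k) * (2 / \<delta>)"] summable_mult2) auto
  qed
  thus ?thesis unfolding pole_pairs_def .
qed

lemma pole_pairs_analytic:
  assumes "summable (\<lambda>k. norm (b k))" "r > 0"
    "\<And>s k. s \<in> ball a r \<Longrightarrow> b k = 0 \<or> norm (s - z k) \<ge> r \<and> norm (s + z k) \<ge> r"
  shows "pole_pairs b z analytic_on {a}"
proof -
  have "pole_pairs b z holomorphic_on ball a r"
    by (rule pole_pairs_holomorphic[OF assms(1) open_ball assms(2,3)])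
  thus ?thesis using assms(2) by (metis analytic_at centre_in_ball open_ball)
qed

lemma pole_pairs_simple_part:
  assumes sm: "summable (\<lambda>k. norm (b k))" and r: "r > 0"
    and away: "\<And>k w. w = z k \<or> w = - z k \<Longrightarrow> w \<noteq> a \<Longrightarrow> dist a w \<ge> 2 * r"
    and inj: "\<And>j k. z j = z k \<Longrightarrow> j = k" "\<And>j k. z j \<noteq> - z k"
    and a: "a = z j \<or> a = - z j"
  shows "has_simple_part (pole_pairs b z) a (b j)"
proof -
  \<comment> \<open>Strikes out the pair that is singular at \<open>a\<close>; the rest of the
    series is analytic there.\<close>
  define b' where "b' = b(j := 0)"
  have nb: "norm (b' k) \<le> norm (b k)" for k by (simp add: b'_def)
  have sm': "summable (\<lambda>k. norm (b' k))" by (rule summable_comparison_test[OF _ sm]) (use nb in auto)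
  have dst: "b' k = 0 \<or> norm (s - z k) \<ge> r \<and> norm (s + z k) \<ge> r" if s: "s \<in> ball a r" for s k
  proof (cases "k = j")
    case False
    have "z k \<noteq> a" "- z k \<noteq> a" using a inj(1)[of k j] inj(2)[of k j] inj(2)[of j k] False
      by (auto simp: minus_equation_iff)
    hence "dist a (z k) \<ge> 2 * r" "dist a (- z k) \<ge> 2 * r" using away by blast+
    moreover have "dist a w \<le> dist a s + dist s w" for w by (rule dist_triangle)
    ultimately have "dist s (z k) \<ge> r" "dist s (- z k) \<ge> r" using s by (smt (verit) mem_ball)+
    thus ?thesis by (simp add: dist_norm)
  qed (simp add: b'_def)
  have an: "pole_pairs b' z analytic_on {a}" by (rule pole_pairs_analytic[OF sm' r dst])
  have eq: "pole_pairs b z s = pole_pairs b' z s + (b j / (s - z j) + b j / (s + z j))" if s: "s \<in> ball a r" for s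
  proof -
    define t where "t = b j * (1 / (s - z j) + 1 / (s + z j))"
    have "summable (\<lambda>k. norm (b' k * (1 / (s - z k) + 1 / (s + z k))))"
    proof (rule summable_comparison_test'[OF summable_mult2[OF sm', of "2 / r"]])
      show "norm (norm (b' k * (1 / (s - z k) + 1 / (s + z k)))) \<le> norm (b' k) * (2 / r)" for k
        unfolding real_norm_def abs_norm_cancel by (rule norm_pole_pair_le[OF r dst[OF s]])
    qed
    hence "(\<lambda>k. b' k * (1 / (s - z k) + 1 / (s + z k))) sums pole_pairs b' z s"
      unfolding pole_pairs_def by (rule summable_sums[OF summable_norm_cancel])
    moreover have "(\<lambda>k. if k = j then t else 0) sums t" using sums_single[of j "\<lambda>_. t"] by simp
    ultimately have "(\<lambda>k. b' k * (1 / (s - z k) + 1 / (s + z k)) + (if k = j then t else 0)) sums (pole_pairs b' z s + t)"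
      by (rule sums_add)
    also have "(\<lambda>k. b' k * (1 / (s - z k) + 1 / (s + z k)) + (if k = j then t else 0)) = (\<lambda>k. b k * (1 / (s - z k) + 1 / (s + z k)))"
      by (auto simp: b'_def t_def)
    finally show ?thesis by (simp add: pole_pairs_def sums_iff t_def distrib_left)
  qed
  have z0: "z j \<noteq> 0" using inj(2)[of j j] by auto
  \<comment> \<open>Whichever sign relates \<open>a\<close> to \<open>z j\<close>, the pair reads b
    j/(s - a) + b j/(s + a), and the second summand is analytic at \<open>a\<close> because
    \<open>a\<close> is not 0.\<close>
  define h where "h = (\<lambda>s. pole_pairs b' z s + b j / (s + a))"
  have "h analytic_on {a}" unfolding h_def using an z0 a by (intro analytic_intros an) auto
  moreover have "\<forall>\<^sub>F s in at a. pole_pairs b z s = h s + b j / (s - a)"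
    using eventually_at_ball[OF r, of a UNIV] by eventually_elim (use eq a in \<open>auto simp: h_def\<close>)
  ultimately show ?thesis unfolding has_simple_part_def by blast
qed

lemma inverse_tendsto_0_at_infinity_bound:
  fixes w :: complex
  assumes "\<epsilon> > 0"
  obtains R where "\<And>s. norm s \<ge> R \<Longrightarrow> norm (1 / (s - w) + 1 / (s + w)) < \<epsilon>"
proof
  fix s :: complex assume s: "norm s \<ge> norm w + 4 / \<epsilon>"
  have "4 / \<epsilon> > 0" using assms by simp
  have "norm (s - w) \<ge> 4 / \<epsilon>" using s norm_triangle_ineq2[of s w] by linarith
  moreover have "norm (s + w) \<ge> 4 / \<epsilon>" using s norm_triangle_ineq2[of s "-w"] by simp
  ultimately have "norm (1 / (s - w)) \<le> 1 / (4 / \<epsilon>)" "norm (1 / (s + w)) \<le> 1 / (4 / \<epsilon>)"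
    unfolding norm_divide using assms by (auto intro!: frac_le simp del: divide_divide_eq_right)
  hence "norm (1 / (s - w) + 1 / (s + w)) \<le> 1 / (4 / \<epsilon>) + 1 / (4 / \<epsilon>)" by (rule norm_triangle_mono)
  also have "\<dots> < \<epsilon>" using assms by simp
  finally show "norm (1 / (s - w) + 1 / (s + w)) < \<epsilon>" .
qed

lemma pole_pairs_decay:
  assumes sm: "summable (\<lambda>k. norm (b k))" and \<delta>: "\<delta> > 0" and \<epsilon>: "\<epsilon> > 0"
  obtains R where "\<And>s. norm s \<ge> R \<Longrightarrow> (\<And>k. norm (s - z k) \<ge> \<delta> \<and> norm (s + z k) \<ge> \<delta>) \<Longrightarrow> norm (pole_pairs b z s) < \<epsilon>"
proof -
  have "(\<lambda>N. \<Sum>k. norm (b (k + N))) \<longlonglongrightarrow> 0" by (rule suminf_exist_split2[OF sm])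
  hence "\<forall>\<^sub>F N in sequentially. (\<Sum>k. norm (b (k + N))) < \<epsilon> * \<delta> / 4"
    using \<epsilon> \<delta> by (intro order_tendstoD) auto
  then obtain N where N: "(\<Sum>k. norm (b (k + N))) < \<epsilon> * \<delta> / 4" by (auto simp: eventually_sequentially)
  \<comment> \<open>Each pair of the tail is at most 2/\<delta> times its coefficient, so the choice
    of N makes the tail less than \<epsilon>/2. The other half goes to the first N pairs; the
    summand 1 keeps the denominator positive.\<close>
  define \<epsilon>' where "\<epsilon>' = \<epsilon> / (2 * (1 + (\<Sum>k<N. norm (b k))))"
  have B: "1 + (\<Sum>k<N. norm (b k)) > 0" by (intro add_pos_nonneg sum_nonneg) auto
  have \<epsilon>': "\<epsilon>' > 0" using \<epsilon> B by (simp add: \<epsilon>'_def)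
  have "\<exists>R. \<forall>s. norm s \<ge> R \<longrightarrow> norm (1 / (s - z k) + 1 / (s + z k)) < \<epsilon>'" for k
    using inverse_tendsto_0_at_infinity_bound[OF \<epsilon>', of "z k"] by metis
  then obtain R where R: "\<And>k s. norm s \<ge> R k \<Longrightarrow> norm (1 / (s - z k) + 1 / (s + z k)) < \<epsilon>'" by metis
  show ?thesis
  \<comment> \<open>The index set \<open>{..N}\<close> is nonempty also when N = 0, as
    \<open>Max\<close> requires.\<close>
  proof (rule that[of "Max (R ` {..N})"])
    fix s assume s: "norm s \<ge> Max (R ` {..N})" "\<And>k. norm (s - z k) \<ge> \<delta> \<and> norm (s + z k) \<ge> \<delta>"
    define g where "g = (\<lambda>k. b k * (1 / (s - z k) + 1 / (s + z k)))"
    have g: "norm (g k) \<le> norm (b k) * (2 / \<delta>)" for k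
      unfolding g_def by (rule norm_pole_pair_le[OF \<delta>]) (use s in auto)
    have "summable (\<lambda>k. norm (g k))"
      by (rule summable_comparison_test[OF _ summable_mult2[OF sm, of "2 / \<delta>"]]) (use g in auto)
    hence "(\<Sum>k. g k) = (\<Sum>k. g (k + N)) + (\<Sum>k<N. g k)"
      by (rule suminf_split_initial_segment[OF summable_norm_cancel])
    moreover have "norm (\<Sum>k. g (k + N)) \<le> (\<Sum>k. norm (b (k + N)) * (2 / \<delta>))"
      by (rule norm_suminf_le[OF g]) (intro summable_mult2 summable_ignore_initial_segment sm)
    moreover have "(\<Sum>k. norm (b (k + N)) * (2 / \<delta>)) = (\<Sum>k. norm (b (k + N))) * (2 / \<delta>)"
      by (rule suminf_mult2[symmetric]) (intro summable_ignore_initial_segment sm)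
    moreover have "(\<Sum>k. norm (b (k + N))) * (2 / \<delta>) < \<epsilon> / 2"
      using N \<delta> by (simp add: field_simps)
    moreover have "norm (\<Sum>k<N. g k) \<le> \<epsilon> / 2"
    proof -
      have "norm (\<Sum>k<N. g k) \<le> (\<Sum>k<N. norm (b k) * \<epsilon>')"
      proof (rule sum_norm_le)
        fix k assume "k \<in> {..<N}"
        hence "R k \<le> Max (R ` {..N})" by (intro Max_ge) auto
        hence "norm (1 / (s - z k) + 1 / (s + z k)) \<le> \<epsilon>'" using R[of k s] s by auto
        thus "norm (g k) \<le> norm (b k) * \<epsilon>'" unfolding g_def norm_mult by (intro mult_left_mono) auto
      qed
      also have "\<dots> = (\<Sum>k<N. norm (b k)) * \<epsilon>'" by (simp add: sum_distrib_right)
      also have "\<dots> \<le> (1 + (\<Sum>k<N. norm (b k))) * \<epsilon>'" using \<epsilon>' by (intro mult_right_mono) auto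
      also have "\<dots> = \<epsilon> / 2"
      proof -
        have "P * (\<epsilon> / (2 * P)) = \<epsilon> / 2" if "P > 0" for P :: real using that by simp
        from this[OF B] show ?thesis unfolding \<epsilon>'_def .
      qed
      finally show ?thesis .
    qed
    ultimately show "norm (pole_pairs b z s) < \<epsilon>"
      unfolding pole_pairs_def g_def[symmetric]
      using norm_triangle_ineq[of "\<Sum>k. g (k + N)" "\<Sum>k<N. g k"] by simp
  qed
qed

theorem mainTheorem2:
  fixes \<gamma> :: "nat \<Rightarrow> real"
  assumes gamma_increasing: "strict_mono \<gamma>"
    and gamma_enumerates: "range \<gamma> = {Im \<rho> |\<rho>. zeta \<rho> = 0 \<and> Im \<rho> > 0}"
    and RH: "riemann_hypothesis"
    and A_defined: "\<forall>k. deriv n_fun (\<i> * of_real (\<gamma> k)) \<noteq> 0"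
    and A_finite: "summable (\<lambda>k. norm (c_fun (\<i> * of_real (\<gamma> k))))"
  shows "\<exists>\<Delta>. \<Delta> holomorphic_on UNIV \<and>
             (\<forall>s. s \<notin> Z_circ \<longrightarrow> \<Delta> s = f_fun s - p_fun \<gamma> s) \<and>
             (\<forall>\<epsilon>>0. \<exists>R. \<forall>s. \<bar>Re s\<bar> \<ge> 1 / 2 \<and> norm s \<ge> R \<longrightarrow> norm (\<Delta> s) < \<epsilon>)"
proof -
  define zr where "zr = (\<lambda>k. 4 * of_nat (Suc k) :: complex)"
  define zi where "zi = (\<lambda>k. \<i> * complex_of_real (\<gamma> k))"
  define br where "br = (\<lambda>k. c_fun (zr k))"
  define bi where "bi = (\<lambda>k. c_fun (zi k))"
  have smr: "summable (\<lambda>k. norm (br k))" unfolding br_def zr_def by (rule summable_c_fun_4)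
  have smi: "summable (\<lambda>k. norm (bi k))" unfolding bi_def zi_def by (rule A_finite)
  have p_eq: "p_fun \<gamma> = (\<lambda>s. c_fun 0 / (s - 0) + pole_pairs br zr s + pole_pairs bi zi s)"
    by (simp add: p_fun_def p_r_def p_i_def pole_pairs_def br_def bi_def zr_def zi_def fun_eq_iff)
  define F where "F = (\<lambda>s. f_fun s - p_fun \<gamma> s)"

  \<comment> \<open>The zeros of \<open>n_fun\<close>: enumeration, symmetry and separation\<close>
  have gpos: "\<gamma> k > 0" for k using gamma_enumerates by (auto dest: rangeI[of \<gamma> k, THEN subsetD[OF equalityD1, rotated]])
  \<comment> \<open>\<open>\<gamma>\<close> records imaginary parts only; the Riemann hypothesis
    supplies the real part 1/2, so each ordinate determines its zero.\<close>
  have zi_Xi: "Xi (1 / 2 + zi k) = 0" for k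
  proof -
    have "\<gamma> k \<in> {Im \<rho> |\<rho>. zeta \<rho> = 0 \<and> Im \<rho> > 0}" using gamma_enumerates by blast
    then obtain \<rho> where \<rho>: "\<gamma> k = Im \<rho>" "zeta \<rho> = 0" "Im \<rho> > 0" by blast
    hence X: "Xi \<rho> = 0" by (intro zeta_zero_imp_Xi_zero) auto
    hence "Re \<rho> = 1 / 2" by (rule Xi_zero(2)[OF RH])
    hence "\<rho> = 1 / 2 + zi k" using \<rho> by (simp add: zi_def complex_eq_iff)
    thus ?thesis using X by simp
  qed
  have minus_circ: "- w \<in> Z_circ \<longleftrightarrow> w \<in> Z_circ" for w
    using n_fun_eq_0_iff[OF RH, of w] n_fun_eq_0_iff[OF RH, of "-w"] by (simp add: n_fun_minus)
  have zi_circ: "zi k \<in> Z_circ" for k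
    unfolding n_fun_eq_0_iff[OF RH, symmetric] by (simp add: n_fun_eq zi_Xi)
  have zr_circ: "zr k \<in> Z_circ" for k
    unfolding Z_circ_def zr_def by (auto intro!: exI[of _ "int (Suc k)"])
  have circ_cases: "a = 0 \<or> (\<exists>k. a = zr k \<or> a = - zr k) \<or> (\<exists>k. a = zi k \<or> a = - zi k)" if "a \<in> Z_circ" for a
  proof -
    from that consider w :: int where "a = 4 * of_int w" | "a \<in> Z_i" by (auto simp: Z_circ_def)
    thus ?thesis
    proof cases
      case 1
      show ?thesis
      proof (cases w "0::int" rule: linorder_cases)
        case less
        hence "a = - zr (nat (- w - 1))" by (simp add: 1 zr_def of_nat_nat)
        thus ?thesis by blast
      next
        case greater
        hence "a = zr (nat (w - 1))" by (simp add: 1 zr_def of_nat_nat)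
        thus ?thesis by blast
      qed (simp add: 1)
    next
      case 2
      hence "zeta (1 / 2 + a) = 0" "Im a \<noteq> 0" by (auto simp: Z_i_def complex_is_Real_iff)
      hence X: "Xi (1 / 2 + a) = 0" by (intro zeta_zero_imp_Xi_zero) auto
      have X': "Xi (1 / 2 - a) = 0" using Xi_reflection[of "1 / 2 + a"] X by simp
      have Re: "Re a = 0" using Xi_zero(2)[OF RH X] by simp
      show ?thesis
      proof (cases "Im a > 0")
        case True
        have "Im (1 / 2 + a) \<in> range \<gamma>" unfolding gamma_enumerates
          using Xi_zero(1)[OF RH X] True by (intro CollectI exI[of _ "1 / 2 + a"]) simp
        then obtain k where "Im a = \<gamma> k" by auto
        hence "a = zi k" using Re by (simp add: zi_def complex_eq_iff)
        thus ?thesis by blast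
      next
        case False
        \<comment> \<open>\<open>\<gamma>\<close> lists the ordinates above the real axis only, so
          for Im a < 0 the reflected zero 1/2 - a is looked up instead.\<close>
        have "Im (1 / 2 - a) \<in> range \<gamma>" unfolding gamma_enumerates
          using Xi_zero(1)[OF RH X'] False \<open>Im a \<noteq> 0\<close> by (intro CollectI exI[of _ "1 / 2 - a"]) simp
        then obtain k where "- Im a = \<gamma> k" by auto
        hence "a = - zi k" using Re by (simp add: zi_def complex_eq_iff)
        thus ?thesis by blast
      qed
    qed
  qed
  have zr_neq_zi: "zr j \<noteq> zi k" "zr j \<noteq> - zi k" "zr j \<noteq> 0" "zi k \<noteq> 0" for j k
    using gpos[of k] by (auto simp: zr_def zi_def complex_eq_iff simp del: of_nat_Suc)
  have inj_r: "zr j = zr k \<Longrightarrow> j = k" "zr j \<noteq> - zr k" for j k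
  proof -
    show "zr j = zr k \<Longrightarrow> j = k" by (simp add: zr_def)
    have "Re (zr j) > 0" "Re (zr k) > 0" by (simp_all add: zr_def)
    thus "zr j \<noteq> - zr k" by (metis add.inverse_inverse neg_less_0_iff_less not_less_iff_gr_or_eq uminus_complex.sel(1))
  qed
  have inj_i: "zi j = zi k \<Longrightarrow> j = k" "zi j \<noteq> - zi k" for j k
  proof -
    show "zi j = zi k \<Longrightarrow> j = k" using strict_mono_eq[OF gamma_increasing] by (simp add: zi_def)
    show "zi j \<noteq> - zi k" using gpos[of j] gpos[of k] by (auto simp: zi_def complex_eq_iff)
  qed

  \<comment> \<open>With separation \<open>2 * r\<close>, every point of the disc of radius r about
    \<open>a\<close> keeps distance r from the other zeros.\<close>
  have isolated: "\<exists>r>0. \<forall>w\<in>Z_circ. w \<noteq> a \<longrightarrow> dist a w \<ge> 2 * r" for a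
  proof -
    \<comment> \<open>Zeros are isolated once \<open>n_fun\<close> is not identically zero; 2 is
      real and not a multiple of 4, so it is outside \<open>Z_circ\<close>.\<close>
    have "n_fun 2 \<noteq> 0"
    proof -
      have "(2::complex) \<noteq> 4 * of_int w" for w :: int
      proof
        assume "(2::complex) = 4 * of_int w"
        hence "(of_int 2 :: complex) = of_int (4 * w)" by simp
        hence "2 = 4 * w" by (simp only: of_int_eq_iff)
        thus False by presburger
      qed
      thus ?thesis unfolding n_fun_eq_0_iff[OF RH] by (auto simp: Z_circ_def Z_i_def)
    qed
    hence "\<forall>\<^sub>F w in at a. n_fun w \<noteq> 0"
      using non_zero_neighbour_alt[OF holomorphic_n_fun[of UNIV], of a 2] by (auto elim: eventually_mono)
    then obtain e where e: "e > 0" "\<And>w. w \<noteq> a \<Longrightarrow> dist w a < e \<Longrightarrow> n_fun w \<noteq> 0"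
      by (auto simp: eventually_at)
    hence "\<forall>w\<in>Z_circ. w \<noteq> a \<longrightarrow> dist a w \<ge> 2 * (e / 2)"
      using n_fun_eq_0_iff[OF RH] by (force simp: dist_commute)
    thus ?thesis using e(1) by (intro exI[of _ "e / 2"]) auto
  qed
  have pp_analytic: "pole_pairs b z analytic_on {a}"
    if "summable (\<lambda>k. norm (b k))" "\<And>k. z k \<in> Z_circ" "\<And>k. z k \<noteq> a \<and> - z k \<noteq> a" for b z a
  proof -
    obtain r where r: "r > 0" "\<And>w. w \<in> Z_circ \<Longrightarrow> w \<noteq> a \<Longrightarrow> dist a w \<ge> 2 * r" using isolated by blast
    show ?thesis
    proof (rule pole_pairs_analytic[OF that(1) r(1)])
      fix s k assume s: "s \<in> ball a r"
      have "dist a (z k) \<ge> 2 * r" "dist a (- z k) \<ge> 2 * r" using r(2) that minus_circ by blast+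
      moreover have "dist a w \<le> dist a s + dist s w" for w by (rule dist_triangle)
      ultimately have "dist s (z k) \<ge> r" "dist s (- z k) \<ge> r" using s by (smt (verit) mem_ball)+
      thus "b k = 0 \<or> norm (s - z k) \<ge> r \<and> norm (s + z k) \<ge> r" by (simp add: dist_norm)
    qed
  qed
  have pp_simple: "has_simple_part (pole_pairs b z) a (b j)"
    if "summable (\<lambda>k. norm (b k))" "\<And>k. z k \<in> Z_circ" "\<And>j k. z j = z k \<Longrightarrow> j = k" "\<And>j k. z j \<noteq> - z k"
       "a = z j \<or> a = - z j" for b z a j
  proof -
    obtain r where r: "r > 0" "\<And>w. w \<in> Z_circ \<Longrightarrow> w \<noteq> a \<Longrightarrow> dist a w \<ge> 2 * r" using isolated by blast
    show ?thesis
    proof (rule pole_pairs_simple_part)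
      show "dist a w \<ge> 2 * r" if "w = z k \<or> w = - z k" "w \<noteq> a" for k w
        using r(2)[of w] that \<open>\<And>k. z k \<in> Z_circ\<close> minus_circ by blast
    qed (fact that r(1))+
  qed
  have c0_analytic: "(\<lambda>s. c_fun 0 / (s - 0)) analytic_on {a}" if "a \<noteq> 0" for a
    using that by (intro analytic_intros) auto

  \<comment> \<open>Cancellation of the principal parts of \<open>f_fun\<close> and
    \<open>p_fun\<close>\<close>
  have F_analytic: "F analytic_on {a}" if "a \<notin> Z_circ" for a
  proof -
    have "0 \<in> Z_circ" by (auto simp: Z_circ_def intro: exI[of _ 0])
    hence "a \<noteq> 0" using that by auto
    moreover have "zr k \<noteq> a \<and> - zr k \<noteq> a" "zi k \<noteq> a \<and> - zi k \<noteq> a" for k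
      using zr_circ zi_circ minus_circ that by metis+
    ultimately have "p_fun \<gamma> analytic_on {a}" unfolding p_eq
      by (intro analytic_on_add c0_analytic pp_analytic smr smi zr_circ zi_circ)
    moreover have "f_fun analytic_on {a}"
      unfolding f_fun_def[abs_def] using that n_fun_eq_0_iff[OF RH, of a]
      by (intro analytic_intros n_fun_analytic) auto
    ultimately show ?thesis unfolding F_def by (intro analytic_intros)
  qed
  \<comment> \<open>At a simple zero \<open>a\<close> of \<open>n_fun\<close> the residue of
    \<open>f_fun\<close> is \<open>c_fun a\<close>. Exactly one of the three pieces of
    \<open>p_fun\<close> is singular there, with coefficient \<open>c_fun a\<close> or
    \<open>c_fun (- a)\<close>, which agree by \<open>c_fun_minus\<close>.\<close>
  have F_simple: "has_simple_part F a 0" if a: "a \<in> Z_circ" for a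
  proof -
    have "deriv n_fun (zr k) \<noteq> 0" for k
      using deriv_n_fun_4_nonzero[OF RH, of "int (Suc k)"] by (simp add: zr_def)
    moreover have "deriv n_fun (zi k) \<noteq> 0" for k using A_defined by (simp add: zi_def)
    moreover have "deriv n_fun 0 \<noteq> 0" using deriv_n_fun_4_nonzero[OF RH, of 0] by simp
    ultimately have da: "deriv n_fun a \<noteq> 0" using circ_cases[OF a] deriv_n_fun_minus by metis
    have "has_simple_part f_fun a (c_fun a)"
      unfolding f_fun_def[abs_def] c_fun_def
      by (rule has_simple_part_inverse_of_simple_zero[OF n_fun_analytic _ da]) (use a n_fun_eq_0_iff[OF RH] in auto)
    moreover have "has_simple_part (p_fun \<gamma>) a (c_fun a)"
    proof -
      consider "a = 0" | k where "a = zr k \<or> a = - zr k" | k where "a = zi k \<or> a = - zi k" using circ_cases[OF a] by blast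
      thus ?thesis
      proof cases
        case 1
        have "has_simple_part (\<lambda>s. c_fun 0 / (s - 0) + pole_pairs br zr s + pole_pairs bi zi s) 0 (c_fun 0 + 0 + 0)"
          using zr_neq_zi
          by (intro has_simple_part_add has_simple_part_pole has_simple_part_analytic pp_analytic smr smi zr_circ zi_circ) auto
        thus ?thesis by (simp add: p_eq 1)
      next
        case (2 k)
        have ne: "a \<noteq> 0" "zi j \<noteq> a \<and> - zi j \<noteq> a" for j
          using 2 zr_neq_zi(1)[of k j] zr_neq_zi(2)[of k j] zr_neq_zi(3)[of k] by (auto simp: minus_equation_iff)
        have "has_simple_part (pole_pairs br zr) a (br k)" by (rule pp_simple[where b = br and z = zr and j = k, OF smr zr_circ inj_r 2])
        hence "has_simple_part (\<lambda>s. c_fun 0 / (s - 0) + pole_pairs br zr s + pole_pairs bi zi s) a (0 + br k + 0)"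
          by (intro has_simple_part_add has_simple_part_analytic c0_analytic pp_analytic smi zi_circ ne)
        thus ?thesis using 2 by (auto simp: p_eq br_def c_fun_minus)
      next
        case (3 k)
        have ne: "a \<noteq> 0" "zr j \<noteq> a \<and> - zr j \<noteq> a" for j
          using 3 zr_neq_zi(1)[of j k] zr_neq_zi(2)[of j k] zr_neq_zi(4)[of k] by (auto simp: minus_equation_iff)
        have "has_simple_part (pole_pairs bi zi) a (bi k)" by (rule pp_simple[where b = bi and z = zi and j = k, OF smi zi_circ inj_i 3])
        hence "has_simple_part (\<lambda>s. c_fun 0 / (s - 0) + pole_pairs br zr s + pole_pairs bi zi s) a (0 + 0 + bi k)"
          by (intro has_simple_part_add has_simple_part_analytic c0_analytic pp_analytic smr zr_circ ne)
        thus ?thesis using 3 by (auto simp: p_eq bi_def c_fun_minus)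
      qed
    qed
    ultimately show ?thesis unfolding F_def using has_simple_part_diff by fastforce
  qed

  define \<Delta> where "\<Delta> = remove_sings F"
  have "\<Delta> analytic_on {a}" for a
    unfolding \<Delta>_def using F_simple[of a] F_analytic[of a] has_simple_part_analytic
    by (cases "a \<in> Z_circ") (auto intro: remove_sings_analytic_if_simple_part_0)
  hence hol: "\<Delta> holomorphic_on UNIV"
    by (metis analytic_imp_holomorphic analytic_on_analytic_at)
  have eq: "\<Delta> s = f_fun s - p_fun \<gamma> s" if "s \<notin> Z_circ" for s
    using remove_sings_at_analytic[OF F_analytic[OF that]] by (simp add: \<Delta>_def F_def)

  \<comment> \<open>Decay of the difference, first away from the points 4w and then near
    them\<close>
  have decay_outside: "\<exists>R. \<forall>s. \<bar>Re s\<bar> \<ge> 1 / 2 \<and> norm s \<ge> R \<and> (\<forall>w::int. dist s (4 * of_int w) \<ge> 1) \<longrightarrow> norm (\<Delta> s) < \<epsilon>"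
    if \<epsilon>: "\<epsilon> > 0" for \<epsilon>
  proof -
    have \<epsilon>4: "\<epsilon> / 4 > 0" using \<epsilon> by simp
    obtain R1 where R1: "\<And>s. \<bar>Re s\<bar> \<ge> 1 / 2 \<Longrightarrow> norm s \<ge> R1 \<Longrightarrow> (\<And>w::int. dist s (4 * of_int w) \<ge> 1) \<Longrightarrow> norm (f_fun s) < \<epsilon> / 4"
      using f_fun_decay[OF \<epsilon>4] by metis
    obtain R2 where R2: "\<And>s. norm s \<ge> R2 \<Longrightarrow> (\<And>k. norm (s - zr k) \<ge> 1 \<and> norm (s + zr k) \<ge> 1) \<Longrightarrow> norm (pole_pairs br zr s) < \<epsilon> / 4"
      using pole_pairs_decay[OF smr zero_less_one \<epsilon>4] by metis
    obtain R3 where R3: "\<And>s. norm s \<ge> R3 \<Longrightarrow> (\<And>k. norm (s - zi k) \<ge> 1 / 2 \<and> norm (s + zi k) \<ge> 1 / 2) \<Longrightarrow> norm (pole_pairs bi zi s) < \<epsilon> / 4"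
      using pole_pairs_decay[OF smi half_gt_zero[OF zero_less_one] \<epsilon>4] by metis
    define R4 where "R4 = 1 + 4 * norm (c_fun 0) / \<epsilon>"
    have "norm (\<Delta> s) < \<epsilon>" if s: "\<bar>Re s\<bar> \<ge> 1 / 2" "norm s \<ge> Max {R1, R2, R3, R4}" "\<And>w::int. dist s (4 * of_int w) \<ge> 1" for s
    proof -
      have nR: "norm s \<ge> R1" "norm s \<ge> R2" "norm s \<ge> R3" "norm s \<ge> R4" using s(2) by auto
      have dr: "norm (s - zr k) \<ge> 1 \<and> norm (s + zr k) \<ge> 1" for k
      proof -
        have "4 * of_int (int (Suc k)) = zr k" "4 * of_int (- int (Suc k)) = - zr k" by (simp_all add: zr_def)
        with s(3)[of "int (Suc k)"] s(3)[of "- int (Suc k)"] have "dist s (zr k) \<ge> 1" "dist s (- zr k) \<ge> 1"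
          by (simp_all only:)
        thus ?thesis by (simp add: dist_norm)
      qed
      \<comment> \<open>The imaginary poles have real part 0, so the condition on Re s alone yields
        the distance 1/2.\<close>
      have di: "norm (s - zi k) \<ge> 1 / 2 \<and> norm (s + zi k) \<ge> 1 / 2" for k
        using s(1) abs_Re_le_cmod[of "s - zi k"] abs_Re_le_cmod[of "s + zi k"] by (simp add: zi_def)
      have "s \<notin> Z_circ"
      proof
        assume "s \<in> Z_circ"
        from circ_cases[OF this] show False
        proof (elim disjE exE)
          assume "s = 0" thus False using s(3)[of 0] by simp
        next
          fix k assume "s = zr k" thus False using dr[of k] by simp
        next
          fix k assume "s = - zr k" thus False using dr[of k] by simp
        next
          fix k assume "s = zi k" thus False using di[of k] by simp
        next
          fix k assume "s = - zi k" thus False using di[of k] by simp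
        qed
      qed
      hence \<Delta>s: "\<Delta> s = f_fun s - (c_fun 0 / s + pole_pairs br zr s + pole_pairs bi zi s)" by (simp add: eq p_eq)
      have "norm (c_fun 0 / s) < \<epsilon> / 4"
      proof -
        have "0 \<le> 4 * norm (c_fun 0) / \<epsilon>" using \<epsilon> by simp
        hence "norm s > 0" "4 * norm (c_fun 0) / \<epsilon> < norm s" using nR(4) unfolding R4_def by linarith+
        thus ?thesis using \<epsilon> by (simp add: norm_divide field_simps)
      qed
      moreover have "norm (f_fun s) < \<epsilon> / 4" by (rule R1) (use s nR in auto)
      moreover have "norm (pole_pairs br zr s) < \<epsilon> / 4" by (rule R2) (use nR dr in auto)
      moreover have "norm (pole_pairs bi zi s) < \<epsilon> / 4" by (rule R3) (use nR di in auto)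
      ultimately have lt: "norm (f_fun s) + norm (c_fun 0 / s) + norm (pole_pairs br zr s) + norm (pole_pairs bi zi s)
          < \<epsilon> / 4 + \<epsilon> / 4 + \<epsilon> / 4 + \<epsilon> / 4" by (intro add_strict_mono)
      have "norm (a - (b + c + d)) \<le> norm a + norm b + norm c + norm d" for a b c d :: complex
        using norm_triangle_ineq4[of a "b + c + d"] norm_triangle_ineq[of "b + c" d] norm_triangle_ineq[of b c] by linarith
      hence "norm (\<Delta> s) \<le> norm (f_fun s) + norm (c_fun 0 / s) + norm (pole_pairs br zr s) + norm (pole_pairs bi zi s)"
        unfolding \<Delta>s by blast
      also note lt
      finally show ?thesis by simp
    qed
    thus ?thesis by (intro exI[of _ "Max {R1, R2, R3, R4}"]) auto
  qed
  have "\<exists>R. \<forall>s. \<bar>Re s\<bar> \<ge> 1 / 2 \<and> norm s \<ge> R \<longrightarrow> norm (\<Delta> s) < \<epsilon>" if \<epsilon>: "\<epsilon> > 0" for \<epsilon>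
  proof -
    obtain R where R: "\<And>s. \<bar>Re s\<bar> \<ge> 1 / 2 \<Longrightarrow> norm s \<ge> R \<Longrightarrow> (\<And>w::int. dist s (4 * of_int w) \<ge> 1) \<Longrightarrow> norm (\<Delta> s) < \<epsilon> / 2"
      using decay_outside[of "\<epsilon> / 2"] \<epsilon> by (metis half_gt_zero)
    \<comment> \<open>Points of the circle about 4w are less than 2 away from s, hence R + 2. The
      lower limit 2 excludes w = 0, whose unit circle would cross the strip |Re| < 1/2; for w other
      than 0 the circle lies in |Re| >= 3.\<close>
    have "norm (\<Delta> s) < \<epsilon>" if s: "\<bar>Re s\<bar> \<ge> 1 / 2" "norm s \<ge> max 2 (R + 2)" for s
    proof (cases "\<forall>w::int. dist s (4 * of_int w) \<ge> 1")
      case True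
      have "norm (\<Delta> s) < \<epsilon> / 2" by (rule R) (use s True in auto)
      thus ?thesis using \<epsilon> by linarith
    next
      case False
      then obtain w :: int where w: "dist s (4 * of_int w) < 1" by (auto simp: not_le)
      define a where "a = (4 * of_int w :: complex)"
      have "w \<noteq> 0" using w s(2) by (auto simp: dist_norm)
      have bound: "norm (\<Delta> x) \<le> \<epsilon> / 2" if x: "dist a x = 1" for x
      proof -
        have "norm (\<Delta> x) < \<epsilon> / 2"
        proof (rule R)
          have "\<bar>Re x - 4 * of_int w\<bar> \<le> 1" using abs_Re_le_cmod[of "a - x"] x by (simp add: a_def dist_norm)
          moreover have "\<bar>real_of_int w\<bar> \<ge> 1" using \<open>w \<noteq> 0\<close> by linarith
          ultimately have "\<bar>Re x\<bar> \<ge> 3" by linarith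
          thus "\<bar>Re x\<bar> \<ge> 1 / 2" by simp
          have "dist s x < 2" using dist_triangle[of s x a] w x by (simp add: a_def)
          hence "norm s \<le> norm x + 2" using norm_triangle_ineq2[of s x] by (simp add: dist_norm)
          thus "norm x \<ge> R" using s(2) by simp
          fix v :: int
          \<comment> \<open>The points 4v are at least 4 apart, so the circle keeps distance 3 from
            all of them except its centre. From the centre the distance is exactly 1, which the
            nonstrict condition admits.\<close>
          show "dist x (4 * of_int v) \<ge> 1"
          proof (cases "v = w")
            case False
            have "\<bar>real_of_int (w - v)\<bar> \<ge> 1" using False by linarith
            moreover have "dist a (4 * of_int v) = 4 * \<bar>real_of_int (w - v)\<bar>"
            proof -
              have "a - 4 * of_int v = of_real (4 * real_of_int (w - v))" by (simp add: a_def)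
              thus ?thesis unfolding dist_norm by (simp only: norm_of_real abs_mult abs_numeral)
            qed
            ultimately have "4 * 1 \<le> dist a (4 * of_int v)" by (simp only: mult_left_mono zero_le_numeral)
            hence "4 * 1 \<le> 1 + dist x (4 * of_int v)" using dist_triangle[of a "4 * of_int v" x] unfolding x
              by (rule order.trans)
            thus ?thesis by simp
          qed (use x in \<open>simp add: a_def dist_commute\<close>)
        qed
        thus ?thesis by simp
      qed
      have "norm (\<Delta> s) \<le> \<epsilon> / 2"
      proof (rule maximum_modulus_frontier[of \<Delta> "ball a 1"])
        show "\<Delta> holomorphic_on interior (ball a 1)" by (rule holomorphic_on_subset[OF hol]) auto
        show "continuous_on (closure (ball a 1)) \<Delta>"
          by (rule holomorphic_on_imp_continuous_on[OF holomorphic_on_subset[OF hol]]) auto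
        show "s \<in> ball a 1" using w by (simp add: a_def dist_commute)
        show "norm (\<Delta> z) \<le> \<epsilon> / 2" if "z \<in> frontier (ball a 1)" for z
          using that by (intro bound) (simp add: frontier_ball)
      qed auto
      thus ?thesis using \<epsilon> by linarith
    qed
    thus ?thesis by blast
  qed
  thus ?thesis using hol eq by blast
qed

end
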